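(* Let $X=(X_t)_{t\in\mathbb{R}}$ be a two-sided real-valued L\'evy process with $X_0=0$ and $\mathbb{E}[X_1^+]<\infty$, and let $\alpha>\mathbb{E}[X_1]$. The random closed set \[ \mathcal{H}_\alpha:=\Big\{t\in\mathbb{R}: X_t\wedge X_{t-}-\alpha t=\inf_{u\le t}(X_u-\alpha u)\Big\} \] is stationary (for every $a\in\mathbb{R}$, $\mathcal{H}_\alpha+a$ has the same distribution as $\mathcal{H}_\alpha$) and regenerative.
   Context: A two-sided L\'evy process is a real-valued process indexed by $\mathbb{R}$ with c\`adl\`ag paths and stationary independent increments. Let $\Omega^\leftrightarrow$ be the class of closed subsets of $\mathbb{R}$ and $\Omega^\rightarrow$ the class of closed subsets of $\mathbb{R}_+$. For $\omega\in\Omega^\leftrightarrow$ and $t\in\mathbb{R}$ let $d_t(\omega)=\inf\{s>t: s\in\omega\}$ (with $\inf\emptyset=+\infty$), $r_t(\omega)=d_t(\omega)-t$, and $\tau_t(\omega)=\mathrm{cl}\big((\omega-t)\cap(0,\infty)\big)$. Let $\mathcal{G}^\leftrightarrow=\sigma\{r_s: s\in\mathbb{R}\}$, $\mathcal{G}^\leftrightarrow_t=\sigma\{r_s:s\le t\}$, $\mathcal{G}^\leftrightarrow_{t+}=\bigcap_{\epsilon>0}\mathcal{G}^\leftrightarrow_{t+\epsilon}$, and define $\mathcal{G}^\rightarrow$ on $\Omega^\rightarrow$ analogously. A probability measure $\mathbb{Q}^\leftrightarrow$ on $(\Omega^\leftrightarrow,\mathcal{G}^\leftrightarrow)$ is regenerative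 with regeneration law $\mathbb{Q}^\rightarrow$ (a probability on $(\Omega^\rightarrow,\mathcal{G}^\rightarrow)$) if for all $t\in\mathbb{R}$: (i) $\mathbb{Q}^\leftrightarrow\{d_t=+\infty\}=0$, and (ii) for all measurable nonnegative $F$, $\mathbb{Q}^\leftrightarrow[F(\tau_{d_t})\mid\mathcal{G}^\leftrightarrow_{t+}]=\mathbb{Q}^\rightarrow[F]$. A random closed set is regenerative if its law is regenerative for some regeneration law. *)

theory Defs
  imports "HOL-Probability.Probability"
begin

definition two_sided_levy :: "'a measure \<Rightarrow> (real \<Rightarrow> 'a \<Rightarrow> real) \<Rightarrow> bool" where
  "two_sided_levy M X \<longleftrightarrow>
     prob_space M \<and>
     (\<forall>t. X t \<in> borel_measurable M) \<and>
     (\<forall>\<omega>\<in>space M. \<forall>t. continuous (at_right t) (\<lambda>s. X s \<omega>) \<and>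
                          (\<exists>l. ((\<lambda>s. X s \<omega>) \<longlongrightarrow> l) (at_left t))) \<and>
     (\<forall>s t. distr M borel (\<lambda>\<omega>. X (s + t) \<omega> - X s \<omega>) = distr M borel (\<lambda>\<omega>. X t \<omega> - X 0 \<omega>)) \<and>
     (\<forall>(n::nat) (tt::nat \<Rightarrow> real). (\<forall>i<n. tt i < tt (Suc i)) \<longrightarrow>
         prob_space.indep_vars M (\<lambda>_. borel) (\<lambda>i \<omega>. X (tt (Suc i)) \<omega> - X (tt i) \<omega>) {..<n})"

definition left_lim :: "(real \<Rightarrow> 'a \<Rightarrow> real) \<Rightarrow> real \<Rightarrow> 'a \<Rightarrow> real" where
  "left_lim X t \<omega> = Lim (at_left t) (\<lambda>s. X s \<omega>)"

text \<open>Extended-real expectation E[Y] = E[Y^+] - E[Y^-] (meaningful when E[Y^+] is finite).\<close>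
definition ext_expectation :: "'a measure \<Rightarrow> ('a \<Rightarrow> real) \<Rightarrow> ereal" where
  "ext_expectation M Y =
     enn2ereal (\<integral>\<^sup>+\<omega>. ennreal (max 0 (Y \<omega>)) \<partial>M) - enn2ereal (\<integral>\<^sup>+\<omega>. ennreal (max 0 (- Y \<omega>)) \<partial>M)"

definition H_set :: "(real \<Rightarrow> 'a \<Rightarrow> real) \<Rightarrow> real \<Rightarrow> 'a \<Rightarrow> real set" where
  "H_set X \<alpha> \<omega> = {t. ereal (min (X t \<omega>) (left_lim X t \<omega>) - \<alpha> * t)
                       = (INF u\<in>{..t}. ereal (X u \<omega> - \<alpha> * u))}"

definition d_fun :: "real \<Rightarrow> real set \<Rightarrow> ereal" where
  "d_fun t \<omega> = Inf (ereal ` {s \<in> \<omega>. t < s})"   (* Inf {} = \<infinity> *)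

definition r_fun :: "real \<Rightarrow> real set \<Rightarrow> ereal" where
  "r_fun t \<omega> = d_fun t \<omega> - ereal t"

definition tau_fun :: "real \<Rightarrow> real set \<Rightarrow> real set" where
  "tau_fun t \<omega> = closure ((\<lambda>u. u - t) ` \<omega> \<inter> {0<..})"

definition Omega_bi :: "real set measure" where
  "Omega_bi = sigma {S. closed S}
     {{S. closed S \<and> r_fun s S \<in> B} | s B. B \<in> sets (borel :: ereal measure)}"

definition G_bi :: "real \<Rightarrow> real set measure" where
  "G_bi t = sigma {S. closed S}
     {{S. closed S \<and> r_fun s S \<in> B} | s B. s \<le> t \<and> B \<in> sets (borel :: ereal measure)}"

definition G_bi_plus :: "real \<Rightarrow> real set measure" where
  "G_bi_plus t = sigma {S. closed S} (\<Inter>\<epsilon>\<in>{0<..}. sets (G_bi (t + \<epsilon>)))"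

definition Omega_right :: "real set measure" where
  "Omega_right = sigma {S. closed S \<and> S \<subseteq> {0..}}
     {{S. closed S \<and> S \<subseteq> {0..} \<and> r_fun s S \<in> B} | s B. 0 \<le> s \<and> B \<in> sets (borel :: ereal measure)}"

definition regenerative_with :: "real set measure \<Rightarrow> real set measure \<Rightarrow> bool" where
  "regenerative_with Q Q' \<longleftrightarrow>
     prob_space Q \<and> sets Q = sets Omega_bi \<and>
     prob_space Q' \<and> sets Q' = sets Omega_right \<and>
     (\<forall>t. emeasure Q {\<omega> \<in> space Q. d_fun t \<omega> = \<infinity>} = 0 \<and>
          (\<forall>F \<in> borel_measurable Omega_right.
             AE \<omega> in Q. nn_cond_exp Q (G_bi_plus t) (\<lambda>\<omega>. F (tau_fun (real_of_ereal (d_fun t \<omega>)) \<omega>)) \<omega>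
                        = (\<integral>\<^sup>+ S. F S \<partial>Q')))"

definition regenerative :: "real set measure \<Rightarrow> bool" where
  "regenerative Q \<longleftrightarrow> (\<exists>Q'. regenerative_with Q Q')"

end

theory Submission
  imports Defs
begin

text \<open>Put \<open>Y\<^sub>t = X\<^sub>t - \<alpha> t\<close>. The set of times at which the infimum of the past of \<open>Y\<close> is reached depends only on the
  increments of \<open>Y\<close>, whence stationarity. As \<open>Y\<close> has negative drift, its infimum over \<open>(-\<infinity>, 0]\<close> is finite and it tends
  to \<open>-\<infinity>\<close> at \<open>+\<infinity>\<close>, so every \<open>d\<^sub>t\<close> is finite. The time \<open>D = d\<^sub>t\<close> is a stopping time. The value \<open>Y\<^sub>D\<close> is the infimum of
  the past: otherwise \<open>Y\<close> would creep down to that infimum and jump up on reaching it, a jump at a predictable time, which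
  the strong Markov property excludes. Hence the infimum times after \<open>D\<close> are those of the path \<open>Y\<^sub>D\<^sub>+\<^sub>u - Y\<^sub>D\<close>, \<open>u \<ge> 0\<close>,
  which by the strong Markov property has the law of \<open>Y\<^sub>u - Y\<^sub>0\<close> and is independent of what happened up to \<open>D\<close>.

  The past and the future at time \<open>q\<close> are both represented by paths on the whole line, constant after and before 0
  respectively, so that a single path space carries them and the events up to \<open>q\<close> are the preimages under the past.\<close>

section \<open>Infimum times of a cadlag path\<close>

text \<open>The obstacle is a path that creeps down to its past infimum and jumps up there: such a
  \<open>D\<close> is an infimum time through its left limit, but a path restarted at
  \<open>Y D\<close> has lost the true level. Ruling this out is what makes the infimum times after
  \<open>D\<close> a functional of the future alone. Two further points shape the proof. The
  hypotheses concern increments at finitely many fixed times, so random sets are described by the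
  open intervals that they hit, hits by rational times, and random times by grid points strictly to
  their right; this strictness makes \<open>T < q\<close> the natural stopping condition, which also
  fits the right limits in \<open>G_bi_plus\<close>. Moreover \<open>X 1\<close> may have mean minus
  infinity, so the drift is exploited through sums of positive and negative parts, never by
  subtracting expectations. What this yields is a bound on a walk; divergence to minus infinity
  comes from applying it with a slope strictly between the mean and \<alpha>.\<close>

definition cadlag :: "(real \<Rightarrow> real) \<Rightarrow> bool" where
  "cadlag y \<longleftrightarrow> (\<forall>t. continuous (at_right t) y \<and> (\<exists>l. (y \<longlongrightarrow> l) (at_left t)))"

definition left_limit :: "(real \<Rightarrow> real) \<Rightarrow> real \<Rightarrow> real" where
  "left_limit y t = Lim (at_left t) y"

text \<open>Comparing with each earlier value replaces the extended real infimum in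
  \<open>H_set\<close>. The inequalities survive adding a constant to the path, so only increments
  matter.\<close>

definition inf_times :: "(real \<Rightarrow> real) \<Rightarrow> real set" where
  "inf_times y = {t. \<forall>u<t. min (y t) (left_limit y t) \<le> y u}"

lemma cadlag_right: "cadlag y \<Longrightarrow> (y \<longlongrightarrow> y t) (at_right t)"
  by (simp add: cadlag_def continuous_within)

lemma left_limit_eq: "(y \<longlongrightarrow> l) (at_left t) \<Longrightarrow> left_limit y t = l"
  by (simp add: left_limit_def tendsto_Lim)

lemma cadlag_left: "cadlag y \<Longrightarrow> (y \<longlongrightarrow> left_limit y t) (at_left t)"
  by (metis cadlag_def left_limit_eq)

lemma cadlagI:
  assumes "\<And>t. (y \<longlongrightarrow> y t) (at_right t)" "\<And>t. (y \<longlongrightarrow> l t) (at_left t)"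
  shows "cadlag y"
  using assms by (auto simp: cadlag_def continuous_within)

text \<open>Together with \<open>cadlag_near_below\<close> this identifies the minimum of value and
  left limit with the lower limit of the path at \<open>t\<close>, the point \<open>t\<close>
  included. It is therefore lower semicontinuous in \<open>t\<close>.\<close>

lemma cadlag_locally_above:
  assumes "cadlag y" "c < min (y t) (left_limit y t)"
  shows "\<exists>d>0. \<forall>u\<in>{t-d<..<t+d}. c < y u"
proof -
  have "eventually (\<lambda>u. c < y u) (at_right t)"
    using order_tendstoD(1)[OF cadlag_right[OF assms(1)]] assms(2) by auto
  then obtain b where b: "b > t" "\<And>u. t < u \<Longrightarrow> u < b \<Longrightarrow> c < y u"
    by (auto simp: eventually_at_right[OF less_add_one])
  have "eventually (\<lambda>u. c < y u) (at_left t)"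
    using order_tendstoD(1)[OF cadlag_left[OF assms(1)]] assms(2) by auto
  then obtain a where a: "a < t" "\<And>u. a < u \<Longrightarrow> u < t \<Longrightarrow> c < y u"
    by (auto simp: eventually_at_left[of "t - 1" t])
  show ?thesis
  proof (intro exI[of _ "min (b - t) (t - a)"] conjI ballI)
    fix u assume "u \<in> {t - min (b - t) (t - a)<..<t + min (b - t) (t - a)}"
    then have "a < u" "u < b" by auto
    then show "c < y u" using a(2)[of u] b(2)[of u] assms(2) by (cases u t rule: linorder_cases) auto
  qed (use a b in auto)
qed

lemma cadlag_near_below:
  assumes "cadlag y" "min (y t) (left_limit y t) < c" "p < t" "t < q"
  shows "\<exists>u\<in>{p<..<q}. y u < c"
proof (cases "y t < c")
  case True
  then show ?thesis using assms by auto
next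
  case False
  then have "left_limit y t < c" using assms by auto
  then have "eventually (\<lambda>u. y u < c) (at_left t)"
    using order_tendstoD(2)[OF cadlag_left[OF assms(1)]] by auto
  then obtain a where a: "a < t" "\<And>u. a < u \<Longrightarrow> u < t \<Longrightarrow> y u < c"
    by (auto simp: eventually_at_left[of "t - 1" t])
  obtain u where "max a p < u" "u < t" using dense[of "max a p" t] a assms by auto
  then show ?thesis using a assms by (intro bexI[of _ u]) auto
qed

lemma cadlag_rational_below:
  assumes "cadlag y" "y v < c" "v < p"
  shows "\<exists>v'\<in>\<rat>. v < v' \<and> v' < p \<and> y v' < c"
proof -
  have "eventually (\<lambda>u. y u < c) (at_right v)"
    using order_tendstoD(2)[OF cadlag_right[OF assms(1)]] assms(2) by auto
  then obtain b where b: "b > v" "\<And>u. v < u \<Longrightarrow> u < b \<Longrightarrow> y u < c"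
    by (auto simp: eventually_at_right[OF less_add_one])
  obtain u where "u \<in> \<rat>" "v < u" "u < min b p" using Rats_dense_in_real[of v "min b p"] b assms by auto
  then show ?thesis using b by (intro bexI[of _ u]) auto
qed

text \<open>Failing to be an infimum time is an open condition by lower semicontinuity. Passing to
  left limits keeps only weak inequalities, hence the level \<open>e\<close> strictly above the
  earlier value \<open>y v\<close>.\<close>

lemma closed_inf_times:
  assumes "cadlag y"
  shows "closed (inf_times y)"
  unfolding closed_def open_dist
proof (intro ballI)
  fix t assume "t \<in> - inf_times y"
  then obtain v where v: "v < t" "y v < min (y t) (left_limit y t)"
    by (auto simp: inf_times_def not_le)
  obtain e where e: "y v < e" "e < min (y t) (left_limit y t)" using dense[OF v(2)] by auto
  obtain d where d: "d > 0" "\<forall>u\<in>{t-d<..<t+d}. e < y u" using cadlag_locally_above[OF assms e(2)] by auto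
  show "\<exists>r>0. \<forall>u. dist u t < r \<longrightarrow> u \<in> - inf_times y"
  proof (intro exI[of _ "min d (t - v)"] conjI allI impI)
    fix u assume u: "dist u t < min d (t - v)"
    then have u': "u \<in> {t-d<..<t+d}" "v < u" by (auto simp: dist_real_def)
    have "e \<le> left_limit y u"
    proof (rule tendsto_lowerbound[OF cadlag_left[OF assms, of u]])
      show "eventually (\<lambda>x. e \<le> y x) (at_left u)"
        using u' d(2) by (intro eventually_at_leftI[of "t - d"]) (auto intro!: less_imp_le)
    qed simp
    moreover have "e < y u" using u' d by auto
    ultimately have "y v < min (y u) (left_limit y u)" using e by auto
    then show "u \<in> - inf_times y" using u' by (auto simp: inf_times_def not_le intro!: exI[of _ v])
  qed (use d v in auto)
qed

text \<open>If no point of \<open>[p, q]\<close> were an infimum time, then each of them would have a neighbourhood on which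
  the path stays above one of its earlier values; the lowest of finitely many such values is taken before \<open>p\<close>.\<close>

lemma inf_times_meet_interval:
  assumes y: "cadlag y" and "p < q"
    and low: "\<And>v e. v < p \<Longrightarrow> e > 0 \<Longrightarrow> \<exists>u\<in>{p<..<q}. y u < y v + e"
  shows "inf_times y \<inter> {p..q} \<noteq> {}"
proof (rule ccontr)
  assume none: "\<not> ?thesis"
  have "\<exists>v e d. v < t \<and> e > 0 \<and> d > 0 \<and> (\<forall>u\<in>{t-d<..<t+d}. y v + e < y u)" if "t \<in> {p..q}" for t
  proof -
    from that none have "t \<notin> inf_times y" by auto
    then obtain v where v: "v < t" "y v < min (y t) (left_limit y t)"
      by (auto simp: inf_times_def not_le)
    obtain e where e: "y v < e" "e < min (y t) (left_limit y t)" using dense[OF v(2)] by auto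
    obtain d where d: "d > 0" "\<forall>u\<in>{t-d<..<t+d}. e < y u" using cadlag_locally_above[OF y e(2)] by auto
    show ?thesis using v e d by (intro exI[of _ v] exI[of _ "e - y v"] exI[of _ d]) auto
  qed
  then obtain v e d where ved: "\<And>t. t \<in> {p..q} \<Longrightarrow> v t < t \<and> e t > 0 \<and> d t > 0 \<and> (\<forall>u\<in>{t-d t<..<t+d t}. y (v t) + e t < y u)"
    by metis
  have "compact {p..q}" by simp
  then obtain F where F: "F \<subseteq> {p..q}" "finite F" "{p..q} \<subseteq> (\<Union>t\<in>F. {t-d t<..<t+d t})"
  proof (rule compactE_image[where C="{p..q}" and f="\<lambda>t. {t-d t<..<t+d t}"])
    show "{p..q} \<subseteq> (\<Union>t\<in>{p..q}. {t-d t<..<t+d t})" using ved by force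
  qed (auto intro: that)
  have "F \<noteq> {}" using F \<open>p < q\<close> by force
  define m where "m = Min ((\<lambda>t. y (v t)) ` F)"
  have "m \<in> (\<lambda>t. y (v t)) ` F"
    unfolding m_def using F \<open>F \<noteq> {}\<close> by (intro Min_in) auto
  then obtain t0 where t0: "t0 \<in> F" "m = y (v t0)" by auto
  define e0 where "e0 = Min (e ` F)"
  have "e0 > 0" using F \<open>F \<noteq> {}\<close> ved by (auto simp: e0_def)
  have above: "y u > m + e0" if u: "u \<in> {p..q}" for u
  proof -
    obtain t where t: "t \<in> F" "u \<in> {t-d t<..<t+d t}" using F u by blast
    have "m \<le> y (v t)" "e0 \<le> e t" using F t by (auto simp: m_def e0_def)
    then show ?thesis using ved[of t] t F(1) by fastforce
  qed
  have "v t0 < p"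
  proof (rule ccontr)
    assume "\<not> v t0 < p"
    then have "v t0 \<in> {p..q}" using ved[of t0] t0 F by (auto simp: subset_iff)
    from above[OF this] show False using t0 \<open>e0 > 0\<close> by auto
  qed
  from low[OF this \<open>e0 > 0\<close>] obtain u where "u \<in> {p<..<q}" "y u < y (v t0) + e0" by auto
  with above[of u] t0 show False by auto
qed

text \<open>A countable form of: the infimum over \<open>(p, q)\<close> is at most the infimum over
  all times before \<open>p\<close>. Neither infimum has to be attained, which is why a slack
  \<open>1 / Suc n\<close> appears.\<close>

definition rational_record :: "(real \<Rightarrow> real) \<Rightarrow> real \<Rightarrow> real \<Rightarrow> bool" where
  "rational_record y p q \<longleftrightarrow>
     (\<forall>v\<in>\<rat>. v < p \<longrightarrow> (\<forall>n::nat. \<exists>u\<in>\<rat>. p < u \<and> u < q \<and> y u < y v + 1 / Suc n))"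

lemma rational_recordI:
  assumes y: "cadlag y" and low: "\<And>v e. v < p \<Longrightarrow> e > 0 \<Longrightarrow> \<exists>u\<in>{p<..<q}. y u < y v + e"
  shows "rational_record y p q"
  unfolding rational_record_def
proof (intro ballI impI allI)
  fix v :: real and n :: nat assume "v < p"
  with low[of v "1 / Suc n"] obtain u where u: "p < u" "u < q" "y u < y v + 1 / Suc n" by auto
  obtain u' where "u' \<in> \<rat>" "u < u'" "u' < q" "y u' < y v + 1 / Suc n"
    using cadlag_rational_below[OF y u(3,2)] by blast
  then show "\<exists>u\<in>\<rat>. p < u \<and> u < q \<and> y u < y v + 1 / Suc n" using u by (intro bexI[of _ u']) auto
qed

lemma rational_recordD:
  assumes y: "cadlag y" and r: "rational_record y p q" and "v < p" "e > 0"
  shows "\<exists>u\<in>{p<..<q}. y u < y v + e"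
proof -
  obtain v' where v': "v' \<in> \<rat>" "v' < p" "y v' < y v + e / 2"
    using cadlag_rational_below[OF y, of v "y v + e / 2" p] assms by auto
  obtain n :: nat where n: "1 / Suc n < e / 2"
    using nat_approx_posE[of "e / 2"] \<open>e > 0\<close> by (auto simp: divide_simps)
  obtain u where "p < u" "u < q" "y u < y v' + 1 / Suc n"
    using r v' unfolding rational_record_def by blast
  then show ?thesis using v' n by (intro bexI[of _ u]) auto
qed

text \<open>This reduces hits of the uncountable set of infimum times to countably many coordinates.
  An infimum time makes every rational interval around it a record; conversely a record interval has
  an infimum time in its closure, which still lies in \<open>(s, c)\<close>.\<close>

lemma inf_times_hit_iff:
  assumes y: "cadlag y"
  shows "inf_times y \<inter> {s<..<c} \<noteq> {} \<longleftrightarrow>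
    (\<exists>p\<in>\<rat>. \<exists>q\<in>\<rat>. s < p \<and> p < q \<and> q < c \<and> rational_record y p q)"
proof
  assume "inf_times y \<inter> {s<..<c} \<noteq> {}"
  then obtain t where t: "t \<in> inf_times y" "s < t" "t < c" by auto
  obtain p where p: "p \<in> \<rat>" "s < p" "p < t" using Rats_dense_in_real t by blast
  obtain q where q: "q \<in> \<rat>" "t < q" "q < c" using Rats_dense_in_real t by blast
  have "rational_record y p q"
  proof (rule rational_recordI[OF y])
    fix v e :: real assume "v < p" "e > 0"
    then have "min (y t) (left_limit y t) \<le> y v" using t p by (auto simp: inf_times_def)
    then have "min (y t) (left_limit y t) < y v + e" using \<open>e > 0\<close> by linarith
    then show "\<exists>u\<in>{p<..<q}. y u < y v + e" using cadlag_near_below[OF y] p q by auto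
  qed
  then show "\<exists>p\<in>\<rat>. \<exists>q\<in>\<rat>. s < p \<and> p < q \<and> q < c \<and> rational_record y p q"
    using p q by (intro bexI[of _ p] bexI[of _ q]) auto
next
  assume "\<exists>p\<in>\<rat>. \<exists>q\<in>\<rat>. s < p \<and> p < q \<and> q < c \<and> rational_record y p q"
  then obtain p q where pq: "s < p" "p < q" "q < c" "rational_record y p q" by auto
  from inf_times_meet_interval[OF y pq(2) rational_recordD[OF y pq(4)]] pq
  show "inf_times y \<inter> {s<..<c} \<noteq> {}" by force
qed

section \<open>Shifting a path, and freezing it after or before time 0\<close>

lemma filterlim_shift_at_left: "filterlim (\<lambda>u. a + u) (at_left (a + t)) (at_left (t::real))"
  unfolding filterlim_at
  by (auto intro!: tendsto_intros eventually_at_leftI[of "t - 1"])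

lemma filterlim_shift_at_right: "filterlim (\<lambda>u. a + u) (at_right (a + t)) (at_right (t::real))"
  unfolding filterlim_at
  by (auto intro!: tendsto_intros eventually_at_rightI[of _ "t + 1"])

lemma tendsto_left_shift:
  "cadlag y \<Longrightarrow> ((\<lambda>u. y (a + u) - c) \<longlongrightarrow> left_limit y (a + t) - c) (at_left t)"
  by (intro tendsto_intros filterlim_compose[OF cadlag_left filterlim_shift_at_left])

lemma cadlag_shift: "cadlag y \<Longrightarrow> cadlag (\<lambda>u. y (a + u) - c)"
  by (rule cadlagI[OF _ tendsto_left_shift])
     (intro tendsto_diff tendsto_const filterlim_compose[OF cadlag_right filterlim_shift_at_right])

lemma cadlag_add:
  assumes "cadlag x" "cadlag y"
  shows "cadlag (\<lambda>u. x u + y u)"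
  by (rule cadlagI[where l="\<lambda>t. left_limit x t + left_limit y t"]) (intro tendsto_add cadlag_right cadlag_left assms)+

lemma tendsto_left_min:
  assumes "cadlag y" "t \<le> 0"
  shows "((\<lambda>u. y (min u 0)) \<longlongrightarrow> left_limit y t) (at_left t)"
proof (rule Lim_transform_eventually[OF cadlag_left[OF assms(1)]])
  show "\<forall>\<^sub>F u in at_left t. y u = y (min u 0)"
    using assms(2) by (intro eventually_at_leftI[of "t - 1"]) (auto simp: min_def)
qed

lemma tendsto_left_max:
  assumes "cadlag y" "t > 0"
  shows "((\<lambda>u. y (max u 0)) \<longlongrightarrow> left_limit y t) (at_left t)"
proof (rule Lim_transform_eventually[OF cadlag_left[OF assms(1)]])
  show "\<forall>\<^sub>F u in at_left t. y u = y (max u 0)"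
    using assms(2) by (intro eventually_at_leftI[of "0"]) (auto simp: max_def)
qed

lemma cadlag_min:
  assumes y: "cadlag y"
  shows "cadlag (\<lambda>u. y (min u 0))"
proof (rule cadlagI)
  fix t :: real
  show "((\<lambda>u. y (min u 0)) \<longlongrightarrow> y (min t 0)) (at_right t)"
  proof (cases "t < 0")
    case True
    have "\<forall>\<^sub>F u in at_right t. y u = y (min u 0)"
      using True by (intro eventually_at_rightI[of _ 0]) (auto simp: min_def)
    from Lim_transform_eventually[OF cadlag_right[OF y] this] True show ?thesis by simp
  next
    case False
    have "\<forall>\<^sub>F u in at_right t. y (min t 0) = y (min u 0)"
      using False by (intro eventually_at_rightI[of _ "t + 1"]) (auto simp: min_def)
    from Lim_transform_eventually[OF tendsto_const this] show ?thesis .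
  qed
  show "((\<lambda>u. y (min u 0)) \<longlongrightarrow> (if t \<le> 0 then left_limit y t else y 0)) (at_left t)"
  proof (cases "t \<le> 0")
    case True
    then show ?thesis using tendsto_left_min[OF y] by simp
  next
    case False
    have "\<forall>\<^sub>F u in at_left t. y 0 = y (min u 0)"
      using False by (intro eventually_at_leftI[of 0]) (auto simp: min_def)
    from Lim_transform_eventually[OF tendsto_const this] False show ?thesis by simp
  qed
qed

lemma cadlag_max:
  assumes y: "cadlag y"
  shows "cadlag (\<lambda>u. y (max u 0))"
proof (rule cadlagI)
  fix t :: real
  show "((\<lambda>u. y (max u 0)) \<longlongrightarrow> y (max t 0)) (at_right t)"
  proof (cases "t < 0")
    case False
    have "\<forall>\<^sub>F u in at_right t. y u = y (max u 0)"
      using False by (intro eventually_at_rightI[of _ "t + 1"]) (auto simp: max_def)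
    from Lim_transform_eventually[OF cadlag_right[OF y] this] False show ?thesis by (simp add: max_def)
  next
    case True
    have "\<forall>\<^sub>F u in at_right t. y (max t 0) = y (max u 0)"
      using True by (intro eventually_at_rightI[of _ 0]) (auto simp: max_def)
    from Lim_transform_eventually[OF tendsto_const this] show ?thesis .
  qed
  show "((\<lambda>u. y (max u 0)) \<longlongrightarrow> (if t > 0 then left_limit y t else y 0)) (at_left t)"
  proof (cases "t > 0")
    case True
    then show ?thesis using tendsto_left_max[OF y] by simp
  next
    case False
    have "\<forall>\<^sub>F u in at_left t. y 0 = y (max u 0)"
      using False by (intro eventually_at_leftI[of "t - 1"]) (auto simp: max_def)
    from Lim_transform_eventually[OF tendsto_const this] False show ?thesis by simp
  qed
qed

lemma inf_times_shift:
  assumes y: "cadlag y"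
  shows "t \<in> inf_times (\<lambda>u. y (a + u) - c) \<longleftrightarrow> a + t \<in> inf_times y"
proof -
  have eq: "left_limit (\<lambda>u. y (a + u) - c) t = left_limit y (a + t) - c"
    by (rule left_limit_eq[OF tendsto_left_shift[OF y]])
  have "(\<forall>u<t. min (y (a + t)) (left_limit y (a + t)) \<le> y (a + u)) \<longleftrightarrow>
        (\<forall>u<a + t. min (y (a + t)) (left_limit y (a + t)) \<le> y u)"
    by (metis add.commute add_less_cancel_left diff_add_cancel)
  then show ?thesis unfolding inf_times_def mem_Collect_eq eq
    by (simp add: min_def split: if_splits)
qed

lemma inf_times_min:
  assumes y: "cadlag y" and "t < 0"
  shows "t \<in> inf_times (\<lambda>u. y (min u 0)) \<longleftrightarrow> t \<in> inf_times y"
  using assms left_limit_eq[OF tendsto_left_min[OF y, of t]] by (auto simp: inf_times_def)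

text \<open>All values before 0 collapse to \<open>y 0\<close>, and 0 already belongs to the tested
  times because \<open>t > 0\<close>.\<close>

lemma inf_times_max:
  assumes y: "cadlag y" and "t > 0"
  shows "t \<in> inf_times (\<lambda>u. y (max u 0)) \<longleftrightarrow> (\<forall>u<t. u \<ge> 0 \<longrightarrow> min (y t) (left_limit y t) \<le> y u)"
proof -
  have "min (y t) (left_limit y t) \<le> y (max u 0)"
    if "\<forall>u<t. 0 \<le> u \<longrightarrow> min (y t) (left_limit y t) \<le> y u" "u < t" for u
    using that \<open>t > 0\<close> by auto
  moreover have "min (y t) (left_limit y t) \<le> y u"
    if "\<forall>u<t. min (y t) (left_limit y t) \<le> y (max u 0)" "u < t" "0 \<le> u" for u
    using that(1)[rule_format, of u] that by (simp add: max_absorb1)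
  ultimately show ?thesis
    using \<open>t > 0\<close> left_limit_eq[OF tendsto_left_max[OF y \<open>t > 0\<close>]] by (auto simp: inf_times_def simp del: min_less_iff_conj min.bounded_iff)
qed

section \<open>Measurability on path space and on the spaces of closed sets\<close>

text \<open>The carrier is restricted to cadlag paths because for these the coordinates at rational
  times decide which intervals contain infimum times.\<close>

definition path_space :: "(real \<Rightarrow> real) measure" where
  "path_space = sigma {x. cadlag x} {{x. cadlag x \<and> x u < c} | u c. True}"

definition path_box :: "real set \<Rightarrow> (real \<Rightarrow> real) \<Rightarrow> (real \<Rightarrow> real) set" where
  "path_box U c = {x. cadlag x \<and> (\<forall>u\<in>U. x u < c u)}"

lemma space_path_space [simp]: "space path_space = {x. cadlag x}"
  unfolding path_space_def by (rule space_measure_of) auto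

lemma sets_path_space:
  "sets path_space = sigma_sets {x. cadlag x} {{x. cadlag x \<and> x u < c} | u c. True}"
  unfolding path_space_def by (rule sets_measure_of) auto

lemma measurable_coordinate [measurable]: "(\<lambda>x. x u) \<in> borel_measurable path_space"
  unfolding borel_measurable_iff_less
  by (auto simp: sets_path_space)

lemma measurable_path_spaceI:
  assumes "\<And>\<omega>. \<omega> \<in> space M \<Longrightarrow> cadlag (f \<omega>)" "\<And>u. (\<lambda>\<omega>. f \<omega> u) \<in> borel_measurable M"
  shows "f \<in> measurable M path_space"
  unfolding path_space_def
proof (rule measurable_measure_of)
  fix B assume "B \<in> {{x. cadlag x \<and> x u < c} | u c. True}"
  then obtain u c where B: "B = {x. cadlag x \<and> x u < c}" by auto
  have "f -` B \<inter> space M = {\<omega> \<in> space M. f \<omega> u < c}" using assms(1) by (auto simp: B)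
  also have "\<dots> \<in> sets M" using assms(2)[of u] by measurable
  finally show "f -` B \<inter> space M \<in> sets M" .
qed (use assms(1) in auto)

lemma path_box_sets [measurable]: "finite U \<Longrightarrow> path_box U c \<in> sets path_space"
proof -
  assume U: "finite U"
  have "path_box U c = {x \<in> space path_space. \<forall>u\<in>U. x u < c u}" by (auto simp: path_box_def)
  also have "\<dots> \<in> sets path_space" using U by measurable
  finally show ?thesis .
qed

lemma Int_stable_path_box: "Int_stable {path_box U c | U c. finite U}"
proof (rule Int_stableI)
  fix A B assume "A \<in> {path_box U c | U c. finite U}" "B \<in> {path_box U c | U c. finite U}"
  then obtain U c V d where *: "A = path_box U c" "B = path_box V d" "finite U" "finite V" by auto
  define e where "e u = (if u \<in> U then if u \<in> V then min (c u) (d u) else c u else d u)" for u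
  have "A \<inter> B = path_box (U \<union> V) e" by (auto simp: * path_box_def e_def split: if_splits)
  then show "A \<inter> B \<in> {path_box U c | U c. finite U}" using * by blast
qed

lemma sets_path_space_box: "sets path_space = sigma_sets {x. cadlag x} {path_box U c | U c. finite U}"
proof (intro equalityI)
  show "sets path_space \<subseteq> sigma_sets {x. cadlag x} {path_box U c | U c. finite U}"
    unfolding sets_path_space
  proof (rule sigma_sets_mono')
    show "{{x. cadlag x \<and> x u < c} | u c. True} \<subseteq> {path_box U c | U c. finite U}"
    proof
      fix A assume "A \<in> {{x. cadlag x \<and> x u < c} | u c. True}"
      then obtain u c where "A = {x. cadlag x \<and> x u < c}" by auto
      then have "A = path_box {u} (\<lambda>_. c)" by (auto simp: path_box_def)
      then show "A \<in> {path_box U c | U c. finite U}" by blast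
    qed
  qed
  have "sigma_sets (space path_space) {path_box U c | U c. finite U} \<subseteq> sets path_space"
    by (rule sets.sigma_sets_subset) auto
  then show "sigma_sets {x. cadlag x} {path_box U c | U c. finite U} \<subseteq> sets path_space" by simp
qed

lemma path_measure_eqI:
  assumes "finite_measure \<mu>" "sets \<mu> = sets path_space" "sets \<nu> = sets path_space"
    and eq: "\<And>U c. finite U \<Longrightarrow> emeasure \<mu> (path_box U c) = emeasure \<nu> (path_box U c)"
  shows "\<mu> = \<nu>"
proof (rule measure_eqI_generator_eq[where E="{path_box U c | U c. finite U}" and \<Omega>="{x. cadlag x}" and A="\<lambda>_. path_box {} (\<lambda>_. 0)"])
  show "emeasure \<mu> (path_box {} (\<lambda>_. 0)) \<noteq> \<infinity>" for i :: nat
    using finite_measure.emeasure_finite[OF assms(1)] by auto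
  show "(\<Union>i::nat. path_box {} (\<lambda>_. 0)) = {x. cadlag x}" by (auto simp: path_box_def)
  show "range (\<lambda>i::nat. path_box {} (\<lambda>_. 0)) \<subseteq> {path_box U c | U c. finite U}" by auto
  show "{path_box U c | U c. finite U} \<subseteq> Pow {x. cadlag x}" by (auto simp: path_box_def)
qed (use assms Int_stable_path_box sets_path_space_box in auto)

lemma pred_Ball_Rats [measurable (raw)]:
  fixes P :: "real \<Rightarrow> 'a \<Rightarrow> bool"
  assumes "\<And>v. Measurable.pred M (P v)"
  shows "Measurable.pred M (\<lambda>x. \<forall>v\<in>\<rat>. P v x)"
  using assms unfolding pred_def by (intro sets.sets_Collect_countable_All' countable_rat)

lemma pred_Bex_Rats [measurable (raw)]:
  fixes P :: "real \<Rightarrow> 'a \<Rightarrow> bool"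
  assumes "\<And>v. Measurable.pred M (P v)"
  shows "Measurable.pred M (\<lambda>x. \<exists>v\<in>\<rat>. P v x)"
  using assms unfolding pred_def by (intro sets.sets_Collect_countable_Ex' countable_rat)

lemma measurable_rational_record [measurable]:
  "Measurable.pred path_space (\<lambda>x. rational_record x p q)"
  unfolding rational_record_def by measurable

section \<open>Hitting events and measurability of random closed sets\<close>

lemma d_fun_less_iff: "d_fun s S < y \<longleftrightarrow> (\<exists>h\<in>S. s < h \<and> ereal h < y)"
  by (auto simp: d_fun_def Inf_less_iff)

lemma d_fun_less_real_iff: "d_fun s S < ereal c \<longleftrightarrow> S \<inter> {s<..<c} \<noteq> {}"
  by (auto simp: d_fun_less_iff)

lemma d_fun_less_infinity_iff: "d_fun s S < \<infinity> \<longleftrightarrow> (\<exists>n::nat. S \<inter> {s<..<real n} \<noteq> {})"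
proof -
  have "\<exists>n::nat. h < real n" for h by (rule reals_Archimedean2)
  then have "\<exists>n::nat. S \<inter> {s<..<real n} \<noteq> {}" if "h \<in> S" "s < h" for h
    using that by (metis IntI empty_iff greaterThanLessThan_iff)
  then have "(\<exists>h\<in>S. s < h) \<longleftrightarrow> (\<exists>n::nat. S \<inter> {s<..<real n} \<noteq> {})" by auto
  then show ?thesis by (simp only: d_fun_less_iff) simp
qed

text \<open>The value of \<open>d_fun s\<close> is determined by which intervals starting at
  \<open>s\<close> are hit, so later measurability proofs only have to treat hitting events.\<close>

lemma borel_measurable_d_fun:
  assumes hit: "\<And>c. {\<omega> \<in> space M. f \<omega> \<inter> {s<..<c} \<noteq> {}} \<in> sets M"
  shows "(\<lambda>\<omega>. d_fun s (f \<omega>)) \<in> borel_measurable M"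
proof (rule borel_measurableI_less)
  fix y :: ereal
  show "{\<omega> \<in> space M. d_fun s (f \<omega>) < y} \<in> sets M"
  proof (cases y)
    case (real c)
    then show ?thesis using hit[of c] by (simp add: d_fun_less_real_iff)
  next
    case PInf
    have "{\<omega> \<in> space M. \<exists>n::nat. f \<omega> \<inter> {s<..<real n} \<noteq> {}} \<in> sets M"
      by (intro sets.sets_Collect_countable_Ex hit)
    then show ?thesis unfolding PInf d_fun_less_infinity_iff .
  qed auto
qed

lemma r_fun_measurable:
  assumes "(\<lambda>\<omega>. d_fun s (f \<omega>)) \<in> borel_measurable M"
  shows "(\<lambda>\<omega>. r_fun s (f \<omega>)) \<in> borel_measurable M"
  unfolding r_fun_def using assms by measurable

lemma space_Omega_bi [simp]: "space Omega_bi = {S. closed S}"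
  unfolding Omega_bi_def by (rule space_measure_of) auto

lemma sets_Omega_bi: "sets Omega_bi = sigma_sets {S. closed S}
     {{S. closed S \<and> r_fun s S \<in> B} | s B. B \<in> sets (borel :: ereal measure)}"
  unfolding Omega_bi_def by (rule sets_measure_of) auto

lemma measurable_Omega_biI:
  assumes cl: "\<And>\<omega>. \<omega> \<in> space M \<Longrightarrow> closed (f \<omega>)"
    and hit: "\<And>s c. {\<omega> \<in> space M. f \<omega> \<inter> {s<..<c} \<noteq> {}} \<in> sets M"
  shows "f \<in> measurable M Omega_bi"
  unfolding Omega_bi_def
proof (rule measurable_measure_of)
  fix B assume "B \<in> {{S. closed S \<and> r_fun s S \<in> B} | s B. B \<in> sets (borel :: ereal measure)}"
  then obtain s C where B: "B = {S. closed S \<and> r_fun s S \<in> C}" "C \<in> sets (borel :: ereal measure)" by auto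
  have "f -` B \<inter> space M = (\<lambda>\<omega>. r_fun s (f \<omega>)) -` C \<inter> space M" using cl by (auto simp: B)
  also have "\<dots> \<in> sets M"
    by (rule measurable_sets[OF r_fun_measurable[OF borel_measurable_d_fun] B(2)]) (rule hit)
  finally show "f -` B \<inter> space M \<in> sets M" .
qed (use cl in auto)

lemma measurable_Omega_rightI:
  assumes cl: "\<And>\<omega>. \<omega> \<in> space M \<Longrightarrow> closed (f \<omega>) \<and> f \<omega> \<subseteq> {0..}"
    and hit: "\<And>s c. 0 \<le> s \<Longrightarrow> {\<omega> \<in> space M. f \<omega> \<inter> {s<..<c} \<noteq> {}} \<in> sets M"
  shows "f \<in> measurable M Omega_right"
  unfolding Omega_right_def
proof (rule measurable_measure_of)
  fix B assume "B \<in> {{S. closed S \<and> S \<subseteq> {0..} \<and> r_fun s S \<in> B} | s B. 0 \<le> s \<and> B \<in> sets (borel :: ereal measure)}"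
  then obtain s C where B: "B = {S. closed S \<and> S \<subseteq> {0..} \<and> r_fun s S \<in> C}" "0 \<le> s" "C \<in> sets (borel :: ereal measure)" by auto
  have "f -` B \<inter> space M = (\<lambda>\<omega>. r_fun s (f \<omega>)) -` C \<inter> space M" using cl by (auto simp: B)
  also have "\<dots> \<in> sets M"
    by (rule measurable_sets[OF r_fun_measurable[OF borel_measurable_d_fun] B(3)]) (rule hit[OF B(2)])
  finally show "f -` B \<inter> space M \<in> sets M" .
qed (use cl in auto)

lemma measurable_r_fun: "r_fun s \<in> borel_measurable Omega_bi"
proof (rule measurableI)
  fix B assume "B \<in> sets (borel :: ereal measure)"
  then have "{S. closed S \<and> r_fun s S \<in> B} \<in> sets Omega_bi" unfolding sets_Omega_bi by blast
  moreover have "r_fun s -` B \<inter> space Omega_bi = {S. closed S \<and> r_fun s S \<in> B}" by auto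
  ultimately show "r_fun s -` B \<inter> space Omega_bi \<in> sets Omega_bi" by simp
qed auto

lemma d_fun_eq_r_fun: "d_fun s S = r_fun s S + ereal s"
  unfolding r_fun_def by (cases "d_fun s S") auto

lemma measurable_d_fun [measurable]: "d_fun s \<in> borel_measurable Omega_bi"
proof -
  have "(\<lambda>S. r_fun s S + ereal s) \<in> borel_measurable Omega_bi"
    using measurable_r_fun by measurable
  then show ?thesis by (simp add: d_fun_eq_r_fun[symmetric])
qed

lemma hit_sets_Omega_bi [measurable]: "Measurable.pred Omega_bi (\<lambda>S. S \<inter> {s<..<c} \<noteq> {})"
  unfolding d_fun_less_real_iff[symmetric] by measurable

lemma measurable_inf_times [measurable]: "inf_times \<in> measurable path_space Omega_bi"
proof (rule measurable_Omega_biI)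
  fix s c
  have "{x \<in> space path_space. \<exists>p\<in>\<rat>. \<exists>q\<in>\<rat>. s < p \<and> p < q \<and> q < c \<and> rational_record x p q} \<in> sets path_space"
    by measurable
  moreover have "{x \<in> space path_space. inf_times x \<inter> {s<..<c} \<noteq> {}} =
      {x \<in> space path_space. \<exists>p\<in>\<rat>. \<exists>q\<in>\<rat>. s < p \<and> p < q \<and> q < c \<and> rational_record x p q}"
    using inf_times_hit_iff by (intro Collect_cong conj_cong) auto
  ultimately show "{x \<in> space path_space. inf_times x \<inter> {s<..<c} \<noteq> {}} \<in> sets path_space" by (simp del: space_path_space)
qed (simp add: closed_inf_times)

lemma measurable_translate_set:
  "(\<lambda>S. (\<lambda>t. t + a) ` S) \<in> measurable Omega_bi Omega_bi"
proof (rule measurable_Omega_biI)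
  show "closed ((\<lambda>t. t + a) ` S)" if "S \<in> space Omega_bi" for S
    using that closed_translation[of S a] by (simp add: add.commute)
  fix s c
  have "(\<lambda>t. t + a) ` S \<inter> {s<..<c} \<noteq> {} \<longleftrightarrow> S \<inter> {s - a<..<c - a} \<noteq> {}" for S :: "real set"
    by (force simp: less_diff_eq diff_less_eq)
  then show "{S \<in> space Omega_bi. (\<lambda>t. t + a) ` S \<inter> {s<..<c} \<noteq> {}} \<in> sets Omega_bi"
    by (simp del: space_Omega_bi)
qed

lemma closed_tau_fun: "closed (tau_fun t S)"
  by (simp add: tau_fun_def)

lemma tau_fun_nonneg: "tau_fun t S \<subseteq> {0..}"
  unfolding tau_fun_def by (rule closure_minimal) auto

text \<open>An open interval does not distinguish a set from its closure, and for \<open>s\<close>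
  nonnegative the restriction to positive points is automatic.\<close>

lemma tau_fun_hit_iff:
  assumes "0 \<le> s"
  shows "tau_fun t S \<inter> {s<..<c} \<noteq> {} \<longleftrightarrow> S \<inter> {t + s<..<t + c} \<noteq> {}"
proof -
  have "tau_fun t S \<inter> {s<..<c} \<noteq> {} \<longleftrightarrow> ((\<lambda>u. u - t) ` S \<inter> {0<..}) \<inter> {s<..<c} \<noteq> {}"
    unfolding tau_fun_def using open_Int_closure_eq_empty[of "{s<..<c}" "(\<lambda>u. u - t) ` S \<inter> {0<..}"]
    by (subst (1 2) Int_commute) simp
  also have "\<dots> \<longleftrightarrow> S \<inter> {t + s<..<t + c} \<noteq> {}"
    using assms by (force simp: less_diff_eq diff_less_eq add.commute)
  finally show ?thesis .
qed

text \<open>The interval from \<open>D + s\<close> to \<open>D + c\<close> is random, whereas hits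
  are known to be measurable for fixed intervals; rational intervals inside the random one bridge
  the difference.\<close>

lemma measurable_tau_fun:
  assumes [measurable]: "D \<in> borel_measurable M" "f \<in> measurable M Omega_bi"
  shows "(\<lambda>\<omega>. tau_fun (D \<omega>) (f \<omega>)) \<in> measurable M Omega_right"
proof (rule measurable_Omega_rightI)
  fix s c :: real assume "0 \<le> s"
  have "{\<omega> \<in> space M. \<exists>p\<in>\<rat>. \<exists>q\<in>\<rat>. D \<omega> + s < p \<and> q < D \<omega> + c \<and> f \<omega> \<inter> {p<..<q} \<noteq> {}} \<in> sets M"
    by measurable
  moreover have "(\<exists>p\<in>\<rat>. \<exists>q\<in>\<rat>. D \<omega> + s < p \<and> q < D \<omega> + c \<and> f \<omega> \<inter> {p<..<q} \<noteq> {}) \<longleftrightarrow> tau_fun (D \<omega>) (f \<omega>) \<inter> {s<..<c} \<noteq> {}" for \<omega>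
  proof
    assume "tau_fun (D \<omega>) (f \<omega>) \<inter> {s<..<c} \<noteq> {}"
    then obtain h where h: "h \<in> f \<omega>" "D \<omega> + s < h" "h < D \<omega> + c" unfolding tau_fun_hit_iff[OF \<open>0 \<le> s\<close>] by auto
    obtain p q where "p \<in> \<rat>" "D \<omega> + s < p" "p < h" "q \<in> \<rat>" "h < q" "q < D \<omega> + c"
      using Rats_dense_in_real h by metis
    then show "\<exists>p\<in>\<rat>. \<exists>q\<in>\<rat>. D \<omega> + s < p \<and> q < D \<omega> + c \<and> f \<omega> \<inter> {p<..<q} \<noteq> {}"
      using h by (intro bexI[of _ p] bexI[of _ q]) auto
  next
    assume "\<exists>p\<in>\<rat>. \<exists>q\<in>\<rat>. D \<omega> + s < p \<and> q < D \<omega> + c \<and> f \<omega> \<inter> {p<..<q} \<noteq> {}"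
    then obtain p q h where "D \<omega> + s < p" "q < D \<omega> + c" "h \<in> f \<omega>" "p < h" "h < q" by auto
    then show "tau_fun (D \<omega>) (f \<omega>) \<inter> {s<..<c} \<noteq> {}" unfolding tau_fun_hit_iff[OF \<open>0 \<le> s\<close>] by auto
  qed
  ultimately show "{\<omega> \<in> space M. tau_fun (D \<omega>) (f \<omega>) \<inter> {s<..<c} \<noteq> {}} \<in> sets M" by (simp only:)
qed (simp add: closed_tau_fun tau_fun_nonneg)

section \<open>Past and future of a process with stationary independent increments\<close>

lemma (in prob_space) emeasure_distr_on_event:
  assumes [measurable]: "f \<in> measurable M N" "A \<in> events" "B \<in> sets N"
  shows "emeasure (distr (density M (indicator A)) N f) B = prob {\<omega> \<in> A. f \<omega> \<in> B}"
proof -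
  have A: "A \<subseteq> space M" by (rule sets.sets_into_space) fact
  have [measurable]: "f \<in> measurable (density M (indicator A)) N" by simp
  have "emeasure (distr (density M (indicator A)) N f) B = emeasure (density M (indicator A)) (f -` B \<inter> space M)"
    by (subst emeasure_distr) auto
  also have "\<dots> = (\<integral>\<^sup>+\<omega>. indicator A \<omega> * indicator (f -` B \<inter> space M) \<omega> \<partial>M)"
    by (subst emeasure_density) auto
  also have "\<dots> = (\<integral>\<^sup>+\<omega>. indicator {\<omega> \<in> A. f \<omega> \<in> B} \<omega> \<partial>M)"
    using A by (intro nn_integral_cong) (auto simp: indicator_def)
  also have "\<dots> = emeasure M {\<omega> \<in> A. f \<omega> \<in> B}"
  proof (rule nn_integral_indicator)
    have "{\<omega> \<in> A. f \<omega> \<in> B} = A \<inter> (f -` B \<inter> space M)" using A by auto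
    then show "{\<omega> \<in> A. f \<omega> \<in> B} \<in> events" by simp
  qed
  finally show ?thesis by (simp add: emeasure_eq_measure)
qed

lemma (in prob_space) emeasure_scaled_distr:
  assumes [measurable]: "g \<in> measurable M N" "B \<in> sets N" and "0 \<le> k"
  shows "emeasure (scale_measure (ennreal k) (distr M N g)) B = k * prob {\<omega> \<in> space M. g \<omega> \<in> B}"
proof -
  have "g -` B \<inter> space M = {\<omega> \<in> space M. g \<omega> \<in> B}" by auto
  then show ?thesis using \<open>0 \<le> k\<close>
    by (simp add: emeasure_distr emeasure_eq_measure ennreal_mult)
qed

lemma (in prob_space) finite_measure_distr_on_event:
  assumes [measurable]: "f \<in> measurable M N" "A \<in> events"
  shows "finite_measure (distr (density M (indicator A)) N f)"
  by (rule finite_measureI) (simp add: emeasure_distr_on_event del: emeasure_distr)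

text \<open>The identity says that the law of \<open>f\<close> on \<open>A\<close>, unnormalised, is
  \<open>k\<close> times the law of \<open>g\<close>. Both are finite measures, so agreement on the
  intersection-stable boxes is enough. With \<open>k = prob A\<close> this is how independence of
  paths is derived below.\<close>

lemma (in prob_space) prob_path_extend:
  assumes [measurable]: "f \<in> measurable M path_space" "g \<in> measurable M path_space" "A \<in> events"
    and "0 \<le> k" and B: "B \<in> sets path_space"
    and box: "\<And>U c. finite U \<Longrightarrow> prob {\<omega> \<in> A. f \<omega> \<in> path_box U c} = k * prob {\<omega> \<in> space M. g \<omega> \<in> path_box U c}"
  shows "prob {\<omega> \<in> A. f \<omega> \<in> B} = k * prob {\<omega> \<in> space M. g \<omega> \<in> B}"
proof -
  have eq: "distr (density M (indicator A)) path_space f = scale_measure (ennreal k) (distr M path_space g)"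
  proof (rule path_measure_eqI)
    fix U :: "real set" and c assume "finite U"
    then show "emeasure (distr (density M (indicator A)) path_space f) (path_box U c) =
        emeasure (scale_measure (ennreal k) (distr M path_space g)) (path_box U c)"
      using \<open>0 \<le> k\<close> box[of U c]
      by (simp add: emeasure_distr_on_event[of f path_space A] emeasure_scaled_distr[of g path_space _ k] del: emeasure_scale_measure)
  qed (auto intro: finite_measure_distr_on_event)
  have "ennreal (prob {\<omega> \<in> A. f \<omega> \<in> B}) = ennreal (k * prob {\<omega> \<in> space M. g \<omega> \<in> B})"
    using emeasure_distr_on_event[of f path_space A B] emeasure_scaled_distr[of g path_space B k] B \<open>0 \<le> k\<close>
    by (simp add: eq)
  then show ?thesis using \<open>0 \<le> k\<close> by (simp add: ennreal_inj)
qed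

text \<open>The integrated form of the same equality of measures; it turns factorised probabilities
  into factorised integrals.\<close>

lemma (in prob_space) nn_integral_on_event:
  assumes [measurable]: "f \<in> measurable M N" "g \<in> measurable M N" "A \<in> events"
    and "0 \<le> k" and F [measurable]: "F \<in> borel_measurable N"
    and eq: "\<And>B. B \<in> sets N \<Longrightarrow> prob {\<omega> \<in> A. f \<omega> \<in> B} = k * prob {\<omega> \<in> space M. g \<omega> \<in> B}"
  shows "(\<integral>\<^sup>+\<omega>. F (f \<omega>) * indicator A \<omega> \<partial>M) = ennreal k * (\<integral>\<^sup>+\<omega>. F (g \<omega>) \<partial>M)"
proof -
  have [measurable]: "f \<in> measurable (density M (indicator A)) N" by simp
  have "distr (density M (indicator A)) N f = scale_measure (ennreal k) (distr M N g)"
  proof (rule measure_eqI)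
    fix B assume "B \<in> sets (distr (density M (indicator A)) N f)"
    then have "B \<in> sets N" by simp
    then show "emeasure (distr (density M (indicator A)) N f) B = emeasure (scale_measure (ennreal k) (distr M N g)) B"
      using \<open>0 \<le> k\<close> eq[of B]
      by (simp add: emeasure_distr_on_event[of f N A] emeasure_scaled_distr[of g N _ k] del: emeasure_scale_measure)
  qed simp
  then have "(\<integral>\<^sup>+x. F x \<partial>distr (density M (indicator A)) N f) = (\<integral>\<^sup>+x. F x \<partial>scale_measure (ennreal k) (distr M N g))" by simp
  then show ?thesis
    by (simp add: nn_integral_distr nn_integral_density nn_integral_scale_measure mult.commute[of "F _"])
qed

lemma finite_set_increasing_enumeration:
  fixes W :: "real set"
  assumes "finite W" "W \<noteq> {}"
  obtains n and tt :: "nat \<Rightarrow> real" where "\<And>i. i < n \<Longrightarrow> tt i < tt (Suc i)" "tt ` {..n} = W"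
proof -
  define l where "l = sorted_list_of_set W"
  have l: "sorted_wrt (<) l" "set l = W" using assms by (auto simp: l_def)
  then have "l \<noteq> []" using assms by auto
  show thesis
  proof (rule that[of "length l - 1" "\<lambda>i. l ! i"])
    show "l ! i < l ! Suc i" if "i < length l - 1" for i
      using l(1) that by (auto simp: sorted_wrt_iff_nth_less)
    have "{..length l - 1} = {..<length l}" using \<open>l \<noteq> []\<close> by (auto simp: Suc_le_eq[symmetric] neq_Nil_conv)
    then show "(\<lambda>i. l ! i) ` {..length l - 1} = W" using l(2) by (auto simp: set_conv_nth)
  qed
qed

locale levy_process =
  fixes M :: "'a measure" and Y :: "real \<Rightarrow> 'a \<Rightarrow> real"
  assumes levy: "two_sided_levy M Y"

sublocale levy_process \<subseteq> prob_space M
  using levy by (simp add: two_sided_levy_def)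

context levy_process
begin

definition past :: "real \<Rightarrow> 'a \<Rightarrow> real \<Rightarrow> real" where
  "past q \<omega> = (\<lambda>u. Y (q + min u 0) \<omega> - Y q \<omega>)"

definition future :: "real \<Rightarrow> 'a \<Rightarrow> real \<Rightarrow> real" where
  "future q \<omega> = (\<lambda>u. Y (q + max u 0) \<omega> - Y q \<omega>)"

lemma measurable_Y [measurable]: "Y t \<in> borel_measurable M"
  using levy by (simp add: two_sided_levy_def)

lemma cadlag_Y: "\<omega> \<in> space M \<Longrightarrow> cadlag (\<lambda>t. Y t \<omega>)"
  using levy by (simp add: two_sided_levy_def cadlag_def)

lemma cadlag_past: "\<omega> \<in> space M \<Longrightarrow> cadlag (past q \<omega>)"
  unfolding past_def using cadlag_min[OF cadlag_shift[OF cadlag_Y]] .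

lemma cadlag_future: "\<omega> \<in> space M \<Longrightarrow> cadlag (future q \<omega>)"
  unfolding future_def using cadlag_max[OF cadlag_shift[OF cadlag_Y]] .

lemma measurable_past [measurable]: "past q \<in> measurable M path_space"
  by (rule measurable_path_spaceI) (simp_all add: cadlag_past, simp add: past_def)

lemma measurable_future [measurable]: "future q \<in> measurable M path_space"
  by (rule measurable_path_spaceI) (simp_all add: cadlag_future, simp add: future_def)

lemma increments_indep:
  assumes "\<And>i. i < n \<Longrightarrow> tt i < tt (Suc i)"
  shows "indep_vars (\<lambda>_. borel) (\<lambda>i \<omega>. Y (q + tt (Suc i)) \<omega> - Y (q + tt i) \<omega>) {..<n}"
proof -
  have "\<forall>n tt. (\<forall>i<n. tt i < tt (Suc i)) \<longrightarrow>
      indep_vars (\<lambda>_. borel) (\<lambda>i \<omega>. Y (tt (Suc i)) \<omega> - Y (tt i) \<omega>) {..<n}"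
    using levy unfolding two_sided_levy_def by (elim conjE)
  from this[rule_format, of n "\<lambda>i. q + tt i"] assms show ?thesis by simp
qed

lemma increment_law:
  "distr M borel (\<lambda>\<omega>. Y (q + t) \<omega> - Y (q + s) \<omega>) = distr M borel (\<lambda>\<omega>. Y t \<omega> - Y s \<omega>)"
proof -
  have *: "distr M borel (\<lambda>\<omega>. Y (s + t) \<omega> - Y s \<omega>) = distr M borel (\<lambda>\<omega>. Y t \<omega> - Y 0 \<omega>)" for s t
    using levy unfolding two_sided_levy_def by blast
  show ?thesis using *[of "q + s" "t - s"] *[of s "t - s"] by (simp add: algebra_simps)
qed

text \<open>The increments of a block are independent, so their joint law is the product of the
  one-dimensional laws, from which stationarity removes the base time \<open>q\<close>.\<close>

lemma increments_law:
  fixes q :: real and tt :: "nat \<Rightarrow> real"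
  defines "R \<equiv> \<lambda>q I \<omega>. restrict (\<lambda>i. Y (q + tt (Suc i)) \<omega> - Y (q + tt i) \<omega>) I"
  assumes tt: "\<And>i. i < n \<Longrightarrow> tt i < tt (Suc i)" and I: "I \<subseteq> {..<n}" and S [measurable]: "S \<in> sets (PiM I (\<lambda>_. borel))"
  shows "prob {\<omega> \<in> space M. R q I \<omega> \<in> S} = prob {\<omega> \<in> space M. R 0 I \<omega> \<in> S}"
\<comment> \<open>The characterisation by a product measure asks for a nonempty index set; empty
  blocks do occur, for instance when one of the two boxes is unconstrained.\<close>
proof (cases "I = {}")
  case True
  then have "R q I = R 0 I" by (simp add: R_def fun_eq_iff)
  then show ?thesis by (simp only:)
next
  case False
  have law: "distr M (PiM I (\<lambda>_. borel)) (R q I) =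
      PiM I (\<lambda>i. distr M borel (\<lambda>\<omega>. Y (tt (Suc i)) \<omega> - Y (tt i) \<omega>))" for q
  proof -
    have "indep_vars (\<lambda>_. borel) (\<lambda>i \<omega>. Y (q + tt (Suc i)) \<omega> - Y (q + tt i) \<omega>) I"
      by (rule indep_vars_subset[OF increments_indep[where tt=tt, OF tt] I])
    then have "distr M (PiM I (\<lambda>_. borel)) (R q I) =
      PiM I (\<lambda>i. distr M borel (\<lambda>\<omega>. Y (q + tt (Suc i)) \<omega> - Y (q + tt i) \<omega>))"
      unfolding R_def by (subst (asm) indep_vars_iff_distr_eq_PiM[OF False]) measurable
    then show ?thesis by (simp add: increment_law)
  qed
  have [measurable]: "R q I \<in> measurable M (PiM I (\<lambda>_. borel))" for q
    unfolding R_def by measurable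
  have "prob {\<omega> \<in> space M. R q I \<omega> \<in> S} = measure (distr M (PiM I (\<lambda>_. borel)) (R q I)) S" for q
    by (subst measure_distr) (auto intro!: arg_cong[where f=prob])
  then show ?thesis using law by simp
qed

text \<open>All times of both boxes, cut off at 0, are enumerated increasingly together with 0. The
  index \<open>m\<close> of time 0 splits the increments into two independent blocks: past values
  are minus sums over the end of the first block, future values are sums over the start of the
  second.\<close>

lemma past_future_box:
  assumes UV: "finite U" "finite V"
  shows "prob {\<omega> \<in> space M. past q \<omega> \<in> path_box U c \<and> future q \<omega> \<in> path_box V d} =
    prob {\<omega> \<in> space M. past 0 \<omega> \<in> path_box U c} * prob {\<omega> \<in> space M. future 0 \<omega> \<in> path_box V d}"
proof -
  define W where "W = {0} \<union> (\<lambda>u. min u 0) ` U \<union> (\<lambda>u. max u 0) ` V"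
  have "finite W" "W \<noteq> {}" using UV by (auto simp: W_def)
  from finite_set_increasing_enumeration[OF this] obtain n and tt :: "nat \<Rightarrow> real"
    where tt: "\<And>i. i < n \<Longrightarrow> tt i < tt (Suc i)" and W: "tt ` {..n} = W" by blast
  have mono: "tt i < tt j" if "i < j" "j \<le> n" for i j
    using that(1,2)
  proof (induction j)
    case (Suc j)
    then show ?case using tt[of j] by (cases "i = j") auto
  qed simp
  have "0 \<in> tt ` {..n}" using W by (auto simp: W_def)
  then obtain m where m: "m \<le> n" "tt m = 0" by auto
  have "\<exists>k\<le>n. tt k = min u 0" if "u \<in> U" for u
  proof -
    have "min u 0 \<in> tt ` {..n}" using that W by (auto simp: W_def)
    then show ?thesis by force
  qed
  then obtain k where k: "\<And>u. u \<in> U \<Longrightarrow> k u \<le> n \<and> tt (k u) = min u 0" by metis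
  have km: "k u \<le> m" if "u \<in> U" for u
    using k[OF that] mono[of m "k u"] m by (force simp: not_le[symmetric])
  have "\<exists>k\<le>n. tt k = max u 0" if "u \<in> V" for u
  proof -
    have "max u 0 \<in> tt ` {..n}" using that W by (auto simp: W_def)
    then show ?thesis by force
  qed
  then obtain l where l: "\<And>u. u \<in> V \<Longrightarrow> l u \<le> n \<and> tt (l u) = max u 0" by metis
  have lm: "m \<le> l u" if "u \<in> V" for u
    using l[OF that] mono[of "l u" m] m by (force simp: not_le[symmetric])
  define R where "R = (\<lambda>q I \<omega>. restrict (\<lambda>i. Y (q + tt (Suc i)) \<omega> - Y (q + tt i) \<omega>) I)"
  define S1 where "S1 = {x \<in> space (PiM {..<m} (\<lambda>_. borel)). \<forall>u\<in>U. - (\<Sum>i\<in>{k u..<m}. x i) < c u}"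
  define S2 where "S2 = {x \<in> space (PiM {m..<n} (\<lambda>_. borel)). \<forall>u\<in>V. (\<Sum>i\<in>{m..<l u}. x i) < d u}"
  have S1 [measurable]: "S1 \<in> sets (PiM {..<m} (\<lambda>_. borel))"
    unfolding S1_def using UV by measurable
  have S2 [measurable]: "S2 \<in> sets (PiM {m..<n} (\<lambda>_. borel))"
  proof -
    have [measurable]: "(\<lambda>x. \<Sum>i\<in>{m..<l u}. x i) \<in> borel_measurable (PiM {m..<n} (\<lambda>_. borel :: real measure))" if "u \<in> V" for u
      using l[OF that] by (intro borel_measurable_sum measurable_component_singleton) auto
    show ?thesis unfolding S2_def using UV by measurable
  qed
  have 1: "past q \<omega> \<in> path_box U c \<longleftrightarrow> R q {..<m} \<omega> \<in> S1" if "\<omega> \<in> space M" for q \<omega>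
  proof -
    have "past q \<omega> u = - (\<Sum>i\<in>{k u..<m}. R q {..<m} \<omega> i)" if "u \<in> U" for u
    proof -
      have "(\<Sum>i\<in>{k u..<m}. R q {..<m} \<omega> i) = (\<Sum>i\<in>{k u..<m}. Y (q + tt (Suc i)) \<omega> - Y (q + tt i) \<omega>)"
        by (rule sum.cong) (auto simp: R_def)
      also have "\<dots> = Y (q + tt m) \<omega> - Y (q + tt (k u)) \<omega>"
        using sum_Suc_diff'[OF km[OF that], of "\<lambda>i. Y (q + tt i) \<omega>"] by simp
      finally show ?thesis using k[OF that] m by (simp add: past_def)
    qed
    moreover have "R q {..<m} \<omega> \<in> space (PiM {..<m} (\<lambda>_. borel))" by (auto simp: R_def space_PiM)
    ultimately show ?thesis using cadlag_past[OF that] by (simp add: path_box_def S1_def)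
  qed
  have 2: "future q \<omega> \<in> path_box V d \<longleftrightarrow> R q {m..<n} \<omega> \<in> S2" if "\<omega> \<in> space M" for q \<omega>
  proof -
    have "future q \<omega> u = (\<Sum>i\<in>{m..<l u}. R q {m..<n} \<omega> i)" if "u \<in> V" for u
    proof -
      have "(\<Sum>i\<in>{m..<l u}. R q {m..<n} \<omega> i) = (\<Sum>i\<in>{m..<l u}. Y (q + tt (Suc i)) \<omega> - Y (q + tt i) \<omega>)"
        using l[OF that] by (intro sum.cong) (auto simp: R_def)
      also have "\<dots> = Y (q + tt (l u)) \<omega> - Y (q + tt m) \<omega>"
        using sum_Suc_diff'[OF lm[OF that], of "\<lambda>i. Y (q + tt i) \<omega>"] by simp
      finally show ?thesis using l[OF that] m by (simp add: future_def)
    qed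
    moreover have "R q {m..<n} \<omega> \<in> space (PiM {m..<n} (\<lambda>_. borel))" by (auto simp: R_def space_PiM)
    ultimately show ?thesis using cadlag_future[OF that] by (simp add: path_box_def S2_def)
  qed
  have "indep_var (PiM {..<m} (\<lambda>_. borel)) (R q {..<m}) (PiM {m..<n} (\<lambda>_. borel)) (R q {m..<n})"
    unfolding R_def using m by (intro indep_var_restrict[OF increments_indep[where tt=tt, OF tt]]) auto
  note indep = indep_varD[OF this S1 S2]
  have "prob {\<omega> \<in> space M. R q {..<m} \<omega> \<in> S1 \<and> R q {m..<n} \<omega> \<in> S2} =
      prob ((\<lambda>\<omega>. (R q {..<m} \<omega>, R q {m..<n} \<omega>)) -` (S1 \<times> S2) \<inter> space M)"
    by (rule arg_cong[where f=prob]) auto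
  also have "\<dots> = prob {\<omega> \<in> space M. R q {..<m} \<omega> \<in> S1} * prob {\<omega> \<in> space M. R q {m..<n} \<omega> \<in> S2}"
    unfolding indep by (intro arg_cong2[where f="(*)"] arg_cong[where f=prob]) auto
  also have "\<dots> = prob {\<omega> \<in> space M. R 0 {..<m} \<omega> \<in> S1} * prob {\<omega> \<in> space M. R 0 {m..<n} \<omega> \<in> S2}"
    unfolding R_def using m by (intro arg_cong2[where f="(*)"] increments_law[where tt=tt and n=n, OF tt]) auto
  finally show ?thesis by (simp add: 1 2 cong: conj_cong)
qed

text \<open>Boxes are replaced by general events one side at a time: first the past event for a
  fixed future box, then the future event for the past event just obtained. Since the right-hand
  side is based at 0, inserting the whole path space for one event gives stationarity of each
  marginal law.\<close>

lemma past_future_prob: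
  assumes B: "B \<in> sets path_space" "C \<in> sets path_space"
  shows "prob {\<omega> \<in> space M. past q \<omega> \<in> B \<and> future q \<omega> \<in> C} =
    prob {\<omega> \<in> space M. past 0 \<omega> \<in> B} * prob {\<omega> \<in> space M. future 0 \<omega> \<in> C}"
proof -
  have [measurable]: "{\<omega> \<in> space M. future q \<omega> \<in> C} \<in> events" if "C \<in> sets path_space" for C q
    using that by measurable
  have [measurable]: "{\<omega> \<in> space M. past q \<omega> \<in> C} \<in> events" if "C \<in> sets path_space" for C q
    using that by measurable
  have 1: "prob {\<omega> \<in> space M. past q \<omega> \<in> B \<and> future q \<omega> \<in> path_box V d} =
    prob {\<omega> \<in> space M. past 0 \<omega> \<in> B} * prob {\<omega> \<in> space M. future 0 \<omega> \<in> path_box V d}" if V: "finite V" for V d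
  proof -
    have "prob {\<omega> \<in> {\<omega> \<in> space M. future q \<omega> \<in> path_box V d}. past q \<omega> \<in> B} =
       prob {\<omega> \<in> space M. future 0 \<omega> \<in> path_box V d} * prob {\<omega> \<in> space M. past 0 \<omega> \<in> B}"
    proof (rule prob_path_extend[OF measurable_past measurable_past _ measure_nonneg B(1)])
      fix U :: "real set" and c assume U: "finite U"
      have "{\<omega> \<in> {\<omega> \<in> space M. future q \<omega> \<in> path_box V d}. past q \<omega> \<in> path_box U c} =
          {\<omega> \<in> space M. past q \<omega> \<in> path_box U c \<and> future q \<omega> \<in> path_box V d}" by blast
      then show "prob {\<omega> \<in> {\<omega> \<in> space M. future q \<omega> \<in> path_box V d}. past q \<omega> \<in> path_box U c} =
          prob {\<omega> \<in> space M. future 0 \<omega> \<in> path_box V d} * prob {\<omega> \<in> space M. past 0 \<omega> \<in> path_box U c}"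
        using past_future_box[OF U V, of q c d] by (simp only: mult.commute)
    qed (use V in measurable)
    moreover have "{\<omega> \<in> {\<omega> \<in> space M. future q \<omega> \<in> path_box V d}. past q \<omega> \<in> B} =
        {\<omega> \<in> space M. past q \<omega> \<in> B \<and> future q \<omega> \<in> path_box V d}" by blast
    ultimately show ?thesis by (simp only: mult.commute)
  qed
  have "prob {\<omega> \<in> {\<omega> \<in> space M. past q \<omega> \<in> B}. future q \<omega> \<in> C} =
      prob {\<omega> \<in> space M. past 0 \<omega> \<in> B} * prob {\<omega> \<in> space M. future 0 \<omega> \<in> C}"
  proof (rule prob_path_extend[OF measurable_future measurable_future _ measure_nonneg B(2)])
    fix U :: "real set" and c assume U: "finite U"
    have "{\<omega> \<in> {\<omega> \<in> space M. past q \<omega> \<in> B}. future q \<omega> \<in> path_box U c} =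
        {\<omega> \<in> space M. past q \<omega> \<in> B \<and> future q \<omega> \<in> path_box U c}" by blast
    then show "prob {\<omega> \<in> {\<omega> \<in> space M. past q \<omega> \<in> B}. future q \<omega> \<in> path_box U c} =
        prob {\<omega> \<in> space M. past 0 \<omega> \<in> B} * prob {\<omega> \<in> space M. future 0 \<omega> \<in> path_box U c}"
      using 1[OF U, of c] by (simp only:)
  qed (use B in measurable)
  moreover have "{\<omega> \<in> {\<omega> \<in> space M. past q \<omega> \<in> B}. future q \<omega> \<in> C} =
      {\<omega> \<in> space M. past q \<omega> \<in> B \<and> future q \<omega> \<in> C}" by blast
  ultimately show ?thesis by (simp only:)
qed

lemma past_prob:
  assumes "B \<in> sets path_space"
  shows "prob {\<omega> \<in> space M. past q \<omega> \<in> B} = prob {\<omega> \<in> space M. past 0 \<omega> \<in> B}"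
proof -
  have "{\<omega> \<in> space M. past q \<omega> \<in> B \<and> future q \<omega> \<in> space path_space} = {\<omega> \<in> space M. past q \<omega> \<in> B}"
    "{\<omega> \<in> space M. future 0 \<omega> \<in> space path_space} = space M"
    by (auto simp: cadlag_future)
  then show ?thesis using past_future_prob[OF assms sets.top, of q] by (simp add: prob_space)
qed

lemma future_prob:
  assumes "B \<in> sets path_space"
  shows "prob {\<omega> \<in> space M. future q \<omega> \<in> B} = prob {\<omega> \<in> space M. future 0 \<omega> \<in> B}"
proof -
  have "{\<omega> \<in> space M. past q \<omega> \<in> space path_space \<and> future q \<omega> \<in> B} = {\<omega> \<in> space M. future q \<omega> \<in> B}"
    "{\<omega> \<in> space M. past 0 \<omega> \<in> space path_space} = space M"
    by (auto simp: cadlag_past)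
  then show ?thesis using past_future_prob[OF sets.top assms, of q] by (simp add: prob_space)
qed

lemma past_future_indep:
  assumes "B \<in> sets path_space" "C \<in> sets path_space"
  shows "prob {\<omega> \<in> space M. past q \<omega> \<in> B \<and> future q \<omega> \<in> C} =
    prob {\<omega> \<in> space M. past q \<omega> \<in> B} * prob {\<omega> \<in> space M. future q \<omega> \<in> C}"
  using past_future_prob[OF assms, of q] past_prob[OF assms(1), of q] future_prob[OF assms(2), of q] by metis

end

section \<open>The strong Markov property\<close>

lemma (in prob_space) nn_integral_bounded_convergence:
  assumes "\<And>i. u i \<in> borel_measurable M" "v \<in> borel_measurable M"
    and "\<And>i \<omega>. \<omega> \<in> space M \<Longrightarrow> u i \<omega> \<le> (1::ennreal)"
    and "\<And>\<omega>. \<omega> \<in> space M \<Longrightarrow> (\<lambda>i. u i \<omega>) \<longlonglongrightarrow> v \<omega>"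
  shows "(\<lambda>i. \<integral>\<^sup>+\<omega>. u i \<omega> \<partial>M) \<longlonglongrightarrow> (\<integral>\<^sup>+\<omega>. v \<omega> \<partial>M)"
  by (rule nn_integral_dominated_convergence[where w="\<lambda>_. 1"])
     (use assms in \<open>auto simp: emeasure_space_1\<close>)

text \<open>Floor plus one, rather than ceiling, gives a grid point strictly above \<open>t\<close>.
  Hence right continuity applies along the grid, and each grid value is taken on an event of the
  form \<open>k / Suc n \<le> t < (k + 1) / Suc n\<close>.\<close>

definition grid_above :: "nat \<Rightarrow> real \<Rightarrow> real" where
  "grid_above n t = (of_int \<lfloor>t * real (Suc n)\<rfloor> + 1) / real (Suc n)"

lemma measurable_grid_above [measurable]: "grid_above n \<in> borel_measurable borel"
  unfolding grid_above_def[abs_def] supply measurable_coordinate [measurable del] by measurable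

lemma grid_above_gt: "t < grid_above n t"
proof -
  have "t * real (Suc n) < of_int \<lfloor>t * real (Suc n)\<rfloor> + 1" by linarith
  then show ?thesis by (simp add: grid_above_def pos_less_divide_eq)
qed

lemma grid_above_le: "grid_above n t \<le> t + 1 / Suc n"
proof -
  have "of_int \<lfloor>t * real (Suc n)\<rfloor> + 1 \<le> t * real (Suc n) + 1" by linarith
  then have "grid_above n t \<le> (t * real (Suc n) + 1) / real (Suc n)"
    unfolding grid_above_def by (rule divide_right_mono) simp
  also have "\<dots> = t + 1 / Suc n" by (simp add: field_simps)
  finally show ?thesis .
qed

lemma grid_above_tendsto: "(\<lambda>n. grid_above n t) \<longlonglongrightarrow> t"
proof (rule tendsto_sandwich[where f="\<lambda>_. t" and h="\<lambda>n. t + 1 / Suc n"])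
  have "(\<lambda>n. t + 1 / real (Suc n)) \<longlonglongrightarrow> t + 0"
    by (intro tendsto_intros) (rule LIMSEQ_Suc[OF lim_1_over_n])
  then show "(\<lambda>n. t + 1 / real (Suc n)) \<longlonglongrightarrow> t" by simp
qed (use less_imp_le[OF grid_above_gt] grid_above_le in \<open>auto intro!: always_eventually simp del: of_nat_Suc\<close>)

lemma cadlag_along_grid:
  assumes "cadlag y"
  shows "(\<lambda>n. y (grid_above n t + a)) \<longlonglongrightarrow> y (t + a)"
proof (rule filterlim_compose[OF cadlag_right[OF assms]])
  have "(\<lambda>n. grid_above n t + a) \<longlonglongrightarrow> t + a" by (intro tendsto_intros grid_above_tendsto)
  then show "filterlim (\<lambda>n. grid_above n t + a) (at_right (t + a)) sequentially"
    unfolding filterlim_at using grid_above_gt[of t] by (auto simp: less_imp_neq[THEN not_sym])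
qed

text \<open>A continuous approximation from below of the indicator of the positive half line.
  Convergence at the coordinates passes through products of ramps, but not through the indicator of
  a box.\<close>

definition ramp :: "nat \<Rightarrow> real \<Rightarrow> real" where
  "ramp j z = min 1 (max 0 (j * z))"

lemma ramp_bounds: "0 \<le> ramp j z" "ramp j z \<le> 1"
  by (auto simp: ramp_def)

lemma ramp_tendsto: "(\<lambda>j. ramp j z) \<longlonglongrightarrow> (if z > 0 then 1 else 0)"
proof (cases "z > 0")
  case True
  obtain j0 :: nat where j0: "1 / z < j0" using reals_Archimedean2 by blast
  have "ramp j z = 1" if "j \<ge> j0" for j
  proof -
    have "1 / z < j" using j0 that by linarith
    then have "1 \<le> j * z" using True by (simp add: field_simps)
    then show ?thesis by (simp add: ramp_def)
  qed
  then have "eventually (\<lambda>j. ramp j z = 1) sequentially" by (auto simp: eventually_sequentially)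
  from tendsto_eventually[OF this] True show ?thesis by simp
next
  case False
  then have "real j * z \<le> 0" for j by (simp add: mult_nonneg_nonpos)
  then have "ramp j z = 0" for j by (simp add: ramp_def max_absorb1)
  then show ?thesis using False by simp
qed

definition box_ramp :: "nat \<Rightarrow> real set \<Rightarrow> (real \<Rightarrow> real) \<Rightarrow> (real \<Rightarrow> real) \<Rightarrow> real" where
  "box_ramp j U c x = (\<Prod>u\<in>U. ramp j (c u - x u))"

lemma measurable_box_ramp [measurable]: "box_ramp j U c \<in> borel_measurable path_space"
  unfolding box_ramp_def[abs_def] ramp_def by measurable

lemma box_ramp_le_1: "ennreal (box_ramp j U c x) \<le> 1"
  unfolding box_ramp_def using ramp_bounds by (auto intro!: prod_le_1)

lemma box_ramp_tendsto:
  assumes "finite U" "cadlag x"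
  shows "(\<lambda>j. box_ramp j U c x) \<longlonglongrightarrow> indicator (path_box U c) x"
proof -
  have "(\<lambda>j. box_ramp j U c x) \<longlonglongrightarrow> (\<Prod>u\<in>U. if c u - x u > 0 then 1 else 0)"
    unfolding box_ramp_def by (intro tendsto_prod ramp_tendsto)
  also have "(\<Prod>u\<in>U. if c u - x u > 0 then 1 else 0) = (indicator (path_box U c) x :: real)"
    using assms by (auto simp: indicator_def path_box_def intro!: prod.neutral)
  finally show ?thesis .
qed

lemma box_ramp_continuous:
  assumes "\<And>u. (\<lambda>n. X n u) \<longlonglongrightarrow> x u"
  shows "(\<lambda>n. box_ramp j U c (X n)) \<longlonglongrightarrow> box_ramp j U c x"
  unfolding box_ramp_def ramp_def by (intro tendsto_intros assms)

context levy_process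
begin

definition past_algebra :: "real \<Rightarrow> 'a measure" where
  "past_algebra q = vimage_algebra (space M) (past q) path_space"

lemma space_past_algebra [simp]: "space (past_algebra q) = space M"
  by (simp add: past_algebra_def)

lemma past_in_path_space: "past q \<in> space M \<rightarrow> space path_space"
  by (auto simp: cadlag_past)

lemma sets_past_algebra:
  "sets (past_algebra q) = {past q -` B \<inter> space M | B. B \<in> sets path_space}"
  unfolding past_algebra_def by (rule sets_vimage_algebra2[OF past_in_path_space])

lemma past_algebra_E:
  assumes "E \<in> sets (past_algebra q)"
  obtains B where "B \<in> sets path_space" "E = {\<omega> \<in> space M. past q \<omega> \<in> B}"
  using assms unfolding sets_past_algebra by blast

lemma past_algebra_events: "E \<in> sets (past_algebra q) \<Longrightarrow> E \<in> events"
  by (elim past_algebra_E) simp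

lemma past_measurable_past_algebra [measurable]: "past q \<in> measurable (past_algebra q) path_space"
  unfolding past_algebra_def by (rule measurable_vimage_algebra1[OF past_in_path_space])

lemma increment_measurable_past_algebra:
  assumes "u \<le> q" "v \<le> q"
  shows "(\<lambda>\<omega>. Y u \<omega> - Y v \<omega>) \<in> borel_measurable (past_algebra q)"
proof -
  have "(\<lambda>\<omega>. past q \<omega> (u - q) - past q \<omega> (v - q)) \<in> borel_measurable (past_algebra q)"
    by measurable
  then show ?thesis using assms by (simp add: past_def)
qed

lemma past_algebra_mono:
  assumes "q' \<le> q"
  shows "sets (past_algebra q') \<subseteq> sets (past_algebra q)"
proof
  fix E assume "E \<in> sets (past_algebra q')"
  then obtain B where B: "B \<in> sets path_space" "E = {\<omega> \<in> space M. past q' \<omega> \<in> B}" by (rule past_algebra_E)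
  have "past q' \<in> measurable (past_algebra q) path_space"
  proof (rule measurable_path_spaceI)
    show "(\<lambda>\<omega>. past q' \<omega> u) \<in> borel_measurable (past_algebra q)" for u
      unfolding past_def by (rule increment_measurable_past_algebra) (use assms in auto)
  qed (simp add: cadlag_past)
  from measurable_sets[OF this B(1)] B(2) show "E \<in> sets (past_algebra q)"
    by (simp add: vimage_def Int_def conj_commute)
qed

lemma past_algebra_future:
  assumes "E \<in> sets (past_algebra q)" "C \<in> sets path_space"
  shows "prob {\<omega> \<in> E. future q \<omega> \<in> C} = prob E * prob {\<omega> \<in> space M. future 0 \<omega> \<in> C}"
proof -
  obtain B where B: "B \<in> sets path_space" "E = {\<omega> \<in> space M. past q \<omega> \<in> B}"
    using assms(1) by (rule past_algebra_E)
  have "{\<omega> \<in> E. future q \<omega> \<in> C} = {\<omega> \<in> space M. past q \<omega> \<in> B \<and> future q \<omega> \<in> C}" using B by blast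
  then show ?thesis
    using past_future_indep[OF B(1) assms(2), of q] future_prob[OF assms(2), of q] B(2) by metis
qed

lemma measurable_Y_at_grid:
  assumes [measurable]: "T \<in> borel_measurable M"
  shows "(\<lambda>\<omega>. Y (grid_above n (T \<omega>) + a) \<omega>) \<in> borel_measurable M"
  unfolding grid_above_def
  by (rule measurable_compose_countable[where f="\<lambda>i \<omega>. Y ((of_int i + 1) / Suc n + a) \<omega>"]) measurable

text \<open>A grid time has countably many values, so evaluation there is measurable; right
  continuity carries this to the limit.\<close>

lemma measurable_Y_at:
  assumes [measurable]: "T \<in> borel_measurable M"
  shows "(\<lambda>\<omega>. Y (T \<omega> + a) \<omega>) \<in> borel_measurable M"
  by (rule borel_measurable_LIMSEQ_real[OF _ measurable_Y_at_grid[OF assms]])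
     (rule cadlag_along_grid[OF cadlag_Y])

lemma measurable_future_at:
  assumes [measurable]: "T \<in> borel_measurable M"
  shows "(\<lambda>\<omega>. future (T \<omega>) \<omega>) \<in> measurable M path_space"
proof (rule measurable_path_spaceI)
  show "(\<lambda>\<omega>. future (T \<omega>) \<omega> u) \<in> borel_measurable M" for u
    unfolding future_def
    using measurable_Y_at[OF assms, of "max u 0"] measurable_Y_at[OF assms, of 0] by simp
qed (simp add: cadlag_future)

text \<open>On each event \<open>A' k\<close> the grid time is a constant, and the event belongs to
  the past of that constant, since the lower bound on \<open>T\<close> concerns an earlier grid
  point. Independence at the fixed time is then summed over \<open>k\<close>.\<close>

lemma strong_markov_grid:
  assumes T [measurable]: "T \<in> borel_measurable M" and A [measurable]: "A \<in> events"
    and stop: "\<And>q. {\<omega> \<in> A. T \<omega> < q} \<in> sets (past_algebra q)"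
    and B [measurable]: "B \<in> sets path_space"
  shows "prob {\<omega> \<in> A. future (grid_above n (T \<omega>)) \<omega> \<in> B} = prob A * prob {\<omega> \<in> space M. future 0 \<omega> \<in> B}"
proof -
  let ?N = "real (Suc n)"
  let ?p = "emeasure M {\<omega> \<in> space M. future 0 \<omega> \<in> B}"
  have AM: "A \<subseteq> space M" by (rule sets.sets_into_space) fact
  define A' where "A' k = {\<omega> \<in> A. \<lfloor>T \<omega> * ?N\<rfloor> = k}" for k :: int
  define E where "E k = {\<omega> \<in> A' k. future ((of_int k + 1) / ?N) \<omega> \<in> B}" for k
  have A': "A' k \<in> sets (past_algebra ((of_int k + 1) / ?N))" for k
  proof -
    have "A' k = {\<omega> \<in> A. T \<omega> < (of_int k + 1) / ?N} - {\<omega> \<in> A. T \<omega> < of_int k / ?N}"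
      by (auto simp: A'_def floor_eq_iff pos_less_divide_eq not_less pos_divide_le_eq)
    moreover have "{\<omega> \<in> A. T \<omega> < of_int k / ?N} \<in> sets (past_algebra ((of_int k + 1) / ?N))"
      by (rule subsetD[OF past_algebra_mono stop]) (simp add: divide_right_mono)
    ultimately show ?thesis using stop by auto
  qed
  have A'M: "A' k \<in> events" for k by (rule past_algebra_events[OF A'])
  have E: "E k \<in> events" for k
  proof -
    have "E k = A' k \<inter> {\<omega> \<in> space M. future ((of_int k + 1) / ?N) \<omega> \<in> B}"
      using AM by (auto simp: E_def A'_def)
    then show ?thesis using A'M[of k] by simp
  qed
  have Ek: "emeasure M (E k) = emeasure M (A' k) * ?p" for k
    unfolding E_def emeasure_eq_measure past_algebra_future[OF A' B] by (simp add: ennreal_mult)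
  have "{\<omega> \<in> A. future (grid_above n (T \<omega>)) \<omega> \<in> B} = (\<Union>k\<in>UNIV. E k)"
    by (auto simp: E_def A'_def grid_above_def)
  then have "emeasure M {\<omega> \<in> A. future (grid_above n (T \<omega>)) \<omega> \<in> B} = emeasure M (\<Union>k\<in>UNIV. E k)" by (simp only:)
  also have "\<dots> = (\<integral>\<^sup>+k. emeasure M (E k) \<partial>count_space UNIV)"
    by (rule emeasure_UN_countable) (auto simp: E disjoint_family_on_def, auto simp: E_def A'_def)
  also have "\<dots> = (\<integral>\<^sup>+k. emeasure M (A' k) \<partial>count_space UNIV) * ?p"
    unfolding Ek by (rule nn_integral_multc) auto
  also have "(\<integral>\<^sup>+k. emeasure M (A' k) \<partial>count_space UNIV) = emeasure M (\<Union>k\<in>UNIV. A' k)"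
    by (rule emeasure_UN_countable[symmetric]) (auto simp: A'M disjoint_family_on_def, auto simp: A'_def)
  also have "(\<Union>k\<in>UNIV. A' k) = A" by (auto simp: A'_def)
  finally have "ennreal (prob {\<omega> \<in> A. future (grid_above n (T \<omega>)) \<omega> \<in> B}) = ennreal (prob A * prob {\<omega> \<in> space M. future 0 \<omega> \<in> B})"
    by (simp add: emeasure_eq_measure ennreal_mult)
  then show ?thesis by (simp add: ennreal_inj)
qed

text \<open>Two limits are taken in this order: the grid times tend to \<open>T\<close> from the
  right, for a fixed continuous function of finitely many coordinates, and then the ramps tend to
  the indicator of a box. The condition \<open>stop\<close> with strict inequality is that of a
  stopping time for the right-continuous filtration. The event \<open>A\<close> allows for times
  that are meaningful only on part of the space.\<close>

theorem strong_markov: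
  assumes T [measurable]: "T \<in> borel_measurable M" and A [measurable]: "A \<in> events"
    and stop: "\<And>q. {\<omega> \<in> A. T \<omega> < q} \<in> sets (past_algebra q)"
    and B [measurable]: "B \<in> sets path_space"
  shows "prob {\<omega> \<in> A. future (T \<omega>) \<omega> \<in> B} = prob A * prob {\<omega> \<in> space M. future 0 \<omega> \<in> B}"
proof (rule prob_path_extend[OF measurable_future_at[OF T] measurable_future A measure_nonneg B])
  fix U :: "real set" and c assume U: "finite U"
  have AM: "A \<subseteq> space M" by (rule sets.sets_into_space) fact
  have [measurable]: "(\<lambda>\<omega>. grid_above n (T \<omega>)) \<in> borel_measurable M" for n by measurable
  note [measurable] = measurable_future_at[OF T] measurable_future_at[of "\<lambda>\<omega>. grid_above _ (T \<omega>)"]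
  have grid: "(\<integral>\<^sup>+\<omega>. ennreal (box_ramp j U c (future (grid_above n (T \<omega>)) \<omega>)) * indicator A \<omega> \<partial>M) =
      ennreal (prob A) * (\<integral>\<^sup>+\<omega>. ennreal (box_ramp j U c (future 0 \<omega>)) \<partial>M)" for j n
    by (rule nn_integral_on_event[where N=path_space and F="\<lambda>x. ennreal (box_ramp j U c x)"])
       (auto intro: strong_markov_grid[OF T A stop] measurable_future_at)
  have le1: "ennreal (box_ramp j U c x) * indicator A \<omega> \<le> 1" for j x \<omega>
    using box_ramp_le_1[of j U c x] by (auto simp: indicator_def)
  have limit: "(\<integral>\<^sup>+\<omega>. ennreal (box_ramp j U c (future (T \<omega>) \<omega>)) * indicator A \<omega> \<partial>M) =
      ennreal (prob A) * (\<integral>\<^sup>+\<omega>. ennreal (box_ramp j U c (future 0 \<omega>)) \<partial>M)" for j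
  proof (rule LIMSEQ_unique[where X="\<lambda>n. \<integral>\<^sup>+\<omega>. ennreal (box_ramp j U c (future (grid_above n (T \<omega>)) \<omega>)) * indicator A \<omega> \<partial>M"])
    show "(\<lambda>n. \<integral>\<^sup>+\<omega>. ennreal (box_ramp j U c (future (grid_above n (T \<omega>)) \<omega>)) * indicator A \<omega> \<partial>M) \<longlonglongrightarrow>
        (\<integral>\<^sup>+\<omega>. ennreal (box_ramp j U c (future (T \<omega>) \<omega>)) * indicator A \<omega> \<partial>M)"
    proof (rule nn_integral_bounded_convergence)
      fix \<omega> assume \<omega>: "\<omega> \<in> space M"
      have "(\<lambda>n. future (grid_above n (T \<omega>)) \<omega> u) \<longlonglongrightarrow> future (T \<omega>) \<omega> u" for u
        unfolding future_def
        using cadlag_along_grid[OF cadlag_Y[OF \<omega>], of "T \<omega>" 0]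
        by (intro tendsto_diff cadlag_along_grid[OF cadlag_Y[OF \<omega>]]) simp
      then have "(\<lambda>n. box_ramp j U c (future (grid_above n (T \<omega>)) \<omega>)) \<longlonglongrightarrow> box_ramp j U c (future (T \<omega>) \<omega>)"
        by (rule box_ramp_continuous)
      then show "(\<lambda>n. ennreal (box_ramp j U c (future (grid_above n (T \<omega>)) \<omega>)) * indicator A \<omega>) \<longlonglongrightarrow>
          ennreal (box_ramp j U c (future (T \<omega>) \<omega>)) * indicator A \<omega>"
        by (cases "\<omega> \<in> A") (auto intro: tendsto_ennrealI)
    qed (simp_all add: le1)
    show "(\<lambda>n. \<integral>\<^sup>+\<omega>. ennreal (box_ramp j U c (future (grid_above n (T \<omega>)) \<omega>)) * indicator A \<omega> \<partial>M) \<longlonglongrightarrow>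
        ennreal (prob A) * (\<integral>\<^sup>+\<omega>. ennreal (box_ramp j U c (future 0 \<omega>)) \<partial>M)"
      unfolding grid by simp
  qed
  have lim1: "(\<lambda>j. \<integral>\<^sup>+\<omega>. ennreal (box_ramp j U c (future (T \<omega>) \<omega>)) * indicator A \<omega> \<partial>M) \<longlonglongrightarrow>
      (\<integral>\<^sup>+\<omega>. indicator (path_box U c) (future (T \<omega>) \<omega>) * indicator A \<omega> \<partial>M)"
  proof (rule nn_integral_bounded_convergence)
    fix \<omega> assume \<omega>: "\<omega> \<in> space M"
    have "(\<lambda>j. ennreal (box_ramp j U c (future (T \<omega>) \<omega>))) \<longlonglongrightarrow> ennreal (indicator (path_box U c) (future (T \<omega>) \<omega>))"
      by (intro tendsto_ennrealI box_ramp_tendsto U cadlag_future[OF \<omega>])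
    then show "(\<lambda>j. ennreal (box_ramp j U c (future (T \<omega>) \<omega>)) * indicator A \<omega>) \<longlonglongrightarrow>
        indicator (path_box U c) (future (T \<omega>) \<omega>) * indicator A \<omega>"
      by (cases "\<omega> \<in> A") (auto simp: ennreal_indicator)
  qed (use U in \<open>simp_all add: le1\<close>)
  have lim2: "(\<lambda>j. \<integral>\<^sup>+\<omega>. ennreal (box_ramp j U c (future 0 \<omega>)) \<partial>M) \<longlonglongrightarrow>
      (\<integral>\<^sup>+\<omega>. indicator (path_box U c) (future 0 \<omega>) \<partial>M)"
  proof (rule nn_integral_bounded_convergence)
    fix \<omega> assume \<omega>: "\<omega> \<in> space M"
    have "(\<lambda>j. ennreal (box_ramp j U c (future 0 \<omega>))) \<longlonglongrightarrow> ennreal (indicator (path_box U c) (future 0 \<omega>))"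
      by (intro tendsto_ennrealI box_ramp_tendsto U cadlag_future[OF \<omega>])
    then show "(\<lambda>j. ennreal (box_ramp j U c (future 0 \<omega>))) \<longlonglongrightarrow> indicator (path_box U c) (future 0 \<omega>)"
      by (simp add: ennreal_indicator)
  qed (use U box_ramp_le_1 in \<open>simp_all del: ennreal_le_1\<close>)
  have lim2': "(\<lambda>j. ennreal (prob A) * (\<integral>\<^sup>+\<omega>. ennreal (box_ramp j U c (future 0 \<omega>)) \<partial>M)) \<longlonglongrightarrow>
      ennreal (prob A) * (\<integral>\<^sup>+\<omega>. indicator (path_box U c) (future 0 \<omega>) \<partial>M)"
    by (rule ennreal_tendsto_cmult[OF _ lim2]) simp
  have eq: "(\<integral>\<^sup>+\<omega>. indicator (path_box U c) (future (T \<omega>) \<omega>) * indicator A \<omega> \<partial>M) =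
      ennreal (prob A) * (\<integral>\<^sup>+\<omega>. indicator (path_box U c) (future 0 \<omega>) \<partial>M)"
    by (rule LIMSEQ_unique[OF lim1[unfolded limit] lim2'])
  have ev1: "{\<omega> \<in> A. future (T \<omega>) \<omega> \<in> path_box U c} \<in> events"
  proof -
    have "{\<omega> \<in> A. future (T \<omega>) \<omega> \<in> path_box U c} = A \<inter> {\<omega> \<in> space M. future (T \<omega>) \<omega> \<in> path_box U c}" using AM by auto
    then show ?thesis using U by simp
  qed
  have ev2: "{\<omega> \<in> space M. future 0 \<omega> \<in> path_box U c} \<in> events" using U by measurable
  have "(\<integral>\<^sup>+\<omega>. indicator (path_box U c) (future (T \<omega>) \<omega>) * indicator A \<omega> \<partial>M) = (\<integral>\<^sup>+\<omega>. indicator {\<omega> \<in> A. future (T \<omega>) \<omega> \<in> path_box U c} \<omega> \<partial>M)"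
    by (intro nn_integral_cong) (auto simp: indicator_def)
  then have 1: "(\<integral>\<^sup>+\<omega>. indicator (path_box U c) (future (T \<omega>) \<omega>) * indicator A \<omega> \<partial>M) = prob {\<omega> \<in> A. future (T \<omega>) \<omega> \<in> path_box U c}"
    using ev1 by (simp add: emeasure_eq_measure)
  have "(\<integral>\<^sup>+\<omega>. indicator (path_box U c) (future 0 \<omega>) \<partial>M) = (\<integral>\<^sup>+\<omega>. indicator {\<omega> \<in> space M. future 0 \<omega> \<in> path_box U c} \<omega> \<partial>M)"
    by (intro nn_integral_cong) (auto simp: indicator_def)
  then have 2: "(\<integral>\<^sup>+\<omega>. indicator (path_box U c) (future 0 \<omega>) \<partial>M) = prob {\<omega> \<in> space M. future 0 \<omega> \<in> path_box U c}"
    using ev2 by (simp add: emeasure_eq_measure)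
  show "prob {\<omega> \<in> A. future (T \<omega>) \<omega> \<in> path_box U c} = prob A * prob {\<omega> \<in> space M. future 0 \<omega> \<in> path_box U c}"
    using eq unfolding 1 2 by (simp add: ennreal_mult[symmetric] ennreal_inj)
qed

end

section \<open>Negative drift\<close>

primrec running_max :: "(nat \<Rightarrow> 'x \<Rightarrow> real) \<Rightarrow> nat \<Rightarrow> 'x \<Rightarrow> real" where
  "running_max s 0 x = 0"
| "running_max s (Suc n) x = max (running_max s n x) (s (Suc n) x)"

lemma running_max_nonneg: "0 \<le> running_max s n x"
  by (induction n) auto

lemma running_max_mono: "n \<le> n' \<Longrightarrow> running_max s n x \<le> running_max s n' x"
  by (rule lift_Suc_mono_le[of "\<lambda>n. running_max s n x"]) auto

lemma running_max_ge: "s 0 x = 0 \<Longrightarrow> s n x \<le> running_max s n x"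
  by (cases n) auto

lemma measurable_running_max [measurable]:
  assumes [measurable]: "\<And>k. s k \<in> borel_measurable N"
  shows "running_max s n \<in> borel_measurable N"
proof (induction n)
  case (Suc n)
  have "(\<lambda>x. max (running_max s n x) (s (Suc n) x)) \<in> borel_measurable N" by (intro borel_measurable_max Suc assms)
  then show ?case by (simp add: fun_eq_iff[symmetric])
qed simp

text \<open>Lindley's recursion: the maximum is either the starting value 0 or is reached after the
  first step \<open>\<xi>\<close>, from where on the walk is that of \<open>z'\<close>.\<close>

lemma running_max_step:
  assumes "s 0 z' = 0" "\<And>k. s (Suc k) z = \<xi> + s k z'"
  shows "running_max s (Suc n) z = max 0 (\<xi> + running_max s n z')"
proof (induction n)
  case (Suc n)
  have "running_max s (Suc (Suc n)) z = max (max 0 (\<xi> + running_max s n z')) (\<xi> + s (Suc n) z')"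
    using Suc assms by simp
  then show ?case by simp
qed (use assms in simp)

text \<open>Restricted to the shift invariant event that the walk \<open>S\<close> is unbounded above, its running maxima \<open>m\<close> satisfy
  \<open>E m\<^sub>n \<le> E m\<^sub>n\<^sub>+\<^sub>1 = E max(0, \<xi> + m\<^sub>n)\<close>, so that \<open>E min(m\<^sub>n, \<xi>\<^sup>-) \<le> E \<xi>\<^sup>+\<close>; since \<open>m\<^sub>n \<rightarrow> \<infinity>\<close> and the event
  does not depend on \<open>\<xi>\<close>, negative drift leaves it no mass.\<close>

lemma (in prob_space) walk_bounded_above:
  fixes s :: "nat \<Rightarrow> 'x \<Rightarrow> real" and Z Z' :: "'a \<Rightarrow> 'x"
  assumes Z [measurable]: "Z \<in> measurable M N" "Z' \<in> measurable M N"
    and \<xi> [measurable]: "\<xi> \<in> borel_measurable M" and s [measurable]: "\<And>k. s k \<in> borel_measurable N"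
    and law: "\<And>B. B \<in> sets N \<Longrightarrow> prob {\<omega> \<in> space M. Z \<omega> \<in> B} = prob {\<omega> \<in> space M. Z' \<omega> \<in> B}"
    and indep: "\<And>B C. B \<in> sets N \<Longrightarrow> C \<in> sets borel \<Longrightarrow>
      prob {\<omega> \<in> space M. Z' \<omega> \<in> B \<and> \<xi> \<omega> \<in> C} = prob {\<omega> \<in> space M. Z' \<omega> \<in> B} * prob {\<omega> \<in> space M. \<xi> \<omega> \<in> C}"
    and s0: "\<And>x. x \<in> space N \<Longrightarrow> s 0 x = 0"
    and step: "\<And>k \<omega>. \<omega> \<in> space M \<Longrightarrow> s (Suc k) (Z \<omega>) = \<xi> \<omega> + s k (Z' \<omega>)"
    and neg: "(\<integral>\<^sup>+\<omega>. ennreal (\<xi> \<omega>) \<partial>M) < (\<integral>\<^sup>+\<omega>. ennreal (- \<xi> \<omega>) \<partial>M)"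
  shows "AE \<omega> in M. \<exists>c. \<forall>k. s k (Z \<omega>) \<le> c"
proof -
  define m where "m = running_max s"
  define U where "U = {x \<in> space N. \<forall>c::nat. \<exists>k. s k x > real c}"
  define A where "A = {\<omega> \<in> space M. Z \<omega> \<in> U}"
  have [measurable]: "m n \<in> borel_measurable N" for n unfolding m_def by (rule measurable_running_max[OF s])
  have U [measurable]: "U \<in> sets N" unfolding U_def by measurable
  have A [measurable]: "A \<in> events" unfolding A_def by measurable
  have ZN: "Z \<omega> \<in> space N" "Z' \<omega> \<in> space N" if "\<omega> \<in> space M" for \<omega>
    using measurable_space[OF Z(1) that] measurable_space[OF Z(2) that] by auto
  have mstep: "m (Suc n) (Z \<omega>) = max 0 (\<xi> \<omega> + m n (Z' \<omega>))" if "\<omega> \<in> space M" for n \<omega>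
    unfolding m_def by (rule running_max_step) (use that s0 step ZN in auto)
  \<comment> \<open>The walks of \<open>Z\<close> and \<open>Z'\<close> differ by one step and by
    the finite amount \<open>\<xi>\<close>, so they are unbounded together. This makes
    \<open>A\<close> an event of \<open>Z'\<close> alone.\<close>
  have A': "A = {\<omega> \<in> space M. Z' \<omega> \<in> U}"
  proof -
    have "Z \<omega> \<in> U \<longleftrightarrow> Z' \<omega> \<in> U" if \<omega>: "\<omega> \<in> space M" for \<omega>
    proof
      assume "Z \<omega> \<in> U"
      then have un: "\<And>c::nat. \<exists>k. s k (Z \<omega>) > real c" by (auto simp: U_def)
      have "\<exists>k. s k (Z' \<omega>) > real c" for c :: nat
      proof -
        obtain c' :: nat where c': "c + \<bar>\<xi> \<omega>\<bar> < c'" using reals_Archimedean2 by blast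
        obtain k where k: "s k (Z \<omega>) > c'" using un by auto
        then have "k \<noteq> 0" using s0[OF ZN(1)[OF \<omega>]] by (auto intro!: Nat.gr0I)
        then obtain k' where "k = Suc k'" by (cases k) auto
        then show ?thesis using k step[OF \<omega>, of k'] c' by (intro exI[of _ k']) auto
      qed
      then show "Z' \<omega> \<in> U" using ZN[OF \<omega>] by (auto simp: U_def)
    next
      assume "Z' \<omega> \<in> U"
      then have un: "\<And>c::nat. \<exists>k. s k (Z' \<omega>) > real c" by (auto simp: U_def)
      have "\<exists>k. s k (Z \<omega>) > real c" for c :: nat
      proof -
        obtain c' :: nat where c': "c + \<bar>\<xi> \<omega>\<bar> < c'" using reals_Archimedean2 by blast
        obtain k where k: "s k (Z' \<omega>) > c'" using un by auto
        then show ?thesis using step[OF \<omega>, of k] c' by (intro exI[of _ "Suc k"]) auto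
      qed
      then show "Z \<omega> \<in> U" using ZN[OF \<omega>] by (auto simp: U_def)
    qed
    then show ?thesis by (auto simp: A_def)
  qed
  define \<mu> where "\<mu> n = (\<integral>\<^sup>+\<omega>. ennreal (m n (Z \<omega>)) * indicator A \<omega> \<partial>M)" for n
  define J where "J n = (\<integral>\<^sup>+\<omega>. min (ennreal (m n (Z' \<omega>))) (ennreal (- \<xi> \<omega>)) * indicator A \<omega> \<partial>M)" for n
  define P where "P = (\<integral>\<^sup>+\<omega>. ennreal (\<xi> \<omega>) * indicator A \<omega> \<partial>M)"
  have \<mu>': "\<mu> n = (\<integral>\<^sup>+\<omega>. ennreal (m n (Z' \<omega>)) * indicator A \<omega> \<partial>M)" for n
  proof -
    have "(\<integral>\<^sup>+\<omega>. (ennreal (m n (Z \<omega>)) * indicator U (Z \<omega>)) * indicator (space M) \<omega> \<partial>M) =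
        ennreal 1 * (\<integral>\<^sup>+\<omega>. ennreal (m n (Z' \<omega>)) * indicator U (Z' \<omega>) \<partial>M)"
      by (rule nn_integral_on_event[where N=N and F="\<lambda>x. ennreal (m n x) * indicator U x"]) (use law in auto)
    moreover have "\<mu> n = (\<integral>\<^sup>+\<omega>. (ennreal (m n (Z \<omega>)) * indicator U (Z \<omega>)) * indicator (space M) \<omega> \<partial>M)"
      unfolding \<mu>_def by (intro nn_integral_cong) (auto simp: A_def indicator_def)
    moreover have "(\<integral>\<^sup>+\<omega>. ennreal (m n (Z' \<omega>)) * indicator U (Z' \<omega>) \<partial>M) = (\<integral>\<^sup>+\<omega>. ennreal (m n (Z' \<omega>)) * indicator A \<omega> \<partial>M)"
      by (intro nn_integral_cong) (auto simp: A' indicator_def)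
    ultimately show ?thesis by simp
  qed
  \<comment> \<open>The recursion gives \<open>max 0 (\<xi> + m) + min m (max 0 (- \<xi>)) = m + max
    0 \<xi>\<close> for \<open>m \<ge> 0\<close>. Keeping sums on both sides avoids subtracting
    quantities that may be infinite.\<close>
  have balance: "\<mu> (Suc n) + J n = \<mu> n + P" for n
  proof -
    have "ennreal (m (Suc n) (Z \<omega>)) + min (ennreal (m n (Z' \<omega>))) (ennreal (- \<xi> \<omega>)) = ennreal (m n (Z' \<omega>)) + ennreal (\<xi> \<omega>)"
      if "\<omega> \<in> space M" for \<omega>
    proof -
      have a: "0 \<le> m n (Z' \<omega>)" by (simp add: m_def running_max_nonneg)
      show ?thesis
      proof (cases "0 \<le> \<xi> \<omega>")
        case True
        then have "ennreal (- \<xi> \<omega>) = 0" by (simp add: ennreal_neg)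
        then show ?thesis using True a by (simp add: mstep[OF that] ennreal_plus add.commute max_absorb2)
      next
        case False
        then have "ennreal (\<xi> \<omega>) = 0" by (simp add: ennreal_neg)
        moreover have "ennreal (m (Suc n) (Z \<omega>)) + ennreal (min (m n (Z' \<omega>)) (- \<xi> \<omega>)) = ennreal (m n (Z' \<omega>))"
        proof -
          have sum: "m (Suc n) (Z \<omega>) + min (m n (Z' \<omega>)) (- \<xi> \<omega>) = m n (Z' \<omega>)"
            by (simp add: mstep[OF that] max_def min_def)
          have "0 \<le> m (Suc n) (Z \<omega>)" "0 \<le> min (m n (Z' \<omega>)) (- \<xi> \<omega>)"
            using False a by (auto simp: m_def running_max_nonneg simp del: running_max.simps)
          from ennreal_plus[OF this] show ?thesis unfolding sum by simp
        qed
        ultimately show ?thesis using False a by (simp add: min_def ennreal_le_iff split: if_splits)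
      qed
    qed
    then have "(\<integral>\<^sup>+\<omega>. (ennreal (m (Suc n) (Z \<omega>)) + min (ennreal (m n (Z' \<omega>))) (ennreal (- \<xi> \<omega>))) * indicator A \<omega> \<partial>M)
      = (\<integral>\<^sup>+\<omega>. (ennreal (m n (Z' \<omega>)) + ennreal (\<xi> \<omega>)) * indicator A \<omega> \<partial>M)"
      by (intro nn_integral_cong) simp
    then show ?thesis unfolding \<mu>'[of n] unfolding \<mu>_def J_def P_def
      by (simp add: distrib_right nn_integral_add)
  qed
  have "P \<le> (\<integral>\<^sup>+\<omega>. ennreal (\<xi> \<omega>) \<partial>M)"
    unfolding P_def by (intro nn_integral_mono) (auto simp: indicator_def)
  also have "\<dots> < \<infinity>" using neg by (auto simp: less_top[symmetric])
  finally have P: "P < \<infinity>" .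
  \<comment> \<open>Finiteness is needed to cancel \<open>\<mu> n\<close> below; it propagates
    because one step adds at most \<open>P\<close>, which is finite by the strict inequality
    \<open>neg\<close>.\<close>
  have fin: "\<mu> n < \<infinity>" for n
  proof (induction n)
    case 0
    then show ?case by (simp add: \<mu>_def m_def)
  next
    case (Suc n)
    have "\<mu> (Suc n) \<le> \<mu> n + P" unfolding balance[symmetric] by simp
    also have "\<dots> < \<infinity>" using Suc P by simp
    finally show ?case .
  qed
  have JP: "J n \<le> P" for n
  proof -
    have "\<mu> n \<le> \<mu> (Suc n)"
      unfolding \<mu>_def by (intro nn_integral_mono mult_right_mono ennreal_leI) (auto simp: m_def)
    then have "\<mu> n + J n \<le> \<mu> n + P" unfolding balance[symmetric] by (rule add_right_mono)
    then show ?thesis using fin[of n] by auto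
  qed
  \<comment> \<open>On \<open>A\<close> the maxima of the walk of \<open>Z'\<close> eventually
    exceed \<open>- \<xi>\<close>, so the truncation by them disappears in the supremum.\<close>
  have "(\<integral>\<^sup>+\<omega>. ennreal (- \<xi> \<omega>) * indicator A \<omega> \<partial>M) =
      (\<integral>\<^sup>+\<omega>. (SUP n. min (ennreal (m n (Z' \<omega>))) (ennreal (- \<xi> \<omega>)) * indicator A \<omega>) \<partial>M)"
  proof (intro nn_integral_cong)
    fix \<omega> assume \<omega>: "\<omega> \<in> space M"
    show "ennreal (- \<xi> \<omega>) * indicator A \<omega> = (SUP n. min (ennreal (m n (Z' \<omega>))) (ennreal (- \<xi> \<omega>)) * indicator A \<omega>)"
    proof (cases "\<omega> \<in> A")
      case True
      then have "Z' \<omega> \<in> U" by (auto simp: A')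
      obtain c :: nat where c: "- \<xi> \<omega> < c" using reals_Archimedean2 by blast
      obtain k where "s k (Z' \<omega>) > c" using \<open>Z' \<omega> \<in> U\<close> by (auto simp: U_def)
      then have k: "- \<xi> \<omega> \<le> m k (Z' \<omega>)"
        using running_max_ge[of s "Z' \<omega>" k] s0[OF ZN(2)[OF \<omega>]] c by (auto simp: m_def)
      have "(SUP n. min (ennreal (m n (Z' \<omega>))) (ennreal (- \<xi> \<omega>))) = ennreal (- \<xi> \<omega>)"
      proof (rule antisym)
        show "(SUP n. min (ennreal (m n (Z' \<omega>))) (ennreal (- \<xi> \<omega>))) \<le> ennreal (- \<xi> \<omega>)" by (rule SUP_least) simp
        have "ennreal (- \<xi> \<omega>) = min (ennreal (m k (Z' \<omega>))) (ennreal (- \<xi> \<omega>))"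
          using k by (simp add: min_absorb2 ennreal_leI)
        also have "\<dots> \<le> (SUP n. min (ennreal (m n (Z' \<omega>))) (ennreal (- \<xi> \<omega>)))" by (rule SUP_upper) simp
        finally show "ennreal (- \<xi> \<omega>) \<le> (SUP n. min (ennreal (m n (Z' \<omega>))) (ennreal (- \<xi> \<omega>)))" .
      qed
      then show ?thesis using True by simp
    qed simp
  qed
  also have "\<dots> = (SUP n. J n)"
    unfolding J_def
  proof (rule nn_integral_monotone_convergence_SUP)
    show "incseq (\<lambda>n \<omega>. min (ennreal (m n (Z' \<omega>))) (ennreal (- \<xi> \<omega>)) * indicator A \<omega>)"
      unfolding incseq_def le_fun_def m_def
      by (intro allI impI mult_right_mono min.mono ennreal_leI running_max_mono) auto
  qed measurable
  also have "\<dots> \<le> P" by (rule SUP_least) (rule JP)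
  finally have le: "(\<integral>\<^sup>+\<omega>. ennreal (- \<xi> \<omega>) * indicator A \<omega> \<partial>M) \<le> P" .
  have split: "prob {\<omega> \<in> A. \<xi> \<omega> \<in> B} = prob A * prob {\<omega> \<in> space M. \<xi> \<omega> \<in> B}" if "B \<in> sets borel" for B
  proof -
    have "{\<omega> \<in> A. \<xi> \<omega> \<in> B} = {\<omega> \<in> space M. Z' \<omega> \<in> U \<and> \<xi> \<omega> \<in> B}" by (auto simp: A')
    then show ?thesis using indep[OF U that] A' by simp
  qed
  have indep_int: "(\<integral>\<^sup>+\<omega>. F (\<xi> \<omega>) * indicator A \<omega> \<partial>M) = ennreal (prob A) * (\<integral>\<^sup>+\<omega>. F (\<xi> \<omega>) \<partial>M)"
    if "F \<in> borel_measurable borel" for F :: "real \<Rightarrow> ennreal"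
    by (rule nn_integral_on_event[where N=borel]) (use that split in auto)
  have "prob A = 0"
  proof (rule ccontr)
    assume "prob A \<noteq> 0"
    then have pos: "0 < ennreal (prob A)" by (simp add: zero_less_measure_iff)
    have "ennreal (prob A) * (\<integral>\<^sup>+\<omega>. ennreal (- \<xi> \<omega>) \<partial>M) \<le> ennreal (prob A) * (\<integral>\<^sup>+\<omega>. ennreal (\<xi> \<omega>) \<partial>M)"
      using le indep_int[of "\<lambda>x. ennreal (- x)"] indep_int[of "\<lambda>x. ennreal x"] unfolding P_def by simp
    then have "(\<integral>\<^sup>+\<omega>. ennreal (- \<xi> \<omega>) \<partial>M) \<le> (\<integral>\<^sup>+\<omega>. ennreal (\<xi> \<omega>) \<partial>M)"
      using pos by (subst (asm) ennreal_mult_le_mult_iff) auto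
    then show False using neg by simp
  qed
  then have "AE \<omega> in M. \<omega> \<notin> A" using A by (simp add: AE_iff_measurable[OF _ refl] prob_eq_0)
  then show ?thesis
  proof (rule AE_mp, intro AE_I2 impI)
    fix \<omega> assume \<omega>: "\<omega> \<in> space M" "\<omega> \<notin> A"
    then obtain c :: nat where "\<forall>k. s k (Z \<omega>) \<le> real c" using ZN[OF \<omega>(1)] by (auto simp: A_def U_def not_less)
    then show "\<exists>c. \<forall>k. s k (Z \<omega>) \<le> c" by blast
  qed
qed

section \<open>From integer times to all times\<close>

lemma cadlag_uminus: "cadlag y \<Longrightarrow> cadlag (\<lambda>u. - y u)"
  by (rule cadlagI[where l="\<lambda>t. - left_limit y t"]) (intro tendsto_minus cadlag_right cadlag_left; assumption)+

lemma cadlag_bounded_above: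
  assumes y: "cadlag y"
  shows "\<exists>c. \<forall>u\<in>{a..b}. y u \<le> c"
proof -
  have "\<exists>c d. d > 0 \<and> (\<forall>u\<in>{t-d<..<t+d}. y u \<le> c)" for t
  proof -
    have "min (- y t) (left_limit (\<lambda>u. - y u) t) - 1 < min (- y t) (left_limit (\<lambda>u. - y u) t)" by linarith
    from cadlag_locally_above[OF cadlag_uminus[OF y] this] obtain d where
      d: "d > 0" "\<forall>u\<in>{t-d<..<t+d}. min (- y t) (left_limit (\<lambda>u. - y u) t) - 1 < - y u" by auto
    then show ?thesis
      by (intro exI[of _ "1 - min (- y t) (left_limit (\<lambda>u. - y u) t)"] exI[of _ d]) fastforce
  qed
  then obtain c d where cd: "\<And>t. d t > 0" "\<And>t u. u \<in> {t-d t<..<t+d t} \<Longrightarrow> y u \<le> c t" by metis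
  have "compact {a..b}" by simp
  then obtain F where F: "finite F" "{a..b} \<subseteq> (\<Union>t\<in>F. {t-d t<..<t+d t})"
  proof (rule compactE_image[where C="{a..b}" and f="\<lambda>t. {t-d t<..<t+d t}"])
    show "{a..b} \<subseteq> (\<Union>t\<in>{a..b}. {t-d t<..<t+d t})" using cd(1) by force
  qed (auto intro: that)
  \<comment> \<open>A sum of absolute values dominates every local bound and also makes sense for an
    empty cover.\<close>
  have "y u \<le> (\<Sum>t\<in>F. \<bar>c t\<bar>)" if u: "u \<in> {a..b}" for u
  proof -
    obtain t where t: "t \<in> F" "u \<in> {t-d t<..<t+d t}" using F u by blast
    have "y u \<le> \<bar>c t\<bar>" using cd(2)[OF t(2)] by linarith
    also have "\<dots> \<le> (\<Sum>t\<in>F. \<bar>c t\<bar>)" using F t by (intro member_le_sum) auto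
    finally show ?thesis .
  qed
  then show ?thesis by blast
qed

text \<open>Dyadic grids are nested, which the grids of mesh \<open>1 / Suc n\<close> are not;
  nesting makes the events in \<open>past_bounded_below\<close> increase.\<close>

lemma cadlag_along_dyadic_grid:
  assumes "cadlag y"
  shows "(\<lambda>n. y ((of_int \<lfloor>t * 2 ^ n\<rfloor> + 1) / 2 ^ n)) \<longlonglongrightarrow> y t"
proof -
  \<comment> \<open>Mesh \<open>1 / 2 ^ n\<close> is index \<open>2 ^ n - 1\<close>, because
    \<open>grid_above\<close> divides by the successor of its index.\<close>
  have "strict_mono (\<lambda>n. 2 ^ n - 1 :: nat)"
    by (rule strict_monoI_Suc) (simp add: diff_less_mono)
  from LIMSEQ_subseq_LIMSEQ[OF cadlag_along_grid[OF assms, of t 0] this]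
  have "(\<lambda>n. y (grid_above (2 ^ n - 1) t)) \<longlonglongrightarrow> y t" by (simp add: o_def)
  moreover have "real (Suc (2 ^ n - 1)) = 2 ^ n" for n by (simp del: of_nat_Suc)
  ultimately show ?thesis by (simp add: grid_above_def del: of_nat_Suc)
qed

context levy_process
begin

text \<open>Without its first step the walk is that of \<open>future 1\<close>. The step is minus
  the value of \<open>past 1\<close> at time -1, hence independent of that future.\<close>

lemma forward_walk_bounded_above:
  assumes neg: "(\<integral>\<^sup>+\<omega>. ennreal (Y 1 \<omega> - Y 0 \<omega>) \<partial>M) < (\<integral>\<^sup>+\<omega>. ennreal (- (Y 1 \<omega> - Y 0 \<omega>)) \<partial>M)"
  shows "AE \<omega> in M. \<exists>c. \<forall>k::nat. Y k \<omega> - Y 0 \<omega> \<le> c"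
proof -
  have "AE \<omega> in M. \<exists>c. \<forall>k::nat. future 0 \<omega> (real k) - future 0 \<omega> 0 \<le> c"
  proof (rule walk_bounded_above[where s="\<lambda>k x. x (real k) - x 0" and N=path_space and Z="future 0" and Z'="future 1" and \<xi>="\<lambda>\<omega>. Y 1 \<omega> - Y 0 \<omega>"])
    fix B and C :: "real set" assume B: "B \<in> sets path_space" and C: "C \<in> sets borel"
    have C': "{x \<in> space path_space. - x (- 1) \<in> C} \<in> sets path_space" using C by measurable
    have eq: "Y 1 \<omega> - Y 0 \<omega> \<in> C \<longleftrightarrow> past 1 \<omega> \<in> {x \<in> space path_space. - x (- 1) \<in> C}" if "\<omega> \<in> space M" for \<omega>
    proof -
      have "past 1 \<omega> (- 1) = - (Y 1 \<omega> - Y 0 \<omega>)" by (simp add: past_def)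
      then show ?thesis using cadlag_past[OF that] by simp
    qed
    have "{\<omega> \<in> space M. future 1 \<omega> \<in> B \<and> Y 1 \<omega> - Y 0 \<omega> \<in> C} =
        {\<omega> \<in> space M. past 1 \<omega> \<in> {x \<in> space path_space. - x (- 1) \<in> C} \<and> future 1 \<omega> \<in> B}"
      "{\<omega> \<in> space M. Y 1 \<omega> - Y 0 \<omega> \<in> C} = {\<omega> \<in> space M. past 1 \<omega> \<in> {x \<in> space path_space. - x (- 1) \<in> C}}"
      using eq by blast+
    then show "prob {\<omega> \<in> space M. future 1 \<omega> \<in> B \<and> Y 1 \<omega> - Y 0 \<omega> \<in> C} =
        prob {\<omega> \<in> space M. future 1 \<omega> \<in> B} * prob {\<omega> \<in> space M. Y 1 \<omega> - Y 0 \<omega> \<in> C}"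
      using past_future_indep[OF C' B, of 1] by (simp only: mult.commute)
  qed (use neg future_prob[of _ 1] in \<open>simp_all\<close>, simp add: future_def)
  then show ?thesis by (simp add: future_def)
qed

text \<open>In reversed time the roles are exchanged: the first step is the value of
  \<open>future (-1)\<close> at time 1, and the rest of the walk is read from
  \<open>past (-1)\<close>. Stationarity transfers the drift condition to this step.\<close>

lemma backward_walk_bounded_above:
  assumes neg: "(\<integral>\<^sup>+\<omega>. ennreal (Y 1 \<omega> - Y 0 \<omega>) \<partial>M) < (\<integral>\<^sup>+\<omega>. ennreal (- (Y 1 \<omega> - Y 0 \<omega>)) \<partial>M)"
  shows "AE \<omega> in M. \<exists>c. \<forall>k::nat. Y 0 \<omega> - Y (- real k) \<omega> \<le> c"
proof -
  have int_eq: "(\<integral>\<^sup>+\<omega>. F (Y 0 \<omega> - Y (-1) \<omega>) \<partial>M) = (\<integral>\<^sup>+\<omega>. F (Y 1 \<omega> - Y 0 \<omega>) \<partial>M)"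
    if [measurable]: "F \<in> borel_measurable borel" for F :: "real \<Rightarrow> ennreal"
  proof -
    have "(\<integral>\<^sup>+\<omega>. F (Y 0 \<omega> - Y (-1) \<omega>) \<partial>M) = (\<integral>\<^sup>+x. F x \<partial>distr M borel (\<lambda>\<omega>. Y (-1 + 1) \<omega> - Y (-1 + 0) \<omega>))"
      by (subst nn_integral_distr) auto
    also have "\<dots> = (\<integral>\<^sup>+\<omega>. F (Y 1 \<omega> - Y 0 \<omega>) \<partial>M)"
      unfolding increment_law by (subst nn_integral_distr) auto
    finally show ?thesis .
  qed
  have "AE \<omega> in M. \<exists>c. \<forall>k::nat. past 0 \<omega> 0 - past 0 \<omega> (- real k) \<le> c"
  proof (rule walk_bounded_above[where s="\<lambda>k x. x 0 - x (- real k)" and N=path_space and Z="past 0" and Z'="past (-1)" and \<xi>="\<lambda>\<omega>. Y 0 \<omega> - Y (-1) \<omega>"])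
    fix B and C :: "real set" assume B: "B \<in> sets path_space" and C: "C \<in> sets borel"
    have C': "{x \<in> space path_space. x 1 \<in> C} \<in> sets path_space" using C by measurable
    have eq: "Y 0 \<omega> - Y (-1) \<omega> \<in> C \<longleftrightarrow> future (-1) \<omega> \<in> {x \<in> space path_space. x 1 \<in> C}" if "\<omega> \<in> space M" for \<omega>
    proof -
      have "future (-1) \<omega> 1 = Y 0 \<omega> - Y (-1) \<omega>" by (simp add: future_def)
      then show ?thesis using cadlag_future[OF that] by simp
    qed
    have "{\<omega> \<in> space M. past (-1) \<omega> \<in> B \<and> Y 0 \<omega> - Y (-1) \<omega> \<in> C} =
        {\<omega> \<in> space M. past (-1) \<omega> \<in> B \<and> future (-1) \<omega> \<in> {x \<in> space path_space. x 1 \<in> C}}"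
      "{\<omega> \<in> space M. Y 0 \<omega> - Y (-1) \<omega> \<in> C} = {\<omega> \<in> space M. future (-1) \<omega> \<in> {x \<in> space path_space. x 1 \<in> C}}"
      using eq by blast+
    then show "prob {\<omega> \<in> space M. past (-1) \<omega> \<in> B \<and> Y 0 \<omega> - Y (-1) \<omega> \<in> C} =
        prob {\<omega> \<in> space M. past (-1) \<omega> \<in> B} * prob {\<omega> \<in> space M. Y 0 \<omega> - Y (-1) \<omega> \<in> C}"
      using past_future_indep[OF B C', of "-1"] by (simp only:)
  next
    show "(\<integral>\<^sup>+\<omega>. ennreal (Y 0 \<omega> - Y (-1) \<omega>) \<partial>M) < (\<integral>\<^sup>+\<omega>. ennreal (- (Y 0 \<omega> - Y (-1) \<omega>)) \<partial>M)"
      using neg int_eq[of ennreal] int_eq[of "\<lambda>x. ennreal (- x)"] by simp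
  next
    show "prob {\<omega> \<in> space M. past 0 \<omega> \<in> B} = prob {\<omega> \<in> space M. past (-1) \<omega> \<in> B}" if "B \<in> sets path_space" for B
      using past_prob[OF that, of "-1"] by simp
  next
    fix k :: nat and \<omega>
    have "past (-1) \<omega> (- real k) = Y (- real (Suc k)) \<omega> - Y (-1) \<omega>"
      unfolding past_def by (rule arg_cong[where f="\<lambda>t. Y t \<omega> - _"]) simp
    moreover have "past 0 \<omega> (- real (Suc k)) = Y (- real (Suc k)) \<omega> - Y 0 \<omega>"
      unfolding past_def by (rule arg_cong[where f="\<lambda>t. Y t \<omega> - _"]) simp
    moreover have "past q \<omega> 0 = 0" for q by (simp add: past_def)
    ultimately show "past 0 \<omega> 0 - past 0 \<omega> (- real (Suc k)) =
        Y 0 \<omega> - Y (-1) \<omega> + (past (-1) \<omega> 0 - past (-1) \<omega> (- real k))"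
      by simp
  qed simp_all
  then show ?thesis by (simp add: past_def)
qed

text \<open>A cadlag path is bounded on a compact interval, so the probabilities tend to 1 as the
  level grows. Any positive bound would do for Ottaviani's argument; \<open>1 / 2\<close> produces
  the factor 2 there.\<close>

lemma past_oscillation:
  "\<exists>C::nat. 1 / 2 \<le> prob {\<omega> \<in> space M. \<forall>v\<in>\<rat>. -1 \<le> v \<and> v \<le> 0 \<longrightarrow> past 0 \<omega> v \<le> real C}"
proof -
  define B where "B C = {\<omega> \<in> space M. \<forall>v\<in>\<rat>. -1 \<le> v \<and> v \<le> 0 \<longrightarrow> past 0 \<omega> v \<le> real C}" for C :: nat
  have [measurable]: "B C \<in> events" for C unfolding B_def by measurable
  have "incseq B"
    unfolding incseq_def B_def by (auto intro: order_trans)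
  moreover have "(\<Union>C. B C) = space M"
  proof (intro equalityI subsetI)
    fix \<omega> assume \<omega>: "\<omega> \<in> space M"
    obtain c where c: "\<forall>v\<in>{-1..0}. past 0 \<omega> v \<le> c" using cadlag_bounded_above[OF cadlag_past[OF \<omega>]] by blast
    obtain C :: nat where "c \<le> real C" using real_arch_simple by blast
    have "past 0 \<omega> v \<le> real C" if "-1 \<le> v" "v \<le> 0" for v
    proof -
      have "past 0 \<omega> v \<le> c" using c that by simp
      also note \<open>c \<le> real C\<close>
      finally show ?thesis .
    qed
    then have "\<omega> \<in> B C" using \<omega> by (simp add: B_def)
    then show "\<omega> \<in> (\<Union>C. B C)" by blast
  qed (auto simp: B_def)
  ultimately have "(\<lambda>C. prob (B C)) \<longlonglongrightarrow> 1"
    using finite_Lim_measure_incseq[of B] by (simp add: prob_space image_subset_iff)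
  from order_tendstoD(1)[OF this, of "1/2"] have "\<exists>C. 1/2 < prob (B C)"
    by (auto simp: eventually_sequentially)
  then show ?thesis unfolding B_def by (auto intro: less_imp_le)
qed

text \<open>Ottaviani's inequality, in reversed time: let \<open>t\<close> be the last dyadic time before 0 at which the path is more
  than \<open>k\<close> below its value at 0. During the unit of time before \<open>t\<close>, which contains an integer, the path exceeds its value
  at \<open>t\<close> by at most \<open>C\<close> with probability at least \<open>1/2\<close>, independently of what happens after \<open>t\<close>.\<close>

lemma dyadic_infimum_inequality:
  assumes C: "1 / 2 \<le> prob {\<omega> \<in> space M. \<forall>v\<in>\<rat>. -1 \<le> v \<and> v \<le> 0 \<longrightarrow> past 0 \<omega> v \<le> real C}"
  shows "prob {\<omega> \<in> space M. \<exists>i::nat. Y 0 \<omega> - Y (- (real i / 2 ^ n)) \<omega> > k} \<le>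
    2 * prob {\<omega> \<in> space M. \<exists>j::nat. Y 0 \<omega> - Y (- real j) \<omega> > k - real C}"
proof -
  define t where "t i = - (real i / 2 ^ n)" for i
  define B where "B = {x \<in> space path_space. \<forall>v\<in>\<rat>. -1 \<le> v \<and> v \<le> 0 \<longrightarrow> x v \<le> real C}"
  define E where "E i = {\<omega> \<in> space M. Y 0 \<omega> - Y (t i) \<omega> > k \<and> (\<forall>j<i. \<not> Y 0 \<omega> - Y (t j) \<omega> > k)}" for i
  define E' where "E' i = {\<omega> \<in> E i. past (t i) \<omega> \<in> B}" for i
  have B [measurable]: "B \<in> sets path_space" unfolding B_def by measurable
  have E [measurable]: "E i \<in> events" for i unfolding E_def by measurable
  have E' [measurable]: "E' i \<in> events" for i
  proof -
    have "E' i = E i \<inter> {\<omega> \<in> space M. past (t i) \<omega> \<in> B}" by (auto simp: E'_def E_def)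
    then show ?thesis by simp
  qed
  have half: "prob (E i) \<le> 2 * prob (E' i)" for i
  proof -
    \<comment> \<open>Seen from \<open>t i\<close>, the times 0 and \<open>t j\<close> are
      \<open>- t i\<close> and \<open>t j - t i\<close>. Both are nonnegative because
      \<open>t\<close> decreases, so the event lies in the future of \<open>t i\<close>.\<close>
    define K where "K = {x \<in> space path_space. x (- t i) > k \<and> (\<forall>j<i. \<not> x (- t i) - x (t j - t i) > k)}"
    have K: "K \<in> sets path_space" unfolding K_def by measurable
    have tj: "0 \<le> t j - t i" if "j < i" for j
      using that by (simp add: t_def divide_right_mono)
    have eq: "\<omega> \<in> E i \<longleftrightarrow> future (t i) \<omega> \<in> K" if "\<omega> \<in> space M" for \<omega>
    proof -
      have "0 \<le> - t i" by (simp add: t_def)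
      then show ?thesis using that cadlag_future[OF that] tj by (auto simp: E_def K_def future_def)
    qed
    have "E i = {\<omega> \<in> space M. future (t i) \<omega> \<in> K}" using eq by (auto simp: E_def)
    moreover have "E' i = {\<omega> \<in> space M. past (t i) \<omega> \<in> B \<and> future (t i) \<omega> \<in> K}" using eq by (auto simp: E'_def E_def)
    ultimately have "prob (E' i) = prob {\<omega> \<in> space M. past 0 \<omega> \<in> B} * prob (E i)"
      using past_future_indep[OF B K, of "t i"] past_prob[OF B, of "t i"] by metis
    moreover have "{\<omega> \<in> space M. past 0 \<omega> \<in> B} = {\<omega> \<in> space M. \<forall>v\<in>\<rat>. -1 \<le> v \<and> v \<le> 0 \<longrightarrow> past 0 \<omega> v \<le> real C}"
      using cadlag_past by (auto simp: B_def)
    ultimately have "1 / 2 * prob (E i) \<le> prob (E' i)"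
      using C mult_right_mono[OF C, of "prob (E i)"] by simp
    then show ?thesis by simp
  qed
  have disj: "disjoint_family E"
    unfolding disjoint_family_on_def E_def by (auto) (metis linorder_neqE_nat)
  have disj': "disjoint_family E'"
    using disj unfolding disjoint_family_on_def E'_def by blast
  have "{\<omega> \<in> space M. \<exists>i::nat. Y 0 \<omega> - Y (- (real i / 2 ^ n)) \<omega> > k} = (\<Union>i. E i)"
  proof (intro equalityI subsetI)
    fix \<omega> assume "\<omega> \<in> {\<omega> \<in> space M. \<exists>i::nat. Y 0 \<omega> - Y (- (real i / 2 ^ n)) \<omega> > k}"
    then have \<omega>: "\<omega> \<in> space M" "\<exists>i. Y 0 \<omega> - Y (t i) \<omega> > k" by (auto simp: t_def)
    from exists_least_iff[THEN iffD1, OF \<omega>(2)] \<omega>(1) show "\<omega> \<in> (\<Union>i. E i)" by (auto simp: E_def)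
  qed (auto simp: E_def t_def)
  moreover have "prob (\<Union>i. E i) \<le> 2 * prob (\<Union>i. E' i)"
  proof (rule sums_le)
    show "(\<lambda>i. prob (E i)) sums prob (\<Union>i. E i)" by (rule finite_measure_UNION) (use disj in auto)
    show "(\<lambda>i. 2 * prob (E' i)) sums (2 * prob (\<Union>i. E' i))"
      by (intro sums_mult finite_measure_UNION) (use disj' in auto)
  qed (rule half)
  moreover have "prob (\<Union>i. E' i) \<le> prob {\<omega> \<in> space M. \<exists>j::nat. Y 0 \<omega> - Y (- real j) \<omega> > k - real C}"
  proof (rule finite_measure_mono)
    show "(\<Union>i. E' i) \<subseteq> {\<omega> \<in> space M. \<exists>j::nat. Y 0 \<omega> - Y (- real j) \<omega> > k - real C}"
    proof
      fix \<omega> assume "\<omega> \<in> (\<Union>i. E' i)"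
      then obtain i where i: "\<omega> \<in> space M" "Y 0 \<omega> - Y (t i) \<omega> > k" "past (t i) \<omega> \<in> B" by (auto simp: E'_def E_def)
      define j where "j = nat \<lceil>- t i\<rceil>"
      have "0 \<le> - t i" by (simp add: t_def)
      then have j: "- t i \<le> real j" "real j < - t i + 1" unfolding j_def by linarith+
      \<comment> \<open>The integer time \<open>- j\<close> is the one in the unit of time before
        \<open>t i\<close>. Its displacement is rational, so the bound in \<open>B\<close>, tested
        at rationals, applies to it.\<close>
      have v: "- real j - t i \<in> \<rat>" "-1 \<le> - real j - t i" "- real j - t i \<le> 0" using j by (auto simp: t_def)
      then have "past (t i) \<omega> (- real j - t i) \<le> real C" using i(3) unfolding B_def by blast
      then have "Y (- real j) \<omega> - Y (t i) \<omega> \<le> real C" using v(3) by (simp add: past_def min_absorb1)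
      then show "\<omega> \<in> {\<omega> \<in> space M. \<exists>j::nat. Y 0 \<omega> - Y (- real j) \<omega> > k - real C}"
        using i by (auto intro!: exI[of _ j])
    qed
  qed measurable
  ultimately show ?thesis by simp
qed

text \<open>The walk controls integer times. The dyadic inequality has constants independent of
  \<open>n\<close>, so it passes to all dyadic times, and right continuity then covers the remaining
  ones.\<close>

theorem past_bounded_below:
  assumes neg: "(\<integral>\<^sup>+\<omega>. ennreal (Y 1 \<omega> - Y 0 \<omega>) \<partial>M) < (\<integral>\<^sup>+\<omega>. ennreal (- (Y 1 \<omega> - Y 0 \<omega>)) \<partial>M)"
  shows "AE \<omega> in M. \<exists>c. \<forall>v\<le>0. c \<le> Y v \<omega>"
proof -
  obtain C :: nat where C: "1 / 2 \<le> prob {\<omega> \<in> space M. \<forall>v\<in>\<rat>. -1 \<le> v \<and> v \<le> 0 \<longrightarrow> past 0 \<omega> v \<le> real C}"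
    using past_oscillation by auto
  define D where "D k n = {\<omega> \<in> space M. \<exists>i::nat. Y 0 \<omega> - Y (- (real i / 2 ^ n)) \<omega> > real k}" for k n :: nat
  define G where "G k = {\<omega> \<in> space M. \<exists>j::nat. Y 0 \<omega> - Y (- real j) \<omega> > real k - real C}" for k :: nat
  have [measurable]: "D k n \<in> events" "G k \<in> events" for k n unfolding D_def G_def by measurable
  have D: "prob (\<Union>n. D k n) \<le> 2 * prob (G k)" for k
  proof (rule LIMSEQ_le_const2)
    have "incseq (D k)"
    proof (rule incseq_SucI, rule subsetI)
      fix n \<omega> assume "\<omega> \<in> D k n"
      then obtain i where i: "\<omega> \<in> space M" "Y 0 \<omega> - Y (- (real i / 2 ^ n)) \<omega> > real k" by (auto simp: D_def)
      have "real i / 2 ^ n = real (2 * i) / 2 ^ Suc n" by simp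
      then show "\<omega> \<in> D k (Suc n)" using i by (auto simp: D_def intro!: exI[of _ "2 * i"])
    qed
    then show "(\<lambda>n. prob (D k n)) \<longlonglongrightarrow> prob (\<Union>n. D k n)"
      by (intro finite_Lim_measure_incseq) auto
    show "\<exists>N. \<forall>n\<ge>N. prob (D k n) \<le> 2 * prob (G k)"
      unfolding D_def G_def using dyadic_infimum_inequality[OF C] by blast
  qed
  have null: "prob (\<Inter>k. G k) = 0"
  proof -
    have "AE \<omega> in M. \<omega> \<notin> (\<Inter>k. G k)"
      using backward_walk_bounded_above[OF neg]
    proof (rule AE_mp, intro AE_I2 impI)
      fix \<omega> assume "\<exists>c. \<forall>k::nat. Y 0 \<omega> - Y (- real k) \<omega> \<le> c"
      then obtain c where c: "\<And>k::nat. Y 0 \<omega> - Y (- real k) \<omega> \<le> c" by auto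
      obtain k :: nat where "c + real C \<le> real k" using real_arch_simple by blast
      then have "Y 0 \<omega> - Y (- real j) \<omega> \<le> real k - real C" for j using c[of j] by linarith
      then have "\<omega> \<notin> G k" by (simp add: G_def not_less)
      then show "\<omega> \<notin> (\<Inter>k. G k)" by blast
    qed
    then show ?thesis by (subst prob_eq_0) auto
  qed
  have "decseq G"
  proof (rule decseq_SucI, rule subsetI)
    fix k \<omega> assume "\<omega> \<in> G (Suc k)"
    then obtain j where "\<omega> \<in> space M" "Y 0 \<omega> - Y (- real j) \<omega> > real (Suc k) - real C" by (auto simp: G_def)
    moreover have "real k - real C < real (Suc k) - real C" by simp
    ultimately show "\<omega> \<in> G k" unfolding G_def by (auto intro!: exI[of _ j])
  qed
  then have "(\<lambda>k. prob (G k)) \<longlonglongrightarrow> 0"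
    using finite_Lim_measure_decseq[of G] null by (simp add: image_subset_iff)
  then have lim: "(\<lambda>k. 2 * prob (G k)) \<longlonglongrightarrow> 0" using tendsto_mult_right_zero by blast
  have "prob (\<Inter>k. \<Union>n. D k n) \<le> 0"
  proof (rule LIMSEQ_le_const[OF lim])
    have "prob (\<Inter>k. \<Union>n. D k n) \<le> 2 * prob (G k)" for k
      using finite_measure_mono[of "\<Inter>k. \<Union>n. D k n" "\<Union>n. D k n"] D[of k] by force
    then show "\<exists>N. \<forall>k\<ge>N. prob (\<Inter>k. \<Union>n. D k n) \<le> 2 * prob (G k)" by blast
  qed
  then have "prob (\<Inter>k. \<Union>n. D k n) = 0" using measure_nonneg antisym by blast
  then have "AE \<omega> in M. \<omega> \<notin> (\<Inter>k. \<Union>n. D k n)" by (subst (asm) prob_eq_0) auto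
  then show ?thesis
  proof (rule AE_mp, intro AE_I2 impI)
    fix \<omega> assume \<omega>: "\<omega> \<in> space M" "\<omega> \<notin> (\<Inter>k. \<Union>n. D k n)"
    then obtain k where k: "\<And>n. \<omega> \<notin> D k n" by blast
    have low: "Y 0 \<omega> - real k \<le> Y v \<omega>" if "v < 0" for v
    proof (rule LIMSEQ_le_const[OF cadlag_along_dyadic_grid[OF cadlag_Y[OF \<omega>(1)], of v]])
      have "Y 0 \<omega> - real k \<le> Y ((of_int \<lfloor>v * 2 ^ n\<rfloor> + 1) / 2 ^ n) \<omega>" for n
      proof -
        have "v * 2 ^ n < 0" using that by (simp add: mult_neg_pos)
        \<comment> \<open>For negative \<open>v\<close> the dyadic point strictly above it is still
          at most 0, so it is among the times covered by \<open>D k n\<close>. The time 0 itself is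
          treated separately at the end.\<close>
        then have "\<lfloor>v * 2 ^ n\<rfloor> + 1 \<le> 0" by linarith
        then have "(of_int \<lfloor>v * 2 ^ n\<rfloor> + 1 :: real) = - real (nat (- (\<lfloor>v * 2 ^ n\<rfloor> + 1)))" by simp
        then have eq: "(of_int \<lfloor>v * 2 ^ n\<rfloor> + 1) / 2 ^ n = - (real (nat (- (\<lfloor>v * 2 ^ n\<rfloor> + 1))) / 2 ^ n)"
          by (simp only: minus_divide_left)
        have "\<not> Y 0 \<omega> - Y (- (real i / 2 ^ n)) \<omega> > real k" for i
          using k[of n] \<omega>(1) unfolding D_def by blast
        then have "Y 0 \<omega> - Y (- (real (nat (- (\<lfloor>v * 2 ^ n\<rfloor> + 1))) / 2 ^ n)) \<omega> \<le> real k"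
          by (simp only: not_less)
        then show ?thesis unfolding eq by linarith
      qed
      then show "\<exists>N. \<forall>n\<ge>N. Y 0 \<omega> - real k \<le> Y ((of_int \<lfloor>v * 2 ^ n\<rfloor> + 1) / 2 ^ n) \<omega>" by blast
    qed
    show "\<exists>c. \<forall>v\<le>0. c \<le> Y v \<omega>"
    proof (intro exI[of _ "Y 0 \<omega> - real k"] allI impI)
      fix v :: real assume "v \<le> 0"
      then show "Y 0 \<omega> - real k \<le> Y v \<omega>" using low by (cases "v = 0") auto
    qed
  qed
qed

end

section \<open>The infimum is attained at the next infimum time\<close>

text \<open>The comparison is made pair by pair through increments, because those are what
  \<open>past_algebra\<close> sees, and because the earlier infimum itself might be minus
  infinity.\<close>

definition near_infimum :: "(real \<Rightarrow> real) \<Rightarrow> real \<Rightarrow> real \<Rightarrow> real set" where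
  "near_infimum y p e = {u \<in> \<rat>. p < u \<and> (\<forall>v\<in>\<rat>. v < p \<longrightarrow> y u - y v < e)}"

text \<open>The default 0 only makes the time total; the strong Markov property is applied on the
  event that the set is nonempty.\<close>

definition near_infimum_time :: "(real \<Rightarrow> real) \<Rightarrow> real \<Rightarrow> real \<Rightarrow> real" where
  "near_infimum_time y p e = (if near_infimum y p e = {} then 0 else Inf (near_infimum y p e))"

text \<open>No order is imposed on \<open>u\<close> and \<open>w\<close>: the condition is that the
  oscillation of \<open>x\<close> over rational times in \<open>(0, d)\<close> exceeds
  \<open>e\<close>.\<close>

definition early_rise :: "real \<Rightarrow> real \<Rightarrow> (real \<Rightarrow> real) \<Rightarrow> bool" where
  "early_rise d e x \<longleftrightarrow> (\<exists>u\<in>\<rat>. \<exists>w\<in>\<rat>. 0 < u \<and> u < d \<and> 0 < w \<and> w < d \<and> x w - x u > e)"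

lemma near_infimum_time_less_iff:
  "near_infimum y p e \<noteq> {} \<Longrightarrow> near_infimum_time y p e < q \<longleftrightarrow> (\<exists>u\<in>near_infimum y p e. u < q)"
proof -
  assume ne: "near_infimum y p e \<noteq> {}"
  have "bdd_below (near_infimum y p e)" by (rule bdd_belowI[of _ p]) (auto simp: near_infimum_def)
  then show ?thesis using ne by (simp add: near_infimum_time_def cInf_less_iff)
qed

text \<open>An upward jump at \<open>D\<close> from the level of the earlier infimum is announced by the times at which the path
  comes close to that infimum: they are stopping times which increase strictly to \<open>D\<close>.\<close>

lemma jump_announced:
  assumes y: "cadlag y" and p: "p \<in> \<rat>" "t < p" "p < D" and free: "inf_times y \<inter> {t<..<D} = {}"
    and low: "\<And>v. v < p \<Longrightarrow> left_limit y D \<le> y v" and jump: "left_limit y D + e < y D" and "d > 0"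
  shows "\<exists>m. \<forall>n\<ge>m. near_infimum y p (1 / Suc n) \<noteq> {} \<and>
    early_rise d e (\<lambda>u. y (near_infimum_time y p (1 / Suc n) + max u 0) - y (near_infimum_time y p (1 / Suc n)))"
proof -
  \<comment> \<open>With \<open>q\<close> closer than \<open>d / 2\<close> to \<open>D\<close>, an
    announcing time between \<open>q\<close> and \<open>D\<close> sees both sides of the jump within
    time \<open>d\<close>.\<close>
  obtain q where q: "q \<in> \<rat>" "max p (D - d / 2) < q" "q < D"
    using Rats_dense_in_real[of "max p (D - d / 2)" D] p \<open>d > 0\<close> by auto
  \<comment> \<open>No infimum time lies in \<open>(t, D)\<close>, so \<open>(p, q)\<close> is not a
    record. The resulting \<open>v\<close> and \<open>m\<close> keep the path at least
    \<open>1 / Suc m\<close> above \<open>y v\<close> at rational times of \<open>(p, q)\<close>;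
    once the tolerance is at most that, the announcing time cannot precede \<open>q\<close>.\<close>
  have "\<not> rational_record y p q"
  proof
    assume "rational_record y p q"
    then have "inf_times y \<inter> {t<..<D} \<noteq> {}"
      unfolding inf_times_hit_iff[OF y] using p q by (intro bexI[of _ p] bexI[of _ q]) auto
    then show False using free by simp
  qed
  then obtain v and m :: nat where v: "v \<in> \<rat>" "v < p" and nm: "\<not> (\<exists>u\<in>\<rat>. p < u \<and> u < q \<and> y u < y v + 1 / Suc m)"
    unfolding rational_record_def by blast
  have m: "y v + 1 / Suc m \<le> y u" if "u \<in> \<rat>" "p < u" "u < q" for u
    using nm that by (meson not_less)
  show ?thesis
  proof (intro exI[of _ m] allI impI)
    fix n assume n: "m \<le> n"
    define N where "N = near_infimum y p (1 / Suc n)"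
    define T where "T = near_infimum_time y p (1 / Suc n)"
    have "left_limit y D < left_limit y D + 1 / Suc n" by simp
    from order_tendstoD(2)[OF cadlag_left[OF y] this]
    obtain a where a: "a < D" "\<And>u. a < u \<Longrightarrow> u < D \<Longrightarrow> y u < left_limit y D + 1 / Suc n"
      by (auto simp: eventually_at_left[of "D - 1" D])
    obtain u where u: "u \<in> \<rat>" "max a p < u" "u < D" using Rats_dense_in_real[of "max a p" D] a p by auto
    have uN: "u \<in> N"
      unfolding N_def near_infimum_def
    proof (intro CollectI conjI ballI impI)
      fix v :: real assume "v < p"
      then show "y u - y v < 1 / Suc n" using a(2)[of u] u low[of v] by simp
    qed (use u in auto)
    then have N: "N \<noteq> {}" by auto
    then have T: "T < D" using uN u unfolding T_def N_def near_infimum_time_less_iff[OF N[unfolded N_def]] by auto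
    have "\<not> T < q"
    proof
      assume "T < q"
      then obtain w where w: "w \<in> N" "w < q" unfolding T_def N_def near_infimum_time_less_iff[OF N[unfolded N_def]] by auto
      then have "y w - y v < 1 / Suc n" "w \<in> \<rat>" "p < w" using v by (auto simp: N_def near_infimum_def)
      moreover have "1 / real (Suc n) \<le> 1 / Suc m" using n by (simp add: frac_le)
      ultimately show False using m[of w] w by linarith
    qed
    then have Tq: "D - d / 2 < T" using q by auto
    \<comment> \<open>A third of the excess of the jump over \<open>e\<close>: an error of
      \<open>g\<close> on each side of \<open>D\<close> still leaves a rise of
      \<open>e + g\<close>.\<close>
    define g where "g = (y D - left_limit y D - e) / 3"
    have g: "g > 0" using jump by (simp add: g_def)
    have "left_limit y D < left_limit y D + g" using g by simp
    from order_tendstoD(2)[OF cadlag_left[OF y] this]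
    obtain a' where a': "a' < D" "\<And>u. a' < u \<Longrightarrow> u < D \<Longrightarrow> y u < left_limit y D + g"
      by (auto simp: eventually_at_left[of "D - 1" D])
    obtain r where r: "r \<in> \<rat>" "max a' T - T < r" "r < D - T"
      using Rats_dense_in_real[of "max a' T - T" "D - T"] a' T by auto
    have "y D - g < y D" using g by simp
    from order_tendstoD(1)[OF cadlag_right[OF y] this]
    obtain b where b: "D < b" "\<And>u. D < u \<Longrightarrow> u < b \<Longrightarrow> y D - g < y u"
      by (auto simp: eventually_at_right[OF less_add_one])
    obtain w where w: "w \<in> \<rat>" "D - T < w" "w < min (b - T) d"
      using Rats_dense_in_real[of "D - T" "min (b - T) d"] b Tq \<open>d > 0\<close> by auto
    have "y (T + r) < left_limit y D + g" using r a'(2)[of "T + r"] by auto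
    moreover have "y D - g < y (T + w)" using w b(2)[of "T + w"] by auto
    moreover have "y D - g - (left_limit y D + g) > e" using g by (simp add: g_def field_simps)
    ultimately have "y (T + w) - y (T + r) > e" by linarith
    moreover have "0 < r" "r < d" "0 < w" "w < d" using r w T Tq by auto
    ultimately have "early_rise d e (\<lambda>u. y (T + max u 0) - y T)"
      unfolding early_rise_def using r(1) w(1) by (intro bexI[of _ r] bexI[of _ w]) (auto simp: max_def)
    then show "near_infimum y p (1 / Suc n) \<noteq> {} \<and> early_rise d e (\<lambda>u. y (near_infimum_time y p (1 / Suc n) + max u 0) - y (near_infimum_time y p (1 / Suc n)))"
      using N unfolding T_def N_def by simp
  qed
qed

text \<open>If \<open>y D\<close> exceeds an earlier value, right continuity keeps the path above
  that value just after \<open>D\<close>, where no infimum time can then lie. So infimum times do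
  not accumulate at \<open>D\<close> from the right, and the infimum defining \<open>d_fun\<close>
  is attained.\<close>

lemma d_fun_right_isolated:
  assumes y: "cadlag y" and d: "d_fun t (inf_times y) = ereal D" and u: "u < D" "y u < y D"
  shows "t < D" "inf_times y \<inter> {t<..<D} = {}" "D \<in> inf_times y"
proof -
  obtain c where c: "y u < c" "c < y D" using dense[OF u(2)] by auto
  from order_tendstoD(1)[OF cadlag_right[OF y] c(2)]
  obtain b where b: "D < b" "\<And>z. D < z \<Longrightarrow> z < b \<Longrightarrow> c < y z"
    by (auto simp: eventually_at_right[OF less_add_one])
  have none: "h \<notin> inf_times y" if h: "D < h" "h < b" for h
  proof
    assume "h \<in> inf_times y"
    then have "min (y h) (left_limit y h) \<le> y u" using u h by (auto simp: inf_times_def)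
    moreover have "c < y h" using b h by auto
    moreover have "c \<le> left_limit y h"
    proof (rule tendsto_lowerbound[OF cadlag_left[OF y, of h]])
      show "eventually (\<lambda>x. c \<le> y x) (at_left h)"
        using h b(2) by (intro eventually_at_leftI[of D]) (auto intro!: less_imp_le)
    qed simp
    ultimately show False using c by linarith
  qed
  have "ereal D < ereal b" using b by simp
  then have "inf_times y \<inter> {t<..<b} \<noteq> {}" using d_fun_less_real_iff[of t "inf_times y" b] d by simp
  then obtain h where h: "h \<in> inf_times y" "t < h" "h < b" by auto
  have ge: "D \<le> h" if "h \<in> inf_times y" "t < h" for h
  proof -
    have "d_fun t (inf_times y) \<le> ereal h" unfolding d_fun_def by (rule Inf_lower) (use that in auto)
    then show ?thesis using d by simp
  qed
  have "h = D" using ge[OF h(1,2)] none[of h] h by force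
  then show "t < D" "D \<in> inf_times y" using h by auto
  show "inf_times y \<inter> {t<..<D} = {}" using ge by force
qed

lemma measurable_early_rise [measurable]: "Measurable.pred path_space (early_rise d e)"
  unfolding early_rise_def[abs_def] by measurable

context levy_process
begin

text \<open>Right continuity at 0 keeps the path within \<open>e / 2\<close> of its initial value
  for a short time, so the events decrease to the empty set.\<close>

lemma early_rise_vanishes:
  assumes "e > 0"
  shows "(\<lambda>j. prob {\<omega> \<in> space M. early_rise (1 / Suc j) e (future 0 \<omega>)}) \<longlonglongrightarrow> 0"
proof -
  define R where "R j = {\<omega> \<in> space M. early_rise (1 / Suc j) e (future 0 \<omega>)}" for j
  have [measurable]: "R j \<in> events" for j unfolding R_def by measurable
  have "decseq R"
  proof (rule decseq_SucI, rule subsetI)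
    fix j \<omega> assume "\<omega> \<in> R (Suc j)"
    moreover have "1 / real (Suc (Suc j)) \<le> 1 / Suc j" by (simp add: frac_le)
    ultimately show "\<omega> \<in> R j" unfolding R_def early_rise_def by (auto intro: less_le_trans simp del: of_nat_Suc)
  qed
  moreover have "(\<Inter>j. R j) = {}"
  proof (rule ccontr)
    assume "(\<Inter>j. R j) \<noteq> {}"
    then obtain \<omega> where \<omega>: "\<And>j. \<omega> \<in> R j" by auto
    define x where "x = future 0 \<omega>"
    have x: "cadlag x" using \<omega>[of 0] cadlag_future by (auto simp: R_def x_def)
    have "x 0 - e / 2 < x 0" "x 0 < x 0 + e / 2" using assms by auto
    from order_tendstoD(1)[OF cadlag_right[OF x] this(1)] order_tendstoD(2)[OF cadlag_right[OF x] this(2)]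
    have "eventually (\<lambda>u. x 0 - e / 2 < x u \<and> x u < x 0 + e / 2) (at_right 0)" by (rule eventually_conj)
    then obtain b where b: "b > 0" "\<And>u. 0 < u \<Longrightarrow> u < b \<Longrightarrow> x 0 - e / 2 < x u \<and> x u < x 0 + e / 2"
      by (auto simp: eventually_at_right[of 0 1])
    obtain j :: nat where j: "1 / Suc j < b" using nat_approx_posE[OF b(1)] by (auto simp: divide_simps)
    obtain u w where uw: "0 < u" "u < 1 / Suc j" "0 < w" "w < 1 / Suc j" "x w - x u > e"
      using \<omega>[of j] unfolding R_def early_rise_def x_def by blast
    have "x w < x 0 + e / 2" "x 0 - e / 2 < x u" using b(2)[of u] b(2)[of w] uw j by auto
    then show False using uw(5) by linarith
  qed
  ultimately show ?thesis
    using finite_Lim_measure_decseq[of R] by (simp add: image_subset_iff R_def)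
qed

text \<open>This is the stopping property of the announcing times. For \<open>q\<close> beyond
  \<open>p\<close> all times involved lie before \<open>q\<close>; otherwise the event is
  empty.\<close>

lemma near_infimum_less_past:
  "{\<omega> \<in> space M. \<exists>u\<in>near_infimum (\<lambda>t. Y t \<omega>) p e. u < q} \<in> sets (past_algebra q)"
proof (cases "p < q")
  case True
  have "{\<omega> \<in> space (past_algebra q). \<exists>u\<in>\<rat>. p < u \<and> u < q \<and> (\<forall>v\<in>\<rat>. v < p \<longrightarrow> past q \<omega> (u - q) - past q \<omega> (v - q) < e)} \<in> sets (past_algebra q)"
    by measurable
  moreover have "past q \<omega> (u - q) - past q \<omega> (v - q) = Y u \<omega> - Y v \<omega>" if "u < q" "v < p" for \<omega> u v
    using that True by (simp add: past_def)
  then have "{\<omega> \<in> space (past_algebra q). \<exists>u\<in>\<rat>. p < u \<and> u < q \<and> (\<forall>v\<in>\<rat>. v < p \<longrightarrow> past q \<omega> (u - q) - past q \<omega> (v - q) < e)} =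
      {\<omega> \<in> space M. \<exists>u\<in>near_infimum (\<lambda>t. Y t \<omega>) p e. u < q}"
    unfolding near_infimum_def by (intro Collect_cong conj_cong) auto
  ultimately show ?thesis by (simp only:)
next
  case False
  then have "{\<omega> \<in> space M. \<exists>u\<in>near_infimum (\<lambda>t. Y t \<omega>) p e. u < q} = {}"
    by (auto simp: near_infimum_def)
  then show ?thesis by (simp only: sets.empty_sets)
qed

lemma near_infimum_event: "{\<omega> \<in> space M. near_infimum (\<lambda>t. Y t \<omega>) p e \<noteq> {}} \<in> events"
proof -
  have "{\<omega> \<in> space M. \<exists>u\<in>\<rat>. p < u \<and> (\<forall>v\<in>\<rat>. v < p \<longrightarrow> Y u \<omega> - Y v \<omega> < e)} \<in> events" by measurable
  moreover have "near_infimum (\<lambda>t. Y t \<omega>) p e \<noteq> {} \<longleftrightarrow> (\<exists>u\<in>\<rat>. p < u \<and> (\<forall>v\<in>\<rat>. v < p \<longrightarrow> Y u \<omega> - Y v \<omega> < e))" for \<omega>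
    unfolding near_infimum_def by blast
  ultimately show ?thesis by (simp only:)
qed

lemma measurable_near_infimum_time:
  "(\<lambda>\<omega>. near_infimum_time (\<lambda>t. Y t \<omega>) p e) \<in> borel_measurable M"
proof (rule borel_measurableI_less)
  fix q :: real
  let ?N = "\<lambda>\<omega>. near_infimum (\<lambda>t. Y t \<omega>) p e"
  \<comment> \<open>The second part of the union accounts for the default value 0, which is below
    \<open>q\<close> only for positive \<open>q\<close>.\<close>
  have "{\<omega> \<in> space M. near_infimum_time (\<lambda>t. Y t \<omega>) p e < q} =
      {\<omega> \<in> space M. \<exists>u\<in>?N \<omega>. u < q} \<union> (if 0 < q then space M - {\<omega> \<in> space M. ?N \<omega> \<noteq> {}} else {})"
  proof (intro equalityI subsetI)
    fix \<omega> assume \<omega>: "\<omega> \<in> {\<omega> \<in> space M. near_infimum_time (\<lambda>t. Y t \<omega>) p e < q}"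
    show "\<omega> \<in> {\<omega> \<in> space M. \<exists>u\<in>?N \<omega>. u < q} \<union> (if 0 < q then space M - {\<omega> \<in> space M. ?N \<omega> \<noteq> {}} else {})"
      using \<omega> near_infimum_time_less_iff[of "\<lambda>t. Y t \<omega>" p e q]
      by (cases "?N \<omega> = {}") (auto simp: near_infimum_time_def)
  next
    fix \<omega> assume \<omega>: "\<omega> \<in> {\<omega> \<in> space M. \<exists>u\<in>?N \<omega>. u < q} \<union> (if 0 < q then space M - {\<omega> \<in> space M. ?N \<omega> \<noteq> {}} else {})"
    then show "\<omega> \<in> {\<omega> \<in> space M. near_infimum_time (\<lambda>t. Y t \<omega>) p e < q}"
      using near_infimum_time_less_iff[of "\<lambda>t. Y t \<omega>" p e q]
      by (cases "?N \<omega> = {}") (auto simp: near_infimum_time_def split: if_splits)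
  qed
  moreover have "{\<omega> \<in> space M. \<exists>u\<in>?N \<omega>. u < q} \<in> events" by (rule past_algebra_events[OF near_infimum_less_past])
  ultimately show "{\<omega> \<in> space M. near_infimum_time (\<lambda>t. Y t \<omega>) p e < q} \<in> events"
    using near_infimum_event[of p e] by auto
qed

text \<open>A larger jump would place the outcome in \<open>E j n\<close> for every \<open>j\<close>
  and all large \<open>n\<close>, by \<open>jump_announced\<close>. The strong Markov property
  bounds \<open>prob (E j n)\<close> by \<open>\<pi> j\<close> uniformly in \<open>n\<close>, so the
  lower limit \<open>L j\<close> obeys the same bound and the intersection over \<open>j\<close> is
  null. This null set depends on \<open>p\<close> and \<open>e\<close> only, not on \<open>t\<close>
  and \<open>D\<close>.\<close>

lemma no_jump_of_size:
  assumes "p \<in> \<rat>" "e > 0"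
  shows "AE \<omega> in M. \<forall>t<p. \<forall>D>p. inf_times (\<lambda>t. Y t \<omega>) \<inter> {t<..<D} = {} \<longrightarrow>
    (\<forall>v<p. left_limit (\<lambda>t. Y t \<omega>) D \<le> Y v \<omega>) \<longrightarrow> Y D \<omega> \<le> left_limit (\<lambda>t. Y t \<omega>) D + e"
proof -
  let ?N = "\<lambda>n \<omega>. near_infimum (\<lambda>t. Y t \<omega>) p (1 / Suc n)"
  let ?T = "\<lambda>n \<omega>. near_infimum_time (\<lambda>t. Y t \<omega>) p (1 / Suc n)"
  define \<pi> where "\<pi> j = prob {\<omega> \<in> space M. early_rise (1 / Suc j) e (future 0 \<omega>)}" for j
  define A where "A n = {\<omega> \<in> space M. ?N n \<omega> \<noteq> {}}" for n
  define E where "E j n = {\<omega> \<in> A n. future (?T n \<omega>) \<omega> \<in> {x \<in> space path_space. early_rise (1 / Suc j) e x}}" for j n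
  define L where "L j = (\<Union>m. \<Inter>n\<in>{m..}. E j n)" for j
  have A: "A n \<in> events" for n unfolding A_def by (rule near_infimum_event)
  have T: "?T n \<in> borel_measurable M" for n by (rule measurable_near_infimum_time)
  have rise: "{x \<in> space path_space. early_rise d e x} \<in> sets path_space" for d by measurable
  have E: "E j n \<in> events" for j n
  proof -
    have "E j n = A n \<inter> ((\<lambda>\<omega>. future (?T n \<omega>) \<omega>) -` {x \<in> space path_space. early_rise (1 / Suc j) e x} \<inter> space M)"
      by (auto simp: E_def A_def)
    then show ?thesis using A measurable_sets[OF measurable_future_at[OF T] rise] by auto
  qed
  have EP: "prob (E j n) \<le> \<pi> j" for j n
  proof -
    have "prob (E j n) = prob (A n) * prob {\<omega> \<in> space M. future 0 \<omega> \<in> {x \<in> space path_space. early_rise (1 / Suc j) e x}}"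
      unfolding E_def
    proof (rule strong_markov[OF T A _ rise])
      fix q
      have "?N n \<omega> \<noteq> {} \<and> ?T n \<omega> < q \<longleftrightarrow> (\<exists>u\<in>?N n \<omega>. u < q)" for \<omega>
        using near_infimum_time_less_iff[of "\<lambda>t. Y t \<omega>" p "1 / Suc n" q] by blast
      then have "{\<omega> \<in> A n. ?T n \<omega> < q} = {\<omega> \<in> space M. \<exists>u\<in>?N n \<omega>. u < q}"
        unfolding A_def by blast
      then show "{\<omega> \<in> A n. ?T n \<omega> < q} \<in> sets (past_algebra q)" using near_infimum_less_past by simp
    qed
    also have "prob {\<omega> \<in> space M. future 0 \<omega> \<in> {x \<in> space path_space. early_rise (1 / Suc j) e x}} = \<pi> j"
      unfolding \<pi>_def by (rule arg_cong[where f=prob]) (auto simp: cadlag_future)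
    also have "prob (A n) * \<pi> j \<le> \<pi> j" by (rule mult_left_le_one_le) (auto simp: \<pi>_def)
    finally show ?thesis .
  qed
  have Ev: "(\<Inter>n\<in>{m..}. E j n) \<in> events" for j m
    by (rule sets.countable_INT) (use E in auto)
  have L: "L j \<in> events" for j unfolding L_def using Ev by auto
  have LP: "prob (L j) \<le> \<pi> j" for j
  proof (rule LIMSEQ_le_const2)
    show "(\<lambda>m. prob (\<Inter>n\<in>{m..}. E j n)) \<longlonglongrightarrow> prob (L j)"
      unfolding L_def by (rule finite_Lim_measure_incseq) (use Ev in \<open>auto simp: incseq_def\<close>)
    have "prob (\<Inter>n\<in>{m..}. E j n) \<le> \<pi> j" for m
      by (rule order_trans[OF finite_measure_mono EP[of j m]]) (use E in auto)
    then show "\<exists>N. \<forall>m\<ge>N. prob (\<Inter>n\<in>{m..}. E j n) \<le> \<pi> j" by blast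
  qed
  have "prob (\<Inter>j. L j) \<le> 0"
  proof (rule LIMSEQ_le_const[OF early_rise_vanishes[OF \<open>e > 0\<close>]])
    have "prob (\<Inter>j. L j) \<le> \<pi> j" for j
      by (rule order_trans[OF finite_measure_mono LP[of j]]) (use L in auto)
    then show "\<exists>N. \<forall>j\<ge>N. prob (\<Inter>j. L j) \<le> prob {\<omega> \<in> space M. early_rise (1 / Suc j) e (future 0 \<omega>)}"
      unfolding \<pi>_def by blast
  qed
  then have "prob (\<Inter>j. L j) = 0" using measure_nonneg antisym by blast
  moreover have "(\<Inter>j. L j) \<in> events" using L by auto
  ultimately have "AE \<omega> in M. \<omega> \<notin> (\<Inter>j. L j)" by (subst (asm) prob_eq_0) auto
  then show ?thesis
  proof (rule AE_mp, intro AE_I2 impI allI)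
    fix \<omega> t D
    assume \<omega>: "\<omega> \<in> space M" "\<omega> \<notin> (\<Inter>j. L j)" and tD: "t < p" "p < D"
      and free: "inf_times (\<lambda>t. Y t \<omega>) \<inter> {t<..<D} = {}" and low: "\<forall>v<p. left_limit (\<lambda>t. Y t \<omega>) D \<le> Y v \<omega>"
    show "Y D \<omega> \<le> left_limit (\<lambda>t. Y t \<omega>) D + e"
    proof (rule ccontr)
      assume "\<not> Y D \<omega> \<le> left_limit (\<lambda>t. Y t \<omega>) D + e"
      then have jump: "left_limit (\<lambda>t. Y t \<omega>) D + e < Y D \<omega>" by simp
      have "\<omega> \<in> L j" for j
      proof -
        obtain m where m: "\<And>n. n \<ge> m \<Longrightarrow> ?N n \<omega> \<noteq> {} \<and>
          early_rise (1 / Suc j) e (\<lambda>u. Y (?T n \<omega> + max u 0) \<omega> - Y (?T n \<omega>) \<omega>)"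
          using jump_announced[OF cadlag_Y[OF \<omega>(1)] \<open>p \<in> \<rat>\<close> tD free _ jump, of "1 / Suc j"] low by auto
        have "\<omega> \<in> E j n" if "n \<ge> m" for n
          using m[OF that] \<omega>(1) cadlag_future[OF \<omega>(1)] by (simp add: E_def A_def future_def)
        then show ?thesis unfolding L_def by blast
      qed
      then show False using \<omega>(2) by blast
    qed
  qed
qed

text \<open>A rational \<open>p\<close> between \<open>t\<close> and \<open>D\<close> and the sizes
  \<open>1 / Suc n\<close> leave countably many exceptional sets, so the conclusion holds for all
  \<open>t\<close> simultaneously.\<close>

theorem infimum_attained_at_d:
  "AE \<omega> in M. \<forall>t D. d_fun t (inf_times (\<lambda>t. Y t \<omega>)) = ereal D \<longrightarrow> (\<forall>u<D. Y D \<omega> \<le> Y u \<omega>)"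
proof -
  have "AE \<omega> in M. \<forall>p\<in>\<rat>. \<forall>n::nat. \<forall>t<p. \<forall>D>p. inf_times (\<lambda>t. Y t \<omega>) \<inter> {t<..<D} = {} \<longrightarrow>
    (\<forall>v<p. left_limit (\<lambda>t. Y t \<omega>) D \<le> Y v \<omega>) \<longrightarrow> Y D \<omega> \<le> left_limit (\<lambda>t. Y t \<omega>) D + 1 / Suc n"
    by (subst AE_ball_countable[OF countable_rat], intro ballI, subst AE_all_countable, intro allI, rule no_jump_of_size) auto
  then show ?thesis
  proof (rule AE_mp, intro AE_I2 impI allI)
    fix \<omega> t D u
    let ?y = "\<lambda>t. Y t \<omega>"
    assume \<omega>: "\<omega> \<in> space M" and nj: "\<forall>p\<in>\<rat>. \<forall>n::nat. \<forall>t<p. \<forall>D>p. inf_times ?y \<inter> {t<..<D} = {} \<longrightarrow>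
      (\<forall>v<p. left_limit ?y D \<le> Y v \<omega>) \<longrightarrow> Y D \<omega> \<le> left_limit ?y D + 1 / Suc n"
      and d: "d_fun t (inf_times ?y) = ereal D" and u: "u < D"
    show "Y D \<omega> \<le> Y u \<omega>"
    proof (rule ccontr)
      assume "\<not> Y D \<omega> \<le> Y u \<omega>"
      then have lt: "Y u \<omega> < Y D \<omega>" by simp
      note iso = d_fun_right_isolated[OF cadlag_Y[OF \<omega>] d u lt]
      have mn: "min (Y D \<omega>) (left_limit ?y D) \<le> Y v \<omega>" if "v < D" for v using iso(3) that by (simp add: inf_times_def)
      \<comment> \<open>The creeping case: the past infimum is reached through the left limit and
        \<open>D\<close> carries an upward jump.\<close>
      have "left_limit ?y D < Y D \<omega>" using mn[OF u] lt by linarith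
      then have ll: "left_limit ?y D \<le> Y v \<omega>" if "v < D" for v using mn[OF that] by linarith
      obtain p where p: "p \<in> \<rat>" "t < p" "p < D" using Rats_dense_in_real[OF iso(1)] by auto
      have "Y D \<omega> \<le> left_limit ?y D + 1 / Suc n" for n
        using nj[rule_format, OF p(1) p(2) p(3) iso(2), of n] ll p(3) by force
      then have "Y D \<omega> - left_limit ?y D \<le> 1 / Suc n" for n by (simp add: algebra_simps)
      then have "Y D \<omega> - left_limit ?y D \<le> 0"
        by (intro LIMSEQ_le_const[OF LIMSEQ_Suc[OF lim_1_over_n]]) auto
      then show False using ll[OF u] lt by linarith
    qed
  qed
qed

end

section \<open>Regeneration\<close>

lemma measurable_tau_inf_times: "(\<lambda>x. tau_fun 0 (inf_times x)) \<in> measurable path_space Omega_right"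
  by (rule measurable_tau_fun) measurable

lemma measurable_tau_at_d:
  "(\<lambda>S. tau_fun (real_of_ereal (d_fun t S)) S) \<in> measurable Omega_bi Omega_right"
  by (rule measurable_tau_fun) measurable

text \<open>Up to a time \<open>p > t\<close> the path is bounded below by some \<open>b\<close>. An
  integer time with value below \<open>b\<close> comes after \<open>p\<close> and turns an interval
  from \<open>p\<close> into a record, which must contain an infimum time.\<close>

lemma inf_times_unbounded:
  assumes y: "cadlag y" and low: "\<exists>c. \<forall>v\<le>0. c \<le> y v" and down: "\<And>b. \<exists>k::nat. y k < b"
  shows "d_fun t (inf_times y) < \<infinity>"
proof -
  define p where "p = \<bar>t\<bar> + 1"
  obtain c where c: "\<And>v. v \<le> 0 \<Longrightarrow> c \<le> y v" using low by auto
  obtain c' where c': "\<forall>u\<in>{0..p}. - y u \<le> c'" using cadlag_bounded_above[OF cadlag_uminus[OF y]] by blast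
  define b where "b = min c (- c')"
  have b: "b \<le> y v" if "v \<le> p" for v
  proof (cases "v \<le> 0")
    case True
    then show ?thesis using c[of v] by (simp add: b_def)
  next
    case False
    then have "- y v \<le> c'" using c' that by simp
    then show ?thesis unfolding b_def by linarith
  qed
  obtain k :: nat where k: "y k < b" using down by blast
  have pk: "p < real k" using b[of "real k"] k by (cases "real k \<le> p") auto
  have "inf_times y \<inter> {p..real k + 1} \<noteq> {}"
  proof (rule inf_times_meet_interval[OF y])
    show "p < real k + 1" using pk by simp
    fix v e :: real assume "v < p" "e > 0"
    then have "y (real k) < y v + e" using k b[of v] by simp
    then show "\<exists>u\<in>{p<..<real k + 1}. y u < y v + e" using pk by (intro bexI[of _ "real k"]) auto
  qed
  then obtain h where "h \<in> inf_times y" "p \<le> h" by auto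
  moreover have "t < p" by (simp add: p_def)
  ultimately have "\<exists>h\<in>inf_times y. t < h \<and> ereal h < \<infinity>" by (intro bexI[of _ h]) auto
  then show ?thesis by (simp only: d_fun_less_iff)
qed

lemma d_fun_ge: "ereal t \<le> d_fun t S"
  unfolding d_fun_def by (rule Inf_greatest) auto

lemma d_fun_real: "d_fun t S < \<infinity> \<Longrightarrow> d_fun t S = ereal (real_of_ereal (d_fun t S))"
  using d_fun_ge[of t S] by (cases "d_fun t S") auto

text \<open>Because \<open>y D\<close> bounds the earlier path from below, comparing with times from
  \<open>D\<close> on already decides the comparison with all earlier ones. Without
  \<open>low\<close> the restarted path could have infimum times that \<open>y\<close>
  lacks.\<close>

lemma tau_fun_inf_times:
  assumes y: "cadlag y" and low: "\<And>u. u < D \<Longrightarrow> y D \<le> y u"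
  shows "tau_fun D (inf_times y) = tau_fun 0 (inf_times (\<lambda>u. y (D + max u 0) - y D))"
proof -
  define z where "z = (\<lambda>u. y (D + u) - y D)"
  have z: "cadlag z" unfolding z_def by (rule cadlag_shift[OF y])
  have "h \<in> inf_times (\<lambda>u. z (max u 0)) \<longleftrightarrow> D + h \<in> inf_times y" if "h > 0" for h
  proof -
    have "(\<forall>u<h. u \<ge> 0 \<longrightarrow> min (z h) (left_limit z h) \<le> z u) \<longleftrightarrow> (\<forall>u<h. min (z h) (left_limit z h) \<le> z u)"
    proof (intro iffI allI impI)
      fix u assume *: "\<forall>u<h. u \<ge> 0 \<longrightarrow> min (z h) (left_limit z h) \<le> z u" and "u < h"
      show "min (z h) (left_limit z h) \<le> z u"
      proof (cases "u \<ge> 0")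
        case True
        then show ?thesis using * \<open>u < h\<close> by blast
      next
        case False
        have "min (z h) (left_limit z h) \<le> z 0" using *[rule_format, of 0] that by simp
        also have "\<dots> \<le> z u" using low[of "D + u"] False by (simp add: z_def)
        finally show ?thesis .
      qed
    qed blast
    also have "\<dots> \<longleftrightarrow> D + h \<in> inf_times y"
      using inf_times_shift[OF y, of h D "y D"] unfolding z_def[symmetric] by (simp only: inf_times_def mem_Collect_eq)
    finally show ?thesis unfolding inf_times_max[OF z that] .
  qed
  then have "(\<lambda>u. u - D) ` inf_times y \<inter> {0<..} = (\<lambda>u. u - 0) ` inf_times (\<lambda>u. z (max u 0)) \<inter> {0<..}"
    by (auto simp: image_iff) (metis add_diff_cancel_left')
  then show ?thesis unfolding tau_fun_def z_def by simp
qed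

section \<open>The filtration of a random closed set\<close>

lemma sets_G_bi: "sets (G_bi s) = sigma_sets {S. closed S}
    {{S. closed S \<and> r_fun u S \<in> B} | u B. u \<le> s \<and> B \<in> sets (borel :: ereal measure)}"
  unfolding G_bi_def by (rule sets_measure_of) auto

lemma sets_G_bi_subset: "sets (G_bi s) \<subseteq> sets Omega_bi"
  unfolding sets_G_bi sets_Omega_bi by (rule sigma_sets_mono') blast

lemma space_G_bi_plus: "space (G_bi_plus t) = {S. closed S}"
  and sets_G_bi_plus: "sets (G_bi_plus t) = sigma_sets {S. closed S} (\<Inter>\<epsilon>\<in>{0<..}. sets (G_bi (t + \<epsilon>)))"
proof -
  have "(\<Inter>\<epsilon>\<in>{0::real<..}. sets (G_bi (t + \<epsilon>))) \<subseteq> sets Omega_bi"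
    using sets_G_bi_subset by (intro INF_lower2[of 1]) auto
  also have "\<dots> \<subseteq> Pow {S. closed S}" using sets.space_closed[of Omega_bi] by simp
  finally have *: "(\<Inter>\<epsilon>\<in>{0<..}. sets (G_bi (t + \<epsilon>))) \<subseteq> Pow {S. closed S}" .
  show "space (G_bi_plus t) = {S. closed S}" unfolding G_bi_plus_def by (rule space_measure_of[OF *])
  show "sets (G_bi_plus t) = sigma_sets {S. closed S} (\<Inter>\<epsilon>\<in>{0<..}. sets (G_bi (t + \<epsilon>)))"
    unfolding G_bi_plus_def by (rule sets_measure_of[OF *])
qed

lemma sets_G_bi_plus_subset:
  assumes "0 < \<epsilon>"
  shows "sets (G_bi_plus t) \<subseteq> sets (G_bi (t + \<epsilon>))"
proof -
  have "space (G_bi (t + \<epsilon>)) = {S. closed S}"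
    unfolding G_bi_def by (rule space_measure_of) auto
  moreover have "sigma_sets (space (G_bi (t + \<epsilon>))) (\<Inter>\<epsilon>\<in>{0<..}. sets (G_bi (t + \<epsilon>))) \<subseteq> sets (G_bi (t + \<epsilon>))"
    by (rule sets.sigma_sets_subset) (use assms in auto)
  ultimately show ?thesis unfolding sets_G_bi_plus by simp
qed

lemma d_fun_agree_le:
  assumes agree: "\<And>h. h < q \<Longrightarrow> h \<in> S' \<Longrightarrow> h \<in> S" and "u \<le> s" "d_fun s S < ereal q"
  shows "d_fun u S \<le> d_fun u S'"
  unfolding d_fun_def[of u S']
proof (rule Inf_greatest)
  fix x assume "x \<in> ereal ` {h \<in> S'. u < h}"
  then obtain h where h: "x = ereal h" "h \<in> S'" "u < h" by auto
  show "d_fun u S \<le> x"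
  proof (cases "h < q")
    case True
    then show ?thesis using h agree[of h] unfolding d_fun_def by (intro Inf_lower) auto
  next
    case False
    have "d_fun u S \<le> d_fun s S" unfolding d_fun_def using \<open>u \<le> s\<close> by (intro Inf_superset_mono) auto
    also have "\<dots> \<le> ereal q" using assms(3) by simp
    also have "\<dots> \<le> x" using h False by simp
    finally show ?thesis .
  qed
qed

text \<open>Events of \<open>G_bi s\<close> see a set only through its \<open>d_fun u\<close> with
  \<open>u \<le> s\<close>. If the set is hit between \<open>s\<close> and \<open>q\<close>, all of
  these are decided by its points before \<open>q\<close>.\<close>

lemma G_bi_local:
  assumes A: "A \<in> sets (G_bi s)" and cl: "closed S" "closed S'"
    and agree: "\<And>h. h < q \<Longrightarrow> h \<in> S \<longleftrightarrow> h \<in> S'" and d: "d_fun s S < ereal q"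
  shows "S \<in> A \<longleftrightarrow> S' \<in> A"
proof -
  have d': "d_fun s S' < ereal q"
    using d agree unfolding d_fun_less_real_iff by auto
  have eq: "d_fun u S = d_fun u S'" if "u \<le> s" for u
    using d_fun_agree_le[of q S' S, OF _ that d] d_fun_agree_le[of q S S', OF _ that d'] agree by auto
  show ?thesis
    using A unfolding sets_G_bi
  proof (induction rule: sigma_sets.induct)
    case (Basic a)
    then obtain u B where "a = {S. closed S \<and> r_fun u S \<in> B}" "u \<le> s" by auto
    then show ?case using eq[of u] cl by (simp add: r_fun_def)
  qed (use cl in auto)
qed

context levy_process
begin

lemma measurable_path [measurable]: "(\<lambda>\<omega> t. Y t \<omega>) \<in> measurable M path_space"
  by (rule measurable_path_spaceI) (auto simp: cadlag_Y)

definition infs :: "'a \<Rightarrow> real set" where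
  "infs \<omega> = inf_times (\<lambda>t. Y t \<omega>)"

lemma closed_infs: "\<omega> \<in> space M \<Longrightarrow> closed (infs \<omega>)"
  unfolding infs_def by (rule closed_inf_times[OF cadlag_Y])

lemma measurable_infs [measurable]: "infs \<in> measurable M Omega_bi"
  unfolding infs_def[abs_def] by (rule measurable_compose[OF measurable_path measurable_inf_times])

lemma infs_past_iff:
  assumes "\<omega> \<in> space M" "h < q"
  shows "h \<in> infs \<omega> \<longleftrightarrow> h \<in> (\<lambda>t. t + q) ` inf_times (past q \<omega>)"
proof -
  have "h \<in> (\<lambda>t. t + q) ` inf_times (past q \<omega>) \<longleftrightarrow> h - q \<in> inf_times (past q \<omega>)"
    by (force simp: image_iff)
  also have "\<dots> \<longleftrightarrow> h - q \<in> inf_times (\<lambda>u. Y (q + u) \<omega> - Y q \<omega>)"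
    unfolding past_def using inf_times_min[OF cadlag_shift[OF cadlag_Y[OF assms(1)]], of "h - q" q "Y q \<omega>"] assms(2) by simp
  also have "\<dots> \<longleftrightarrow> h \<in> infs \<omega>"
    unfolding inf_times_shift[OF cadlag_Y[OF assms(1)]] infs_def by simp
  finally show ?thesis by simp
qed

text \<open>The set reconstructed from \<open>past q\<close> may differ from \<open>infs\<close> at
  and after \<open>q\<close>, where the stopped path is constant; by \<open>G_bi_local\<close> this
  does not affect the event once \<open>d_fun s\<close> is below \<open>q\<close>.\<close>

lemma infs_past_event:
  assumes A: "A \<in> sets (G_bi s)"
  shows "{\<omega> \<in> space M. infs \<omega> \<in> A \<and> d_fun s (infs \<omega>) < ereal q} \<in> sets (past_algebra q)"
proof -
  let ?S = "\<lambda>\<omega>. (\<lambda>t. t + q) ` inf_times (past q \<omega>)"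
  have m: "?S \<in> measurable (past_algebra q) Omega_bi"
    by (rule measurable_compose[OF measurable_compose[OF past_measurable_past_algebra measurable_inf_times] measurable_translate_set])
  have [measurable]: "A \<in> sets Omega_bi" using A sets_G_bi_subset by auto
  have meas: "{\<omega> \<in> space (past_algebra q). ?S \<omega> \<in> A \<and> d_fun s (?S \<omega>) < ereal q} \<in> sets (past_algebra q)"
    using m by measurable
  have iff: "infs \<omega> \<in> A \<and> d_fun s (infs \<omega>) < ereal q \<longleftrightarrow> ?S \<omega> \<in> A \<and> d_fun s (?S \<omega>) < ereal q"
    if \<omega>: "\<omega> \<in> space M" for \<omega>
  proof -
    have "?S \<omega> \<in> space Omega_bi" by (rule measurable_space[OF m]) (simp add: \<omega>)
    then have cl: "closed (?S \<omega>)" by simp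
    define S where "S = ?S \<omega>"
    have mem: "h \<in> infs \<omega> \<longleftrightarrow> h \<in> S" if "h < q" for h
      unfolding S_def by (rule infs_past_iff[OF \<omega> that])
    have "infs \<omega> \<inter> {s<..<q} = S \<inter> {s<..<q}" using mem by auto
    then have d: "d_fun s (infs \<omega>) < ereal q \<longleftrightarrow> d_fun s S < ereal q" unfolding d_fun_less_real_iff by simp
    have "infs \<omega> \<in> A \<longleftrightarrow> S \<in> A" if "d_fun s (infs \<omega>) < ereal q"
      by (rule G_bi_local[OF A closed_infs[OF \<omega>] _ mem that]) (use cl in \<open>simp_all add: S_def\<close>)
    then show ?thesis unfolding S_def[symmetric] using d by blast
  qed
  have "{\<omega> \<in> space M. infs \<omega> \<in> A \<and> d_fun s (infs \<omega>) < ereal q} =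
      {\<omega> \<in> space (past_algebra q). ?S \<omega> \<in> A \<and> d_fun s (?S \<omega>) < ereal q}"
    unfolding space_past_algebra by (rule Collect_cong, rule conj_cong[OF refl iff])
  with meas show ?thesis by (simp only:)
qed

text \<open>A point in the open interval from \<open>t\<close> to \<open>q\<close> also lies beyond
  \<open>t + 1 / Suc n\<close> for some \<open>n\<close>. This allows \<open>A\<close> to be used as
  an event of \<open>G_bi (t + 1 / Suc n)\<close>, which is where the right limit of the filtration
  enters.\<close>

lemma infs_past_event_plus:
  assumes A: "A \<in> sets (G_bi_plus t)"
  shows "{\<omega> \<in> space M. infs \<omega> \<in> A \<and> d_fun t (infs \<omega>) < ereal q} \<in> sets (past_algebra q)"
proof -
  have "(\<Union>n::nat. {\<omega> \<in> space M. infs \<omega> \<in> A \<and> d_fun (t + 1 / Suc n) (infs \<omega>) < ereal q}) \<in> sets (past_algebra q)"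
    using sets_G_bi_plus_subset[of "1 / Suc _" t] A by (intro sets.countable_UN) (auto intro!: infs_past_event)
  moreover have "d_fun t S < ereal q \<longleftrightarrow> (\<exists>n::nat. d_fun (t + 1 / Suc n) S < ereal q)" for S
  proof
    assume "d_fun t S < ereal q"
    then obtain h where h: "h \<in> S" "t < h" "h < q" unfolding d_fun_less_real_iff by auto
    obtain n :: nat where "1 / Suc n < h - t" using nat_approx_posE[of "h - t"] h by (auto simp: divide_simps)
    then have "h \<in> S \<inter> {t + 1 / Suc n<..<q}" using h by auto
    then show "\<exists>n::nat. d_fun (t + 1 / Suc n) S < ereal q" unfolding d_fun_less_real_iff by blast
  next
    assume "\<exists>n::nat. d_fun (t + 1 / Suc n) S < ereal q"
    then obtain n :: nat and h where h: "h \<in> S" "t + 1 / Suc n < h" "h < q" unfolding d_fun_less_real_iff by auto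
    have "0 < 1 / real (Suc n)" by simp
    then have "t < h" using h(2) by linarith
    then show "d_fun t S < ereal q" unfolding d_fun_less_real_iff using h by auto
  qed
  then have "{\<omega> \<in> space M. infs \<omega> \<in> A \<and> d_fun t (infs \<omega>) < ereal q} =
      (\<Union>n::nat. {\<omega> \<in> space M. infs \<omega> \<in> A \<and> d_fun (t + 1 / Suc n) (infs \<omega>) < ereal q})" by blast
  ultimately show ?thesis by (simp only:)
qed

text \<open>The path \<open>future 0\<close> is constant before 0, so every time up to 0 is one of
  its infimum times; \<open>tau_fun 0\<close> removes these artefacts.\<close>

definition regeneration_set :: "'a \<Rightarrow> real set" where
  "regeneration_set \<omega> = tau_fun 0 (inf_times (future 0 \<omega>))"

lemma measurable_regeneration_set [measurable]: "regeneration_set \<in> measurable M Omega_right"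
  unfolding regeneration_set_def[abs_def] by (rule measurable_compose[OF measurable_future measurable_tau_inf_times])

text \<open>On \<open>A'\<close> the time \<open>T\<close> is a stopping time, and almost surely the
  infimum is attained there, so the set after \<open>T\<close> is a functional of
  \<open>future T\<close>. Passing to \<open>A'\<close> discards only the null event on which
  \<open>real_of_ereal\<close> would hide an infinite value.\<close>

lemma regeneration_prob:
  assumes fin: "AE \<omega> in M. \<forall>t. d_fun t (infs \<omega>) < \<infinity>"
    and A: "A \<in> sets (G_bi_plus t)" and B: "B \<in> sets Omega_right"
  shows "prob {\<omega> \<in> space M. infs \<omega> \<in> A \<and> tau_fun (real_of_ereal (d_fun t (infs \<omega>))) (infs \<omega>) \<in> B} =
    prob {\<omega> \<in> space M. infs \<omega> \<in> A} * prob {\<omega> \<in> space M. regeneration_set \<omega> \<in> B}"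
proof -
  define T where "T \<omega> = real_of_ereal (d_fun t (infs \<omega>))" for \<omega>
  define A' where "A' = {\<omega> \<in> space M. infs \<omega> \<in> A \<and> d_fun t (infs \<omega>) < \<infinity>}"
  define B' where "B' = {x \<in> space path_space. tau_fun 0 (inf_times x) \<in> B}"
  have A_bi [measurable]: "A \<in> sets Omega_bi"
    using A sets_G_bi_plus_subset[of 1 t] sets_G_bi_subset[of "t + 1"] by auto
  have T [measurable]: "T \<in> borel_measurable M" unfolding T_def by measurable
  have A' [measurable]: "A' \<in> events" unfolding A'_def by measurable
  have "B' = (\<lambda>x. tau_fun 0 (inf_times x)) -` B \<inter> space path_space" by (auto simp: B'_def)
  then have B' [measurable]: "B' \<in> sets path_space" using measurable_sets[OF measurable_tau_inf_times B] by simp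
  have dT: "d_fun t (infs \<omega>) = ereal (T \<omega>)" if "d_fun t (infs \<omega>) < \<infinity>" for \<omega>
    unfolding T_def by (rule d_fun_real[OF that])
  have sm: "prob {\<omega> \<in> A'. future (T \<omega>) \<omega> \<in> B'} = prob A' * prob {\<omega> \<in> space M. future 0 \<omega> \<in> B'}"
  proof (rule strong_markov[OF T A' _ B'])
    fix q
    have "{\<omega> \<in> A'. T \<omega> < q} = {\<omega> \<in> space M. infs \<omega> \<in> A \<and> d_fun t (infs \<omega>) < ereal q}"
    proof (intro equalityI subsetI)
      fix \<omega> assume "\<omega> \<in> {\<omega> \<in> A'. T \<omega> < q}"
      then show "\<omega> \<in> {\<omega> \<in> space M. infs \<omega> \<in> A \<and> d_fun t (infs \<omega>) < ereal q}" using dT[of \<omega>] by (auto simp: A'_def)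
    next
      fix \<omega> assume \<omega>: "\<omega> \<in> {\<omega> \<in> space M. infs \<omega> \<in> A \<and> d_fun t (infs \<omega>) < ereal q}"
      then have "d_fun t (infs \<omega>) < ereal q" by simp
      also have "ereal q < \<infinity>" by simp
      finally show "\<omega> \<in> {\<omega> \<in> A'. T \<omega> < q}" using \<omega> dT[of \<omega>] by (auto simp: A'_def)
    qed
    then show "{\<omega> \<in> A'. T \<omega> < q} \<in> sets (past_algebra q)" using infs_past_event_plus[OF A, of q] by simp
  qed
  have e1: "prob {\<omega> \<in> space M. infs \<omega> \<in> A \<and> tau_fun (T \<omega>) (infs \<omega>) \<in> B} = prob {\<omega> \<in> A'. future (T \<omega>) \<omega> \<in> B'}"
  proof (rule finite_measure_eq_AE)
    show "AE \<omega> in M. \<omega> \<in> {\<omega> \<in> space M. infs \<omega> \<in> A \<and> tau_fun (T \<omega>) (infs \<omega>) \<in> B} \<longleftrightarrow> \<omega> \<in> {\<omega> \<in> A'. future (T \<omega>) \<omega> \<in> B'}"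
      using fin infimum_attained_at_d
    proof (eventually_elim, goal_cases)
      case (1 \<omega>)
      show ?case
      proof (cases "\<omega> \<in> space M")
        case True
        have f: "d_fun t (infs \<omega>) < \<infinity>" using 1 by blast
        then have low: "\<And>u. u < T \<omega> \<Longrightarrow> Y (T \<omega>) \<omega> \<le> Y u \<omega>" using 1(2) dT[OF f] unfolding infs_def by blast
        have "tau_fun (T \<omega>) (infs \<omega>) = tau_fun 0 (inf_times (future (T \<omega>) \<omega>))"
          unfolding infs_def future_def by (rule tau_fun_inf_times[OF cadlag_Y[OF True] low])
        then show ?thesis using True f cadlag_future[OF True] by (simp add: A'_def B'_def)
      qed (simp add: A'_def)
    qed
    have [measurable]: "(\<lambda>\<omega>. tau_fun (T \<omega>) (infs \<omega>)) \<in> measurable M Omega_right" by (rule measurable_tau_fun) measurable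
    show "{\<omega> \<in> space M. infs \<omega> \<in> A \<and> tau_fun (T \<omega>) (infs \<omega>) \<in> B} \<in> events" using B by measurable
    have "{\<omega> \<in> A'. future (T \<omega>) \<omega> \<in> B'} = A' \<inter> ((\<lambda>\<omega>. future (T \<omega>) \<omega>) -` B' \<inter> space M)" by (auto simp: A'_def)
    then show "{\<omega> \<in> A'. future (T \<omega>) \<omega> \<in> B'} \<in> events"
      using measurable_sets[OF measurable_future_at[OF T] B'] A' by (metis sets.Int)
  qed
  have e2: "prob A' = prob {\<omega> \<in> space M. infs \<omega> \<in> A}"
  proof (rule finite_measure_eq_AE)
    show "AE \<omega> in M. \<omega> \<in> A' \<longleftrightarrow> \<omega> \<in> {\<omega> \<in> space M. infs \<omega> \<in> A}"
      using fin by eventually_elim (simp add: A'_def)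
  qed measurable
  have e3: "{\<omega> \<in> space M. future 0 \<omega> \<in> B'} = {\<omega> \<in> space M. regeneration_set \<omega> \<in> B}"
    using cadlag_future by (auto simp: B'_def regeneration_set_def)
  show ?thesis using sm e1 e2 e3 by (simp only: T_def)
qed

text \<open>The path centred at \<open>q\<close> is the sum of its past, which vanishes after 0, and
  its future, which vanishes before 0. Their joint law is a product that does not depend on
  \<open>q\<close>.\<close>

lemma path_law_shift:
  assumes B: "B \<in> sets path_space"
  shows "prob {\<omega> \<in> space M. (\<lambda>u. Y (q + u) \<omega> - Y q \<omega>) \<in> B} = prob {\<omega> \<in> space M. (\<lambda>u. Y u \<omega> - Y 0 \<omega>) \<in> B}"
proof -
  define add :: "(real \<Rightarrow> real) \<times> (real \<Rightarrow> real) \<Rightarrow> real \<Rightarrow> real" where "add = (\<lambda>(x, y) u. x u + y u)"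
  let ?P = "path_space \<Otimes>\<^sub>M path_space"
  have add: "add \<in> measurable ?P path_space"
  proof (rule measurable_path_spaceI)
    show "cadlag (add z)" if "z \<in> space ?P" for z
      using that by (auto simp: add_def space_pair_measure intro: cadlag_add)
    fix u
    have [measurable]: "(\<lambda>z. fst z u) \<in> borel_measurable ?P" "(\<lambda>z. snd z u) \<in> borel_measurable ?P"
      by (rule measurable_compose[OF measurable_fst measurable_coordinate], rule measurable_compose[OF measurable_snd measurable_coordinate])
    have "(\<lambda>z. fst z u + snd z u) \<in> borel_measurable ?P" by (intro borel_measurable_add) fact+
    then show "(\<lambda>z. add z u) \<in> borel_measurable ?P" by (simp add: add_def case_prod_beta)
  qed
  have law: "distr M path_space (past 0) \<Otimes>\<^sub>M distr M path_space (future 0) = distr M ?P (\<lambda>\<omega>. (past q \<omega>, future q \<omega>))" for q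
  proof (rule pair_measure_eqI)
    show "sigma_finite_measure (distr M path_space (past 0))" "sigma_finite_measure (distr M path_space (future 0))"
      by (intro prob_space_imp_sigma_finite prob_space_distr; measurable)+
    show "sets (distr M path_space (past 0) \<Otimes>\<^sub>M distr M path_space (future 0)) = sets (distr M ?P (\<lambda>\<omega>. (past q \<omega>, future q \<omega>)))"
      unfolding sets_distr by (intro sets_pair_measure_cong sets_distr)
    fix C D assume "C \<in> sets (distr M path_space (past 0))" "D \<in> sets (distr M path_space (future 0))"
    then have CD: "C \<in> sets path_space" "D \<in> sets path_space" by auto
    have "emeasure (distr M path_space (past 0)) C = prob {\<omega> \<in> space M. past 0 \<omega> \<in> C}"
      using CD by (subst emeasure_distr) (auto simp: emeasure_eq_measure intro!: arg_cong[where f=prob])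
    moreover have "emeasure (distr M path_space (future 0)) D = prob {\<omega> \<in> space M. future 0 \<omega> \<in> D}"
      using CD by (subst emeasure_distr) (auto simp: emeasure_eq_measure intro!: arg_cong[where f=prob])
    moreover have "emeasure (distr M ?P (\<lambda>\<omega>. (past q \<omega>, future q \<omega>))) (C \<times> D) = prob {\<omega> \<in> space M. past q \<omega> \<in> C \<and> future q \<omega> \<in> D}"
      using CD by (subst emeasure_distr) (auto simp: emeasure_eq_measure intro!: arg_cong[where f=prob])
    ultimately show "emeasure (distr M path_space (past 0)) C * emeasure (distr M path_space (future 0)) D =
        emeasure (distr M ?P (\<lambda>\<omega>. (past q \<omega>, future q \<omega>))) (C \<times> D)"
      using past_future_prob[OF CD, of q] by (simp add: ennreal_mult)
  qed
  have P: "prob {\<omega> \<in> space M. (\<lambda>u. Y (q + u) \<omega> - Y q \<omega>) \<in> B} =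
      measure (distr M ?P (\<lambda>\<omega>. (past q \<omega>, future q \<omega>))) (add -` B \<inter> space ?P)" for q
  proof -
    have "measure (distr M ?P (\<lambda>\<omega>. (past q \<omega>, future q \<omega>))) (add -` B \<inter> space ?P) =
        prob ((\<lambda>\<omega>. (past q \<omega>, future q \<omega>)) -` (add -` B \<inter> space ?P) \<inter> space M)"
      by (rule measure_distr) (use measurable_sets[OF add B] in measurable)
    also have "(\<lambda>\<omega>. (past q \<omega>, future q \<omega>)) -` (add -` B \<inter> space ?P) \<inter> space M = {\<omega> \<in> space M. (\<lambda>u. Y (q + u) \<omega> - Y q \<omega>) \<in> B}"
    proof -
      have "add (past q \<omega>, future q \<omega>) = (\<lambda>u. Y (q + u) \<omega> - Y q \<omega>)" for \<omega>
        by (auto simp: add_def past_def future_def min_def max_def)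
      then show ?thesis using cadlag_past cadlag_future by (auto simp: space_pair_measure)
    qed
    finally show ?thesis by simp
  qed
  from P[of q] P[of 0] law[of q] law[of 0] show ?thesis by simp
qed

theorem infs_stationary:
  "distr M Omega_bi (\<lambda>\<omega>. (\<lambda>t. t + a) ` infs \<omega>) = distr M Omega_bi infs"
proof (rule measure_eqI)
  have m: "(\<lambda>\<omega>. (\<lambda>t. t + a) ` infs \<omega>) \<in> measurable M Omega_bi"
    by (rule measurable_compose[OF measurable_infs measurable_translate_set])
  fix B assume "B \<in> sets (distr M Omega_bi (\<lambda>\<omega>. (\<lambda>t. t + a) ` infs \<omega>))"
  then have B: "B \<in> sets Omega_bi" by simp
  define C where "C = inf_times -` B \<inter> space path_space"
  have C: "C \<in> sets path_space" unfolding C_def by (rule measurable_sets[OF measurable_inf_times B])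
  have shift: "inf_times (\<lambda>u. Y (q + u) \<omega> - Y q \<omega>) = (\<lambda>t. t - q) ` infs \<omega>" if "\<omega> \<in> space M" for q \<omega>
    using inf_times_shift[OF cadlag_Y[OF that], of _ q "Y q \<omega>"] unfolding infs_def by (force simp: image_iff)
  have iff: "(\<lambda>u. Y (q + u) \<omega> - Y q \<omega>) \<in> C \<longleftrightarrow> (\<lambda>t. t - q) ` infs \<omega> \<in> B" if "\<omega> \<in> space M" for q \<omega>
    using shift[OF that, of q] cadlag_shift[OF cadlag_Y[OF that]] by (simp add: C_def)
  have "prob {\<omega> \<in> space M. (\<lambda>t. t + a) ` infs \<omega> \<in> B} = prob {\<omega> \<in> space M. infs \<omega> \<in> B}"
    using path_law_shift[OF C, of "- a"] iff[of _ "- a"] iff[of _ 0] by (simp cong: conj_cong)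
  then show "emeasure (distr M Omega_bi (\<lambda>\<omega>. (\<lambda>t. t + a) ` infs \<omega>)) B = emeasure (distr M Omega_bi infs) B"
    using B m by (simp add: emeasure_distr emeasure_eq_measure vimage_def Int_def conj_commute)
qed simp

text \<open>A constant is recognised as the conditional expectation by its integrals over the events
  of \<open>G_bi_plus t\<close>; these follow from the factorisation in
  \<open>regeneration_prob\<close>.\<close>

theorem infs_regenerative:
  assumes fin: "AE \<omega> in M. \<forall>t. d_fun t (infs \<omega>) < \<infinity>"
  shows "regenerative_with (distr M Omega_bi infs) (distr M Omega_right regeneration_set)"
proof -
  let ?Q = "distr M Omega_bi infs" and ?R = "distr M Omega_right regeneration_set"
  have Q: "prob_space ?Q" by (rule prob_space_distr) measurable
  have R: "prob_space ?R" by (rule prob_space_distr) measurable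
  have inf0: "emeasure ?Q {S \<in> space ?Q. d_fun t S = \<infinity>} = 0" for t
  proof -
    have "AE S in ?Q. d_fun t S \<noteq> \<infinity>"
    proof (subst AE_distr_iff)
      show "{S \<in> space Omega_bi. d_fun t S \<noteq> \<infinity>} \<in> sets Omega_bi" by measurable
      show "AE \<omega> in M. d_fun t (infs \<omega>) \<noteq> \<infinity>" using fin by eventually_elim (metis less_irrefl)
    qed measurable
    moreover have "{S \<in> space Omega_bi. d_fun t S = \<infinity>} \<in> sets Omega_bi" by measurable
    ultimately show ?thesis
      using AE_iff_measurable[of "{S \<in> space ?Q. d_fun t S = \<infinity>}" ?Q "\<lambda>S. d_fun t S \<noteq> \<infinity>"] by simp
  qed
  have cond: "AE S in ?Q. nn_cond_exp ?Q (G_bi_plus t) (\<lambda>S. F (tau_fun (real_of_ereal (d_fun t S)) S)) S = (\<integral>\<^sup>+ S. F S \<partial>?R)"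
    if F [measurable]: "F \<in> borel_measurable Omega_right" for t and F :: "real set \<Rightarrow> ennreal"
  proof -
    interpret Q: prob_space ?Q by fact
    have sub: "subalgebra ?Q (G_bi_plus t)"
      unfolding subalgebra_def
      using sets_G_bi_plus_subset[of 1 t] sets_G_bi_subset[of "t + 1"] by (auto simp: space_G_bi_plus)
    interpret S: finite_measure_subalgebra ?Q "G_bi_plus t" by unfold_locales (rule sub)
    let ?f = "\<lambda>S. F (tau_fun (real_of_ereal (d_fun t S)) S)"
    note [measurable] = measurable_tau_at_d[of t]
    have "AE S in ?Q. (\<integral>\<^sup>+ S. F S \<partial>?R) = nn_cond_exp ?Q (G_bi_plus t) ?f S"
    proof (rule S.nn_cond_exp_charact)
      fix A assume A: "A \<in> sets (G_bi_plus t)"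
      then have [measurable]: "A \<in> sets Omega_bi"
        using sets_G_bi_plus_subset[of 1 t] sets_G_bi_subset[of "t + 1"] by auto
      let ?A = "{\<omega> \<in> space M. infs \<omega> \<in> A}"
      have "(\<integral>\<^sup>+ S\<in>A. ?f S \<partial>?Q) = (\<integral>\<^sup>+\<omega>. ?f (infs \<omega>) * indicator A (infs \<omega>) \<partial>M)"
        by (subst nn_integral_distr) auto
      also have "\<dots> = (\<integral>\<^sup>+\<omega>. ?f (infs \<omega>) * indicator ?A \<omega> \<partial>M)"
        by (intro nn_integral_cong) (auto simp: indicator_def)
      also have "\<dots> = ennreal (prob ?A) * (\<integral>\<^sup>+\<omega>. F (regeneration_set \<omega>) \<partial>M)"
      proof (rule nn_integral_on_event[where N=Omega_right])
        show "(\<lambda>\<omega>. tau_fun (real_of_ereal (d_fun t (infs \<omega>))) (infs \<omega>)) \<in> measurable M Omega_right" by measurable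
        fix B assume B: "B \<in> sets Omega_right"
        have "{\<omega> \<in> ?A. tau_fun (real_of_ereal (d_fun t (infs \<omega>))) (infs \<omega>) \<in> B} =
          {\<omega> \<in> space M. infs \<omega> \<in> A \<and> tau_fun (real_of_ereal (d_fun t (infs \<omega>))) (infs \<omega>) \<in> B}" by blast
        then show "prob {\<omega> \<in> ?A. tau_fun (real_of_ereal (d_fun t (infs \<omega>))) (infs \<omega>) \<in> B} = prob ?A * prob {\<omega> \<in> space M. regeneration_set \<omega> \<in> B}"
          using regeneration_prob[OF fin A B] by (simp only:)
      qed auto
      also have "(\<integral>\<^sup>+\<omega>. F (regeneration_set \<omega>) \<partial>M) = (\<integral>\<^sup>+ S. F S \<partial>?R)"
        by (subst nn_integral_distr) auto
      also have "ennreal (prob ?A) = emeasure ?Q A"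
        by (subst emeasure_distr) (auto simp: emeasure_eq_measure intro!: arg_cong[where f=prob])
      also have "emeasure ?Q A * (\<integral>\<^sup>+ S. F S \<partial>?R) = (\<integral>\<^sup>+ S\<in>A. (\<integral>\<^sup>+ S. F S \<partial>?R) \<partial>?Q)"
        by (subst nn_integral_cmult_indicator) (auto simp: mult.commute)
      finally show "(\<integral>\<^sup>+ S\<in>A. ?f S \<partial>?Q) = (\<integral>\<^sup>+ S\<in>A. (\<integral>\<^sup>+ S. F S \<partial>?R) \<partial>?Q)" .
    qed auto
    then show ?thesis by eventually_elim simp
  qed
  show ?thesis
    unfolding regenerative_with_def using Q R inf0 cond by simp
qed

end

section \<open>Removing the drift\<close>

lemma levy_process_drift:
  assumes X: "two_sided_levy M X"
  shows "levy_process M (\<lambda>t \<omega>. X t \<omega> - a * t)"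
proof -
  interpret X: levy_process M X by (rule levy_process.intro) fact
  let ?Y = "\<lambda>t \<omega>. X t \<omega> - a * t"
  have incr: "?Y (s + t) \<omega> - ?Y s \<omega> = (X (s + t) \<omega> - X s \<omega>) - a * t" for s t \<omega>
    by (simp add: algebra_simps)
  have "cadlag (\<lambda>t. ?Y t \<omega>)" if "\<omega> \<in> space M" for \<omega>
    by (rule cadlagI[where l="\<lambda>t. left_limit (\<lambda>t. X t \<omega>) t - a * t"])
       (intro tendsto_intros cadlag_right[OF X.cadlag_Y[OF that]] cadlag_left[OF X.cadlag_Y[OF that]])+
  moreover have "distr M borel (\<lambda>\<omega>. ?Y (s + t) \<omega> - ?Y s \<omega>) = distr M borel (\<lambda>\<omega>. ?Y t \<omega> - ?Y 0 \<omega>)" for s t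
  proof -
    have law: "distr M borel (\<lambda>\<omega>. ?Y (s + t) \<omega> - ?Y s \<omega>) = distr (distr M borel (\<lambda>\<omega>. X (s + t) \<omega> - X s \<omega>)) borel (\<lambda>x. x - a * t)" for s
      unfolding incr by (subst distr_distr) (auto simp: o_def)
    have "distr M borel (\<lambda>\<omega>. X (s + t) \<omega> - X s \<omega>) = distr M borel (\<lambda>\<omega>. X (0 + t) \<omega> - X 0 \<omega>)"
      using X.increment_law[of s t 0] by simp
    then show ?thesis using law[of s] law[of 0] by simp
  qed
  moreover have "X.indep_vars (\<lambda>_. borel) (\<lambda>i \<omega>. ?Y (tt (Suc i)) \<omega> - ?Y (tt i) \<omega>) {..<n}"
    if "\<forall>i<n. tt i < tt (Suc i)" for n :: nat and tt
  proof -
    have "X.indep_vars (\<lambda>_. borel) (\<lambda>i \<omega>. X (tt (Suc i)) \<omega> - X (tt i) \<omega>) {..<n}"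
      using X.increments_indep[where tt=tt and q=0 and n=n] that by simp
    then have "X.indep_vars (\<lambda>_. borel) (\<lambda>i \<omega>. (X (tt (Suc i)) \<omega> - X (tt i) \<omega>) - a * (tt (Suc i) - tt i)) {..<n}"
      by (rule X.indep_vars_compose2[where Y="\<lambda>i x. x - a * (tt (Suc i) - tt i)"]) measurable
    moreover have "(\<lambda>i \<omega>. (X (tt (Suc i)) \<omega> - X (tt i) \<omega>) - a * (tt (Suc i) - tt i)) = (\<lambda>i \<omega>. ?Y (tt (Suc i)) \<omega> - ?Y (tt i) \<omega>)"
      by (simp add: fun_eq_iff algebra_simps)
    ultimately show ?thesis by (simp only:)
  qed
  moreover have "?Y t \<in> borel_measurable M" for t by measurable
  ultimately show ?thesis
    unfolding levy_process_def two_sided_levy_def cadlag_def using X.prob_space_axioms by blast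
qed

text \<open>The infimum over times up to \<open>t\<close> is always at most the value and at most
  the left limit at \<open>t\<close>, so the equality in \<open>H_set\<close> amounts to a lower
  bound by their minimum.\<close>

lemma H_set_eq_inf_times:
  assumes "levy_process M X" "\<omega> \<in> space M"
  shows "H_set X a \<omega> = inf_times (\<lambda>t. X t \<omega> - a * t)"
proof -
  interpret X: levy_process M X by fact
  let ?y = "\<lambda>t. X t \<omega> - a * t"
  have left: "(?y \<longlongrightarrow> left_lim X t \<omega> - a * t) (at_left t)" for t
    using cadlag_left[OF X.cadlag_Y[OF assms(2)], of t] unfolding left_lim_def left_limit_def
    by (intro tendsto_intros)
  have min: "min (X t \<omega>) (left_lim X t \<omega>) - a * t = min (?y t) (left_limit ?y t)" for t
    unfolding left_limit_eq[OF left] by (simp add: min_def)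
  have "ereal (min (?y t) (left_limit ?y t)) = (INF u\<in>{..t}. ereal (?y u)) \<longleftrightarrow>
      (\<forall>u<t. min (?y t) (left_limit ?y t) \<le> ?y u)" for t
  proof
    assume "ereal (min (?y t) (left_limit ?y t)) = (INF u\<in>{..t}. ereal (?y u))"
    then have "ereal (min (?y t) (left_limit ?y t)) \<le> ereal (?y u)" if "u < t" for u
      using that by (simp only:) (rule INF_lower, simp)
    then show "\<forall>u<t. min (?y t) (left_limit ?y t) \<le> ?y u" by (simp only: ereal_less_eq) blast
  next
    assume low: "\<forall>u<t. min (?y t) (left_limit ?y t) \<le> ?y u"
    show "ereal (min (?y t) (left_limit ?y t)) = (INF u\<in>{..t}. ereal (?y u))"
    proof (rule antisym)
      show "ereal (min (?y t) (left_limit ?y t)) \<le> (INF u\<in>{..t}. ereal (?y u))"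
      proof (rule INF_greatest)
        fix u assume "u \<in> {..t}"
        then have "u < t \<or> u = t" by auto
        then have "min (?y t) (left_limit ?y t) \<le> ?y u" using low by auto
        then show "ereal (min (?y t) (left_limit ?y t)) \<le> ereal (?y u)" by (simp only: ereal_less_eq)
      qed
      have "(INF u\<in>{..t}. ereal (?y u)) \<le> ereal (?y t)" by (rule INF_lower) simp
      moreover have "(INF u\<in>{..t}. ereal (?y u)) \<le> ereal (left_limit ?y t)"
      proof (rule tendsto_lowerbound)
        show "((\<lambda>u. ereal (?y u)) \<longlongrightarrow> ereal (left_limit ?y t)) (at_left t)"
          using left[of t] unfolding left_limit_eq[OF left] by (rule tendsto_ereal)
        show "\<forall>\<^sub>F u in at_left t. (INF u\<in>{..t}. ereal (?y u)) \<le> ereal (?y u)"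
          by (intro eventually_at_leftI[of "t - 1"] INF_lower) auto
      qed simp
      ultimately show "(INF u\<in>{..t}. ereal (?y u)) \<le> ereal (min (?y t) (left_limit ?y t))" by (simp add: min_def)
    qed
  qed
  then show ?thesis unfolding H_set_def inf_times_def min by (simp only:)
qed

text \<open>The negative part may have infinite expectation, so the decompositions of
  \<open>f - b\<close> into its own parts and into those of \<open>f\<close> and \<open>b\<close>
  are compared with all terms moved to sides where they are added. Only the finite \<open>u\<close>
  is cancelled.\<close>

lemma negative_drift:
  assumes "prob_space M" and f [measurable]: "f \<in> borel_measurable M"
    and fin: "(\<integral>\<^sup>+\<omega>. ennreal (max 0 (f \<omega>)) \<partial>M) < \<infinity>" and drift: "ext_expectation M f < ereal b"
  shows "(\<integral>\<^sup>+\<omega>. ennreal (f \<omega> - b) \<partial>M) < (\<integral>\<^sup>+\<omega>. ennreal (- (f \<omega> - b)) \<partial>M)"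
proof -
  interpret prob_space M by fact
  have trunc: "ennreal (max 0 x) = ennreal x" for x by (simp add: max_def ennreal_neg)
  define P where "P = (\<integral>\<^sup>+\<omega>. ennreal (f \<omega>) \<partial>M)"
  define N where "N = (\<integral>\<^sup>+\<omega>. ennreal (- f \<omega>) \<partial>M)"
  define u where "u = (\<integral>\<^sup>+\<omega>. ennreal (f \<omega> - b) \<partial>M)"
  define v where "v = (\<integral>\<^sup>+\<omega>. ennreal (- (f \<omega> - b)) \<partial>M)"
  have P: "P < \<infinity>" using fin by (simp add: P_def trunc)
  have PN: "enn2ereal P - enn2ereal N < ereal b"
    using drift unfolding ext_expectation_def trunc P_def N_def .
  have gap: "P + ennreal (- b) < N + ennreal b"
  proof (cases N)
    case top
    then show ?thesis using P by (simp add: less_top)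
  next
    case (real n)
    obtain p where p: "P = ennreal p" "0 \<le> p" using P by (cases P) auto
    have "p - n < b" using PN real p by (simp add: enn2ereal_ennreal)
    then show ?thesis
      unfolding p(1) real(2) using p(2) real(1)
      by (cases "b \<ge> 0") (simp_all add: ennreal_neg ennreal_plus[symmetric] ennreal_less_iff del: ennreal_plus)
  qed
  have balance: "u + (N + ennreal b) = v + (P + ennreal (- b))"
  proof -
    have "ennreal (x - b) + (ennreal (- x) + ennreal b) = ennreal (- (x - b)) + (ennreal x + ennreal (- b))" for x
    proof -
      have "ennreal (max 0 (x - b) + (max 0 (- x) + max 0 b)) = ennreal (max 0 (- (x - b)) + (max 0 x + max 0 (- b)))"
        by (rule arg_cong[where f=ennreal]) (auto simp: max_def)
      then have "ennreal (max 0 (x - b)) + (ennreal (max 0 (- x)) + ennreal (max 0 b)) =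
          ennreal (max 0 (- (x - b))) + (ennreal (max 0 x) + ennreal (max 0 (- b)))"
        by (simp add: ennreal_plus)
      then show ?thesis unfolding trunc .
    qed
    then have "(\<integral>\<^sup>+\<omega>. ennreal (f \<omega> - b) + (ennreal (- f \<omega>) + ennreal b) \<partial>M) =
        (\<integral>\<^sup>+\<omega>. ennreal (- (f \<omega> - b)) + (ennreal (f \<omega>) + ennreal (- b)) \<partial>M)"
      by (simp only:)
    then show ?thesis unfolding u_def v_def P_def N_def
      by (simp add: nn_integral_add emeasure_space_1)
  qed
  have "u \<le> (\<integral>\<^sup>+\<omega>. ennreal (f \<omega>) + ennreal (- b) \<partial>M)"
    unfolding u_def
  proof (rule nn_integral_mono)
    fix \<omega>
    have "ennreal (f \<omega> - b) \<le> ennreal (max 0 (f \<omega>) + max 0 (- b))" by (intro ennreal_leI) auto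
    also have "\<dots> = ennreal (f \<omega>) + ennreal (- b)" by (simp add: ennreal_plus trunc)
    finally show "ennreal (f \<omega> - b) \<le> ennreal (f \<omega>) + ennreal (- b)" .
  qed
  also have "\<dots> = P + ennreal (- b)" by (simp add: nn_integral_add P_def emeasure_space_1)
  also have "\<dots> < \<infinity>" using P by simp
  finally have u: "u < \<infinity>" .
  show ?thesis
  proof (rule ccontr)
    assume "\<not> ?thesis"
    then have "v \<le> u" by (simp add: u_def v_def not_less)
    then have "u + (N + ennreal b) \<le> u + (P + ennreal (- b))" unfolding balance by (rule add_right_mono)
    then have "N + ennreal b \<le> P + ennreal (- b)" using u by auto
    then show False using gap by simp
  qed
qed

theorem theorem2p1:
  fixes M :: "'a measure" and X :: "real \<Rightarrow> 'a \<Rightarrow> real" and \<alpha> :: real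
  assumes levy: "two_sided_levy M X"
    and X0: "\<forall>\<omega>\<in>space M. X 0 \<omega> = 0"
    and pos_int: "(\<integral>\<^sup>+\<omega>. ennreal (max 0 (X 1 \<omega>)) \<partial>M) < \<infinity>"
    and drift: "ereal \<alpha> > ext_expectation M (X 1)"
  shows "(\<forall>\<omega>\<in>space M. closed (H_set X \<alpha> \<omega>))
       \<and> H_set X \<alpha> \<in> measurable M Omega_bi
       \<and> (\<forall>a. distr M Omega_bi (\<lambda>\<omega>. (\<lambda>t. t + a) ` H_set X \<alpha> \<omega>) = distr M Omega_bi (H_set X \<alpha>))
       \<and> regenerative (distr M Omega_bi (H_set X \<alpha>))"
proof -
  have X: "levy_process M X" using levy by (rule levy_process.intro)
  interpret X: levy_process M X by fact
  interpret Y: levy_process M "\<lambda>t \<omega>. X t \<omega> - \<alpha> * t" by (rule levy_process_drift[OF levy])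
  have neg: "(\<integral>\<^sup>+\<omega>. ennreal ((X 1 \<omega> - b * 1) - (X 0 \<omega> - b * 0)) \<partial>M) <
      (\<integral>\<^sup>+\<omega>. ennreal (- ((X 1 \<omega> - b * 1) - (X 0 \<omega> - b * 0))) \<partial>M)" if "ext_expectation M (X 1) < ereal b" for b
  proof -
    have *: "(\<integral>\<^sup>+\<omega>. F ((X 1 \<omega> - b * 1) - (X 0 \<omega> - b * 0)) \<partial>M) = (\<integral>\<^sup>+\<omega>. F (X 1 \<omega> - b) \<partial>M)" for F :: "real \<Rightarrow> ennreal"
      by (rule nn_integral_cong) (simp add: X0)
    show ?thesis
      using negative_drift[OF X.prob_space_axioms X.measurable_Y pos_int that] *[of ennreal] *[of "\<lambda>x. ennreal (- x)"] by simp
  qed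
  have H: "H_set X \<alpha> \<omega> = Y.infs \<omega>" if "\<omega> \<in> space M" for \<omega>
    unfolding Y.infs_def by (rule H_set_eq_inf_times[OF X that])
  \<comment> \<open>The walk with slope \<open>b\<close> is bounded above by some \<open>c\<close>,
    hence the one with slope \<open>\<alpha>\<close> by \<open>c - (\<alpha> - b) * k\<close>, which
    tends to minus infinity.\<close>
  obtain b where b: "ext_expectation M (X 1) < ereal b" "b < \<alpha>" using ereal_dense2[OF drift] by auto
  interpret Z: levy_process M "\<lambda>t \<omega>. X t \<omega> - b * t" by (rule levy_process_drift[OF levy])
  have fin: "AE \<omega> in M. \<forall>t. d_fun t (Y.infs \<omega>) < \<infinity>"
    using Y.past_bounded_below[OF neg[OF drift]] Z.forward_walk_bounded_above[OF neg[OF b(1)]] AE_space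
  proof eventually_elim
    fix \<omega> assume low: "\<exists>c. \<forall>v\<le>0. c \<le> X v \<omega> - \<alpha> * v"
      and up: "\<exists>c. \<forall>k::nat. X k \<omega> - b * k - (X 0 \<omega> - b * 0) \<le> c" and \<omega>: "\<omega> \<in> space M"
    obtain c where c: "\<And>k::nat. X k \<omega> - b * k \<le> c" using up X0 \<omega> by auto
    have "\<exists>k::nat. X k \<omega> - \<alpha> * k < z" for z
    proof -
      obtain k :: nat where k: "(c - z) / (\<alpha> - b) < k" using reals_Archimedean2 by blast
      then have "c - z < (\<alpha> - b) * k" using b(2) by (simp add: pos_divide_less_eq mult.commute)
      then have "X k \<omega> - \<alpha> * k < z" using c[of k] by (simp add: algebra_simps)
      then show ?thesis by blast
    qed
    then show "\<forall>t. d_fun t (Y.infs \<omega>) < \<infinity>"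
      unfolding Y.infs_def using inf_times_unbounded[OF Y.cadlag_Y[OF \<omega>] low] by blast
  qed
  have d1: "distr M Omega_bi (H_set X \<alpha>) = distr M Omega_bi Y.infs"
    by (rule distr_cong) (simp_all add: H)
  have d2: "distr M Omega_bi (\<lambda>\<omega>. (\<lambda>t. t + a) ` H_set X \<alpha> \<omega>) = distr M Omega_bi (\<lambda>\<omega>. (\<lambda>t. t + a) ` Y.infs \<omega>)" for a
    by (rule distr_cong) (simp_all add: H)
  have m: "H_set X \<alpha> \<in> measurable M Omega_bi"
    using Y.measurable_infs by (subst measurable_cong[OF H])
  show ?thesis
    unfolding d1 d2 regenerative_def
    using Y.closed_infs H m Y.infs_stationary Y.infs_regenerative[OF fin] by auto
qed

end
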